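(* Let $\{p_i\}_{i\in\mathbb Z}$ be complex numbers with $p_0\ne0$, and $p^\pm(z):=p_0^{\pm1}+\sum_{m=1}^\infty p_{\pm m}z^{\mp m}\in\mathbb C[[z^{\mp1}]]$. The irreducible highest weight $\ddot U_{q_1,q_2,q_3}(\mathfrak{gl}_1)$-module $V_{p^+,p^-}$ is of finite type (i.e. all its graded components are finite dimensional) if and only if there exists a rational function $P(z)$ such that $p^\pm(z)=P(z)^\pm$ and $P(0)P(\infty)=1$.
   Context: Let $q_1,q_2,q_3\in\mathbb C^*$ satisfy $q_1q_2q_3=1$ and $q_i^m\ne1$ for all $m\in\mathbb N$, $i\in\{1,2,3\}$. $\ddot U_{q_1,q_2,q_3}(\mathfrak{gl}_1)$ is the unital associative $\mathbb C$-algebra generated by $e_i,f_i,\psi_i,\psi_0^{-1}$ ($i\in\mathbb Z$) with, for $e(z)=\sum_{i\in\mathbb Z}e_iz^{-i}$, $f(z)=\sum_{i\in\mathbb Z}f_iz^{-i}$, $\psi^\pm(z)=\psi_0^{\pm1}+\sum_{j>0}\psi_{\pm j}z^{\mp j}$, $\delta(z)=\sum_{i\in\mathbb Z}z^i$ (products over $i=1,2,3$): - all $\psi_i$ commute, $\psi_0\psi_0^{-1}=\psi_0^{-1}\psi_0=1$; - $e(z)e(w)\prod_i(z-q_iw)=-e(w)e(z)\prod_i(w-q_iz)$; $f(z)f(w)\prod_i(w-q_iz)=-f(w)f(z)\prod_i(z-q_iw)$; - $[e(z),f(w)]=\frac{\delta(z/w)}{(1-q_1)(1-q_2)(1-q_3)}(\psi^+(w)-\psi^-(z))$;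 - $\psi^\pm(z)e(w)\prod_i(z-q_iw)=-e(w)\psi^\pm(z)\prod_i(w-q_iz)$; $\psi^\pm(z)f(w)\prod_i(w-q_iz)=-f(w)\psi^\pm(z)\prod_i(z-q_iw)$; - $\mathrm{Sym}_{\mathfrak S_3}[e_{i_1},[e_{i_2+1},e_{i_3-1}]]=0=\mathrm{Sym}_{\mathfrak S_3}[f_{i_1},[f_{i_2+1},f_{i_3-1}]]$ (sum over permutations of $i_1,i_2,i_3$). It is $\mathbb Z$-graded by $\deg e_i=-1$, $\deg f_i=1$, $\deg\psi_i=0$. The universal highest weight module $M_{p^+,p^-}$ is the quotient of $\ddot U_{q_1,q_2,q_3}(\mathfrak{gl}_1)$ by the left ideal generated by $\{f_i,\psi_i-p_i,\psi_0^{-1}-p_0^{-1}\}_{i\in\mathbb Z}$ (graded, with the highest weight vector in degree $0$), and $V_{p^+,p^-}$ is its unique irreducible quotient. For a rational function $P$, $P(z)^\pm$ denotes its expansion in $z^{\mp1}$, i.e. at $z=\infty$ for $+$ and at $z=0$ for $-$. *)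

theory Defs
  imports
    "HOL-Combinatorics.Permutations"
    "HOL-Computational_Algebra.Formal_Laurent_Series"
    "HOL-Library.Poly_Mapping"
    Complex_Main
    "HOL-Algebra.QuotRing"
    "HOL-Algebra.Module"
begin

section \<open>The free associative algebra\<close>

text \<open>Lists are wrapped so that concatenation can be used as the (noncommutative) addition that
  the convolution product of \<^typ>\<open>'a \<Rightarrow>\<^sub>0 'b\<close> refers to: then
  \<open>gen word \<Rightarrow>\<^sub>0 complex\<close> is the free unital associative complex algebra.\<close>

datatype 'a word = Word (letters: "'a list")

instantiation word :: (type) monoid_add
begin

definition zero_word :: "'a word" where
  "zero_word = Word []"

definition plus_word :: "'a word \<Rightarrow> 'a word \<Rightarrow> 'a word" where
  "plus_word u v = Word (letters u @ letters v)"

instance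
  by standard (simp_all add: zero_word_def plus_word_def)

end

text \<open>\<open>PsiInv\<close> stands for the generator \<open>\<psi>\<^sub>0\<^sup>-\<^sup>1\<close>.\<close>

datatype gen = E int | F int | Psi int | PsiInv

type_synonym free_alg = "gen word \<Rightarrow>\<^sub>0 complex"

definition gen :: "gen \<Rightarrow> free_alg" where
  "gen g = Poly_Mapping.single (Word [g]) 1"

definition scal :: "complex \<Rightarrow> free_alg" where
  "scal c = Poly_Mapping.single 0 c"

definition FA :: "free_alg ring" where
  "FA = \<lparr>carrier = UNIV, mult = (*), one = 1, zero = 0, add = (+)\<rparr>"

fun gen_deg :: "gen \<Rightarrow> int" where
  "gen_deg (E i) = -1"
| "gen_deg (F i) = 1"
| "gen_deg (Psi i) = 0"
| "gen_deg PsiInv = 0"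

definition FA_component :: "int \<Rightarrow> free_alg set" where
  "FA_component d = {x. \<forall>u\<in>Poly_Mapping.keys x. (\<Sum>g\<leftarrow>letters u. gen_deg g) = d}"

section \<open>Generating series and the defining relations\<close>

text \<open>A formal series in \<open>z\<close> is the function sending \<open>m\<close> to its coefficient at \<open>z\<^sup>m\<close>; so the
  coefficient of \<open>e(z)\<close> at \<open>z\<^sup>m\<close> is the generator with index \<open>-m\<close>. A formal series in \<open>z\<close> and \<open>w\<close>
  sends \<open>m\<close>, \<open>n\<close> to its coefficient at \<open>z\<^sup>m w\<^sup>n\<close>.\<close>

type_synonym ser1 = "int \<Rightarrow> free_alg"
type_synonym ser2 = "int \<Rightarrow> int \<Rightarrow> free_alg"

definition e_ser :: ser1 where
  "e_ser m = gen (E (- m))"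

definition f_ser :: ser1 where
  "f_ser m = gen (F (- m))"

definition psi_plus :: ser1 where
  "psi_plus m = (if m \<le> 0 then gen (Psi (- m)) else 0)"

definition psi_minus :: ser1 where
  "psi_minus m = (if m = 0 then gen PsiInv else if m > 0 then gen (Psi (- m)) else 0)"

text \<open>The product of \<open>a z + b w\<close> with a series.\<close>

definition lin_mult :: "complex \<Rightarrow> complex \<Rightarrow> ser2 \<Rightarrow> ser2" where
  "lin_mult a b A = (\<lambda>m n. scal a * A (m - 1) n + scal b * A m (n - 1))"

text \<open>The products of \<open>(z - q\<^sub>1 w)(z - q\<^sub>2 w)(z - q\<^sub>3 w)\<close>, respectively
  \<open>(w - q\<^sub>1 z)(w - q\<^sub>2 z)(w - q\<^sub>3 z)\<close>, with a series.\<close>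

definition cubic_zw :: "complex \<Rightarrow> complex \<Rightarrow> complex \<Rightarrow> ser2 \<Rightarrow> ser2" where
  "cubic_zw q1 q2 q3 A = lin_mult 1 (- q1) (lin_mult 1 (- q2) (lin_mult 1 (- q3) A))"

definition cubic_wz :: "complex \<Rightarrow> complex \<Rightarrow> complex \<Rightarrow> ser2 \<Rightarrow> ser2" where
  "cubic_wz q1 q2 q3 A = lin_mult (- q1) 1 (lin_mult (- q2) 1 (lin_mult (- q3) 1 A))"

text \<open>Coefficients of \<open>X(z) Y(w) (\<Prod>i. z - q\<^sub>i w) + Y(w) X(z) (\<Prod>i. w - q\<^sub>i z)\<close>, respectively of
  the same expression with the two cubic factors interchanged.\<close>

definition exchange_e :: "complex \<Rightarrow> complex \<Rightarrow> complex \<Rightarrow> ser1 \<Rightarrow> ser1 \<Rightarrow> free_alg set" where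
  "exchange_e q1 q2 q3 X Y =
     {cubic_zw q1 q2 q3 (\<lambda>m n. X m * Y n) a b + cubic_wz q1 q2 q3 (\<lambda>m n. Y n * X m) a b | a b. True}"

definition exchange_f :: "complex \<Rightarrow> complex \<Rightarrow> complex \<Rightarrow> ser1 \<Rightarrow> ser1 \<Rightarrow> free_alg set" where
  "exchange_f q1 q2 q3 X Y =
     {cubic_wz q1 q2 q3 (\<lambda>m n. X m * Y n) a b + cubic_zw q1 q2 q3 (\<lambda>m n. Y n * X m) a b | a b. True}"

definition comm :: "free_alg \<Rightarrow> free_alg \<Rightarrow> free_alg" where
  "comm x y = x * y - y * x"

text \<open>The coefficient at \<open>z\<^sup>m w\<^sup>n\<close> of both \<open>\<delta>(z/w) A(w)\<close> and \<open>\<delta>(z/w) A(z)\<close> is the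
  coefficient of \<open>A\<close> at the exponent \<open>m + n\<close>.\<close>

definition ef_rel :: "complex \<Rightarrow> complex \<Rightarrow> complex \<Rightarrow> free_alg set" where
  "ef_rel q1 q2 q3 =
     {comm (e_ser m) (f_ser n)
        - scal (1 / ((1 - q1) * (1 - q2) * (1 - q3))) * (psi_plus (m + n) - psi_minus (m + n)) | m n. True}"

definition serre_rel :: "(int \<Rightarrow> free_alg) \<Rightarrow> free_alg set" where
  "serre_rel x =
     {\<Sum>\<pi> | \<pi> permutes {1, 2, 3}. comm (x (i (\<pi> 1))) (comm (x (i (\<pi> 2) + 1)) (x (i (\<pi> 3) - 1)))
      | i :: nat \<Rightarrow> int. True}"

definition toroidal_rels :: "complex \<Rightarrow> complex \<Rightarrow> complex \<Rightarrow> free_alg set" where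
  "toroidal_rels q1 q2 q3 =
     {comm (gen (Psi i)) (gen (Psi j)) | i j. True}
     \<union> {gen (Psi 0) * gen PsiInv - 1, gen PsiInv * gen (Psi 0) - 1}
     \<union> exchange_e q1 q2 q3 e_ser e_ser
     \<union> exchange_f q1 q2 q3 f_ser f_ser
     \<union> ef_rel q1 q2 q3
     \<union> exchange_e q1 q2 q3 psi_plus e_ser
     \<union> exchange_e q1 q2 q3 psi_minus e_ser
     \<union> exchange_f q1 q2 q3 psi_plus f_ser
     \<union> exchange_f q1 q2 q3 psi_minus f_ser
     \<union> serre_rel (\<lambda>i. gen (E i))
     \<union> serre_rel (\<lambda>i. gen (F i))"

section \<open>The quantum toroidal algebra of \<open>gl\<^sub>1\<close>\<close>

text \<open>Scalars are central in the free algebra, so the two-sided ring ideal generated by the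
  relations is also a linear subspace.\<close>

definition toroidal_ideal :: "complex \<Rightarrow> complex \<Rightarrow> complex \<Rightarrow> free_alg set" where
  "toroidal_ideal q1 q2 q3 = Idl\<^bsub>FA\<^esub> (toroidal_rels q1 q2 q3)"

definition toroidal :: "complex \<Rightarrow> complex \<Rightarrow> complex \<Rightarrow> free_alg set ring" where
  "toroidal q1 q2 q3 = FA Quot (toroidal_ideal q1 q2 q3)"

definition toroidal_class :: "complex \<Rightarrow> complex \<Rightarrow> complex \<Rightarrow> free_alg \<Rightarrow> free_alg set" where
  "toroidal_class q1 q2 q3 x = toroidal_ideal q1 q2 q3 +>\<^bsub>FA\<^esub> x"

definition toroidal_component :: "complex \<Rightarrow> complex \<Rightarrow> complex \<Rightarrow> int \<Rightarrow> free_alg set set" where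
  "toroidal_component q1 q2 q3 d = toroidal_class q1 q2 q3 ` FA_component d"

section \<open>Left modules over noncommutative rings\<close>

text \<open>The locale \<^locale>\<open>module\<close> requires a commutative ring, but the record of modules and the
  locale \<^locale>\<open>submodule\<close> do not. The record inherits the fields \<open>mult\<close> and \<open>one\<close> from rings;
  they play no role for modules.\<close>

definition regular_module :: "('a, 'b) ring_scheme \<Rightarrow> ('a, 'a) module" where
  "regular_module R =
     \<lparr>carrier = carrier R, mult = mult R, one = one R, zero = zero R, add = add R, smult = mult R\<rparr>"

definition quot_module :: "('a, 'b, 'c) module_scheme \<Rightarrow> 'b set \<Rightarrow> ('a, 'b set) module" where
  "quot_module M N =
     \<lparr>carrier = a_rcosets\<^bsub>M\<^esub> N, mult = undefined, one = undefined, zero = N, add = set_add M,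
      smult = (\<lambda>a X. \<Union>x\<in>X. N +>\<^bsub>M\<^esub> (a \<odot>\<^bsub>M\<^esub> x))\<rparr>"

definition left_ideal_gen :: "('a, 'b) ring_scheme \<Rightarrow> 'a set \<Rightarrow> 'a set" where
  "left_ideal_gen R S = \<Inter>{J. submodule J R (regular_module R) \<and> S \<subseteq> J}"

definition irreducible_module :: "('a, 'b) ring_scheme \<Rightarrow> ('a, 'c, 'd) module_scheme \<Rightarrow> bool" where
  "irreducible_module R V \<longleftrightarrow>
     carrier V \<noteq> {\<zero>\<^bsub>V\<^esub>} \<and> (\<forall>W. submodule W R V \<longrightarrow> W = {\<zero>\<^bsub>V\<^esub>} \<or> W = carrier V)"

section \<open>Highest weight modules\<close>

definition hw_left_ideal ::
    "complex \<Rightarrow> complex \<Rightarrow> complex \<Rightarrow> (int \<Rightarrow> complex) \<Rightarrow> free_alg set set" where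
  "hw_left_ideal q1 q2 q3 p =
     left_ideal_gen (toroidal q1 q2 q3)
       (toroidal_class q1 q2 q3 `
         (range (\<lambda>i. gen (F i))
          \<union> range (\<lambda>i. gen (Psi i) - scal (p i))
          \<union> {gen PsiInv - scal (inverse (p 0))}))"

definition universal_hw_module ::
    "complex \<Rightarrow> complex \<Rightarrow> complex \<Rightarrow> (int \<Rightarrow> complex) \<Rightarrow> (free_alg set, free_alg set set) module" where
  "universal_hw_module q1 q2 q3 p =
     quot_module (regular_module (toroidal q1 q2 q3)) (hw_left_ideal q1 q2 q3 p)"

text \<open>The grading of the algebra, pushed forward to the universal highest weight module and then to
  its quotient by \<open>N\<close>; the highest weight vector, the class of \<open>1\<close>, has degree \<open>0\<close>.\<close>

definition universal_hw_component ::
    "complex \<Rightarrow> complex \<Rightarrow> complex \<Rightarrow> (int \<Rightarrow> complex) \<Rightarrow> int \<Rightarrow> free_alg set set set" where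
  "universal_hw_component q1 q2 q3 p d =
     (\<lambda>x. hw_left_ideal q1 q2 q3 p +>\<^bsub>regular_module (toroidal q1 q2 q3)\<^esub> x) ` toroidal_component q1 q2 q3 d"

definition quot_component ::
    "complex \<Rightarrow> complex \<Rightarrow> complex \<Rightarrow> (int \<Rightarrow> complex) \<Rightarrow> free_alg set set set \<Rightarrow> int
       \<Rightarrow> free_alg set set set set" where
  "quot_component q1 q2 q3 p N d =
     (\<lambda>x. N +>\<^bsub>universal_hw_module q1 q2 q3 p\<^esub> x) ` universal_hw_component q1 q2 q3 p d"

text \<open>The complex numbers act on a module through the scalars of the algebra.\<close>

definition finite_dim ::
    "complex \<Rightarrow> complex \<Rightarrow> complex \<Rightarrow> (free_alg set, 'b, 'c) module_scheme \<Rightarrow> 'b set \<Rightarrow> bool" where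
  "finite_dim q1 q2 q3 V W \<longleftrightarrow>
     (\<exists>B. finite B \<and> B \<subseteq> W \<and>
       (\<forall>x\<in>W. \<exists>c. x = (\<Oplus>\<^bsub>V\<^esub>b\<in>B. toroidal_class q1 q2 q3 (scal (c b)) \<odot>\<^bsub>V\<^esub> b)))"

definition irreducible_quotient ::
    "complex \<Rightarrow> complex \<Rightarrow> complex \<Rightarrow> (int \<Rightarrow> complex) \<Rightarrow> free_alg set set set \<Rightarrow> bool" where
  "irreducible_quotient q1 q2 q3 p N \<longleftrightarrow>
     submodule N (toroidal q1 q2 q3) (universal_hw_module q1 q2 q3 p) \<and>
     irreducible_module (toroidal q1 q2 q3) (quot_module (universal_hw_module q1 q2 q3 p) N)"

definition finite_type ::
    "complex \<Rightarrow> complex \<Rightarrow> complex \<Rightarrow> (int \<Rightarrow> complex) \<Rightarrow> free_alg set set set \<Rightarrow> bool" where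
  "finite_type q1 q2 q3 p N \<longleftrightarrow>
     (\<forall>d. finite_dim q1 q2 q3 (quot_module (universal_hw_module q1 q2 q3 p) N)
            (quot_component q1 q2 q3 p N d))"

section \<open>Rational functions and their expansions\<close>

text \<open>A series in \<open>z\<^sup>-\<^sup>1\<close> is represented as a formal series in the variable \<open>u = z\<^sup>-\<^sup>1\<close>.\<close>

definition weight_plus :: "(int \<Rightarrow> complex) \<Rightarrow> complex fps" where
  "weight_plus p = Abs_fps (\<lambda>m. p (int m))"

definition weight_minus :: "(int \<Rightarrow> complex) \<Rightarrow> complex fps" where
  "weight_minus p = Abs_fps (\<lambda>m. if m = 0 then inverse (p 0) else p (- int m))"

text \<open>The Laurent expansions of \<open>A(z)/B(z)\<close> at \<open>z = 0\<close> (in the variable \<open>z\<close>) and at \<open>z = \<infinity>\<close>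
  (in the variable \<open>u\<close>, after substituting \<open>z = u\<^sup>-\<^sup>1\<close>).\<close>

definition expansion_zero :: "complex poly \<Rightarrow> complex poly \<Rightarrow> complex fls" where
  "expansion_zero A B = poly (map_poly fls_const A) fls_X / poly (map_poly fls_const B) fls_X"

definition expansion_infinity :: "complex poly \<Rightarrow> complex poly \<Rightarrow> complex fls" where
  "expansion_infinity A B =
     poly (map_poly fls_const A) fls_X_inv / poly (map_poly fls_const B) fls_X_inv"

text \<open>\<open>P(0)\<close> and \<open>P(\<infinity>)\<close> are the values of the rational function on the Riemann sphere, that is, its
  limits at these points.\<close>

definition rational_weight :: "(int \<Rightarrow> complex) \<Rightarrow> bool" where
  "rational_weight p \<longleftrightarrow>
     (\<exists>A B :: complex poly. B \<noteq> 0 \<and>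
        fps_to_fls (weight_plus p) = expansion_infinity A B \<and>
        fps_to_fls (weight_minus p) = expansion_zero A B \<and>
        (\<exists>P0 Pinf. ((\<lambda>z. poly A z / poly B z) \<longlongrightarrow> P0) (at 0) \<and>
                   ((\<lambda>z. poly A z / poly B z) \<longlongrightarrow> Pinf) at_infinity \<and>
                   P0 * Pinf = 1))"

end

theory Submission
  imports Defs
begin

text \<open>
  Write \<open>v\<close> for the highest weight vector of the irreducible module \<open>V\<close>, and \<open>V\<^sub>-\<^sub>k\<close> for its component of degree
  \<open>-k\<close>. Since the \<open>\<psi>\<close>'s and the \<open>f\<close>'s can be moved to the right, where they act on \<open>v\<close> by scalars, \<open>V\<^sub>-\<^sub>k\<close> is
  spanned by the words \<open>e\<^sub>i\<^sub>1 \<dots> e\<^sub>i\<^sub>k v\<close>. Let \<open>d = p\<^sup>+ - p\<^sup>-\<close>, a bilateral series. The weight is rational if and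
  only if \<open>A(z) d(z) = 0\<close> for some polynomial \<open>A \<noteq> 0\<close>: in that case \<open>A p\<^sup>+ = A p\<^sup>-\<close> is a polynomial \<open>B\<close>, and
  \<open>P = B/A\<close> has the values \<open>p\<^sub>0\<close> at \<open>\<infinity>\<close> and \<open>p\<^sub>0\<^sup>-\<^sup>1\<close> at 0 (\<open>rational_weight_iff_recurrent\<close>).

  If \<open>V\<^sub>-\<^sub>1\<close> is finite dimensional, the vectors \<open>e\<^sub>i v\<close> satisfy a linear relation; applying all \<open>f\<^sub>j\<close> to it turns it
  into a recurrence for the coefficients of \<open>d\<close> (\<open>recurrent_of_finite_span\<close>).

  Conversely, suppose that \<open>A d = 0\<close>. By induction on \<open>k\<close> there is a polynomial \<open>A\<^sub>k\<close>, not vanishing at 0, such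
  that \<open>A\<^sub>k(w) e(w)\<close> and \<open>A\<^sub>k(w) (\<psi>\<^sup>+(w) - \<psi>\<^sup>-(w))\<close> kill \<open>V\<^sub>-\<^sub>k\<close>. For the second series the step from \<open>k\<close> to \<open>k + 1\<close>
  eliminates \<open>x\<close> between the relations \<open>A\<^sub>k(x) = 0\<close> and \<open>A\<^sub>k(w) \<Prod>\<^sub>i (w - q\<^sub>i x) = 0\<close> that hold on
  \<open>(\<psi>\<^sup>+(w) - \<psi>\<^sup>-(w)) e(x)\<close>, which leads to \<open>A\<^sub>k\<^sub>+\<^sub>1(w) = A\<^sub>k(w) \<Prod>\<^sub>i A\<^sub>k(w/q\<^sub>i)\<close>. For the first one it then suffices,
  by irreducibility, to commute \<open>A\<^sub>k\<^sub>+\<^sub>1(w) e(w)\<close> with the \<open>f\<^sub>j\<close> (\<open>annihilates_Suc\<close>). A series killed by a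
  polynomial that does not vanish at 0 has only finitely many independent coefficients, so
  \<open>V\<^sub>-\<^sub>k\<^sub>-\<^sub>1\<close> is finite dimensional if \<open>V\<^sub>-\<^sub>k\<close> is (\<open>finite_span_of_recurrent\<close>).

  Irreducibility is used in the form that a vector of negative degree that is killed by all \<open>f\<^sub>j\<close> is zero
  (\<open>singular_vanish\<close>): the submodule that it generates lives in negative degrees. To conclude that
  this submodule is proper one has to know that \<open>v\<close> is not a sum of vectors of negative degrees. The
  submodule \<open>N\<close> with \<open>V = M/N\<close> is not assumed to be graded, so this needs a proof. The series \<open>\<psi>\<^sup>\<plusminus>\<close> act on
  \<open>e(w\<^sub>1) \<dots> e(w\<^sub>m) v\<close> as multiplication by \<open>p\<^sup>\<plusminus>(z) \<Prod>\<^sub>l \<Prod>\<^sub>i (z - w\<^sub>l/q\<^sub>i) / (z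
    - q\<^sub>i w\<^sub>l)\<close>. One can extract from them series
  that act as \<open>\<Prod>\<^sub>l (1 - w\<^sub>l/z)\<close> and \<open>\<Prod>\<^sub>l (1 - z/w\<^sub>l)\<close> (\<open>intertwiner_exists\<close>); this works because no
  \<open>\<Sum>\<^sub>i (q\<^sub>i\<^sup>n - q\<^sub>i\<^sup>-\<^sup>n)\<close> with \<open>n > 0\<close> is zero. Their coefficients at \<open>z\<^sup>\<mp>\<^sup>m\<close> multiply by \<open>\<plusminus>\<Prod>\<^sub>l w\<^sub>l\<close>
    and \<open>\<plusminus>\<Prod>\<^sub>l w\<^sub>l\<^sup>-\<^sup>1\<close> in
  degree \<open>-m\<close> and kill \<open>v\<close>, so their product is an operator that is the identity on \<open>V\<^sub>-\<^sub>m\<close> and kills \<open>v\<close>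
  (\<open>degree_detector\<close>).
\<close>

section \<open>Power series that commute with a family up to a twist\<close>

text \<open>The free algebra is noncommutative, so it is no algebra over \<open>complex\<close> in the sense of
  a type class; the locale keeps the central scalars as an explicit map.\<close>

locale scalar_ring =
  fixes sc :: "complex \<Rightarrow> 'r::ring_1"
  assumes sc_add: "sc (a + b) = sc a + sc b"
    and sc_mult: "sc (a * b) = sc a * sc b"
    and sc_one: "sc 1 = 1"
    and sc_central: "sc a * x = x * sc a"
begin

sublocale vs: vector_space "\<lambda>c x. sc c * x"
  by unfold_locales (simp_all add: sc_add sc_mult sc_one algebra_simps)

lemma sc_zero: "sc 0 = 0"
  using sc_add[of 0 0] by simp

lemma sc_minus: "sc (- a) = - sc a"
  using sc_add[of a "- a"] by (simp add: sc_zero add_eq_0_iff)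

lemma sc_diff: "sc (a - b) = sc a - sc b"
  using sc_add[of a "- b"] by (simp add: sc_minus)

lemma sc_sum: "sc (sum g S) = (\<Sum>s\<in>S. sc (g s))"
  by (induction S rule: infinite_finite_induct) (simp_all add: sc_zero sc_add)

lemma sc_left_commute: "x * (sc a * y) = sc a * (x * y)"
  by (metis mult.assoc sc_central)

text \<open>A family \<open>y\<close> is read as a generating series \<open>y(w)\<close>, and multiplication by \<open>w\<close> raises the
  index by one. So this is the series \<open>c(t w) y(w)\<close> in \<open>t\<close>, at index \<open>j\<close>.\<close>

definition twist :: "complex fps \<Rightarrow> (int \<Rightarrow> 'r) \<Rightarrow> int \<Rightarrow> 'r fps" where
  "twist c y j = Abs_fps (\<lambda>k. sc (c $ k) * y (j + int k))"

text \<open>The failure, in degree \<open>n\<close>, of the relation \<open>A(t) y(w) = c(t w) y(w) A(t)\<close>.\<close>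

definition defect :: "'r fps \<Rightarrow> complex fps \<Rightarrow> (int \<Rightarrow> 'r) \<Rightarrow> int \<Rightarrow> nat \<Rightarrow> 'r" where
  "defect A c y j n = (A * fps_const (y j) - twist c y j * A) $ n"

lemma twist_nth: "twist c y j $ k = sc (c $ k) * y (j + int k)"
  by (simp add: twist_def)

lemma defect_eq:
  "defect A c y j n = A $ n * y j - (\<Sum>k=0..n. sc (c $ k) * y (j + int k) * A $ (n - k))"
  by (simp add: defect_def fps_mult_nth[of "twist c y j"] twist_nth)

lemma defect_cong:
  assumes "\<And>k. k \<le> n \<Longrightarrow> A $ k = A' $ k"
  shows "defect A c y j n = defect A' c y j n"
  unfolding defect_eq using assms by simp

text \<open>Moving \<open>A\<close> past a product of twists one index at a time: each step costs one defect. This is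
  the bookkeeping behind both the composition and the cancellation of twisted commutation
  relations below.\<close>

lemma commute_past_twist:
  "(A * twist c' y j - twist (c * c') y j * A) $ m
     = (\<Sum>k=0..m. sc (c' $ k) * defect A c y (j + int k) (m - k))"
proof -
  define g where "g i k l = sc (c' $ i) * (sc (c $ k) * y (j + int i + int k) * A $ l)" for i k l
  have "(twist (c * c') y j * A) $ m
        = (\<Sum>t=0..m. sc ((c' * c) $ t) * y (j + int t) * A $ (m - t))"
    by (subst mult.commute[of c c']) (simp only: fps_mult_nth twist_nth)
  also have "\<dots> = (\<Sum>t=0..m. \<Sum>i=0..t. g i (t - i) (m - t))"
    by (intro sum.cong refl)
       (simp add: fps_mult_nth[of c' c] sc_sum sc_mult sum_distrib_right g_def mult.assoc
         del: vs.scale_scale)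
  also have "\<dots> = (\<Sum>i=0..m. \<Sum>k=0..m - i. g i k (m - i - k))"
    by (rule fps_mult_assoc_lemma)
  finally have 1: "(twist (c * c') y j * A) $ m = (\<Sum>i=0..m. \<Sum>k=0..m - i. g i k (m - i - k))" .
  have "(A * twist c' y j) $ m = (\<Sum>k=0..m. A $ (m - k) * (sc (c' $ k) * y (j + int k)))"
    unfolding fps_mult_nth twist_nth
    by (rule sum.reindex_bij_witness[of _ "\<lambda>k. m - k" "\<lambda>k. m - k"]) auto
  also have "\<dots> = (\<Sum>k=0..m. sc (c' $ k) * (A $ (m - k) * y (j + int k)))"
    by (simp add: sc_left_commute)
  finally have 2: "(A * twist c' y j) $ m = (\<Sum>k=0..m. sc (c' $ k) * (A $ (m - k) * y (j + int k)))" .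
  show ?thesis
    unfolding fps_sub_nth 1 2 defect_eq g_def
    by (simp add: right_diff_distrib sum_subtractf sum_distrib_left)
qed

definition rescale :: "complex \<Rightarrow> 'r fps \<Rightarrow> 'r fps" where
  "rescale a A = Abs_fps (\<lambda>n. sc (a ^ n) * A $ n)"

lemma rescale_nth: "rescale a A $ n = sc (a ^ n) * A $ n"
  by (simp add: rescale_def)

lemma defect_rescale:
  "defect (rescale a A) (Abs_fps (\<lambda>n. a ^ n * c $ n)) y j n = sc (a ^ n) * defect A c y j n"
proof -
  have "sc (a ^ k * c $ k) * y (j + int k) * (sc (a ^ (n - k)) * A $ (n - k))
      = sc (a ^ n) * (sc (c $ k) * y (j + int k) * A $ (n - k))" if "k \<le> n" for k
  proof -
    have "a ^ n = a ^ k * a ^ (n - k)"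
      using that by (metis le_add_diff_inverse power_add)
    moreover have "y (j + int k) * (sc (a ^ (n - k)) * A $ (n - k))
        = sc (a ^ (n - k)) * (y (j + int k) * A $ (n - k))"
      by (rule sc_left_commute)
    ultimately show ?thesis
      by (simp add: mult.assoc ac_simps)
  qed
  then show ?thesis
    unfolding defect_eq rescale_nth
    by (simp add: right_diff_distrib sum_distrib_left mult.assoc)
qed

definition unipotent :: "'r set \<Rightarrow> 'r fps set" where
  "unipotent R = {A. A $ 0 = 1 \<and> (\<forall>n>0. A $ n \<in> R)}"

lemma unipotent_mult:
  assumes R: "vs.subspace R" "\<And>a b. a \<in> R \<Longrightarrow> b \<in> R \<Longrightarrow> a * b \<in> R"
    and A: "A \<in> unipotent R" and B: "B \<in> unipotent R"
  shows "A * B \<in> unipotent R"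
proof -
  have "(A * B) $ n \<in> R" if "n > 0" for n
    unfolding fps_mult_nth
  proof (rule vs.subspace_sum[OF R(1)])
    fix i assume "i \<in> {0..n}"
    then show "A $ i * B $ (n - i) \<in> R"
      using A B R(2) that by (cases "i = 0"; cases "i = n") (auto simp: unipotent_def)
  qed
  then show ?thesis
    using A B by (simp add: unipotent_def)
qed

lemma unipotent_rescale:
  assumes "vs.subspace R" "A \<in> unipotent R"
  shows "rescale a A \<in> unipotent R"
  using assms vs.subspace_scale[OF assms(1)] by (auto simp: unipotent_def rescale_nth sc_one)

lemma mult_top_coeff:
  fixes A A' B B' :: "'r fps"
  assumes "\<And>k. k < n \<Longrightarrow> A' $ k = A $ k" "\<And>k. k < n \<Longrightarrow> B' $ k = B $ k"
    and "n > 0" "A $ 0 = 1" "B $ 0 = 1"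
  shows "(A' * B') $ n = (A * B) $ n + (A' $ n - A $ n) + (B' $ n - B $ n)"
    and "\<And>k. k < n \<Longrightarrow> (A' * B') $ k = (A * B) $ k"
proof -
  have split: "(\<Sum>i=0..n. h i) = h 0 + (\<Sum>i=1..<n. h i) + h n" for h :: "nat \<Rightarrow> 'r"
    using \<open>n > 0\<close>
    by (simp add: sum.atLeast_Suc_atMost[of 0 n] sum.last_plus[of "Suc 0" n] ac_simps)
  have "(\<Sum>i=1..<n. A' $ i * B' $ (n - i)) = (\<Sum>i=1..<n. A $ i * B $ (n - i))"
    using assms(1,2) by (intro sum.cong) auto
  then show "(A' * B') $ n = (A * B) $ n + (A' $ n - A $ n) + (B' $ n - B $ n)"
    unfolding fps_mult_nth split using assms by (simp add: algebra_simps)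
  show "(A' * B') $ k = (A * B) $ k" if "k < n" for k
    unfolding fps_mult_nth using that assms(1,2) by (intro sum.cong) auto
qed

end

text \<open>Relations hold modulo a two-sided ideal. Congruences are used in place of a quotient ring,
  because the ideal depends on the parameters \<open>q\<^sub>i\<close> and the quotient is therefore no type.\<close>

locale scalar_ideal = scalar_ring sc for sc :: "complex \<Rightarrow> 'r::ring_1" +
  fixes I :: "'r set"
  assumes zero_I: "0 \<in> I"
    and add_I: "\<lbrakk>x \<in> I; y \<in> I\<rbrakk> \<Longrightarrow> x + y \<in> I"
    and left_I: "x \<in> I \<Longrightarrow> a * x \<in> I"
    and right_I: "x \<in> I \<Longrightarrow> x * a \<in> I"
begin

lemma minus_I: "x \<in> I \<Longrightarrow> - x \<in> I"
  using left_I[of x "- 1"] by simp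

lemma diff_I: "\<lbrakk>x \<in> I; y \<in> I\<rbrakk> \<Longrightarrow> x - y \<in> I"
  using add_I[of x "- y"] minus_I by simp

lemma sum_I: "(\<And>s. s \<in> S \<Longrightarrow> g s \<in> I) \<Longrightarrow> sum g S \<in> I"
  by (induction S rule: infinite_finite_induct) (auto simp: zero_I add_I)

lemma cancel_I: "x \<in> I \<Longrightarrow> x + y \<in> I \<longleftrightarrow> y \<in> I"
  using add_I[of x y] diff_I[of "x + y" x] by auto

lemma cong_I: "x - y \<in> I \<Longrightarrow> x \<in> I \<longleftrightarrow> y \<in> I"
  using cancel_I[of "x - y" y] by simp

lemma trans_I: "x - y \<in> I \<Longrightarrow> y - z \<in> I \<Longrightarrow> x - z \<in> I"
  using add_I[of "x - y" "y - z"] by simp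

text \<open>The relation \<open>A(t) y(w) = c(t w) y(w) A(t)\<close> modulo \<open>I\<close> and \<open>t\<^sup>n\<close>, with both series normalized.\<close>

definition intertwines :: "(int \<Rightarrow> 'r) \<Rightarrow> nat \<Rightarrow> 'r fps \<Rightarrow> complex fps \<Rightarrow> bool" where
  "intertwines y n A c \<longleftrightarrow> A $ 0 = 1 \<and> c $ 0 = 1 \<and> (\<forall>j. \<forall>k<n. defect A c y j k \<in> I)"

text \<open>To leading order the defect is additive in products, like a logarithmic derivative: lower
  coefficients of the defects vanish by assumption, and the constant terms are 1.\<close>

lemma defect_mult:
  assumes A: "intertwines y n A c" and B: "intertwines y n B c'"
  shows "defect (A * B) (c * c') y j n - (defect A c y j n + defect B c' y j n) \<in> I"
proof -
  define D where "D = B * fps_const (y j) - twist c' y j * B"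
  define D' where "D' = A * twist c' y j - twist (c * c') y j * A"
  have D: "D $ k = defect B c' y j k" for k
    by (simp add: D_def defect_def)
  have D': "D' $ m = (\<Sum>k=0..m. sc (c' $ k) * defect A c y (j + int k) (m - k))" for m
    unfolding D'_def by (rule commute_past_twist)
  have D'_low: "D' $ m \<in> I" if "m < n" for m
    unfolding D' using that A by (auto intro!: sum_I left_I simp: intertwines_def)
  have "D' $ n = defect A c y j n + (\<Sum>k=1..n. sc (c' $ k) * defect A c y (j + int k) (n - k))"
    unfolding D' using B by (simp add: sum.atLeast_Suc_atMost intertwines_def sc_one)
  moreover have "(\<Sum>k=1..n. sc (c' $ k) * defect A c y (j + int k) (n - k)) \<in> I"
    using A by (auto intro!: sum_I left_I simp: intertwines_def)
  ultimately have D'_top: "D' $ n - defect A c y j n \<in> I"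
    by simp
  have "(A * D) $ n = D $ n + (\<Sum>k=1..n. A $ k * D $ (n - k))"
    using A by (simp add: fps_mult_nth sum.atLeast_Suc_atMost intertwines_def)
  moreover have "(\<Sum>k=1..n. A $ k * D $ (n - k)) \<in> I"
    using B by (auto intro!: sum_I left_I simp: intertwines_def D)
  ultimately have AD: "(A * D) $ n - defect B c' y j n \<in> I"
    by (simp add: D)
  have "(D' * B) $ n = D' $ n + (\<Sum>k<n. D' $ k * B $ (n - k))"
    using B by (simp add: fps_mult_nth intertwines_def atLeast0AtMost lessThan_Suc_atMost[symmetric] add.commute)
  moreover have "(\<Sum>k<n. D' $ k * B $ (n - k)) \<in> I"
    by (auto intro!: sum_I right_I D'_low)
  ultimately have "(D' * B) $ n - D' $ n \<in> I"
    by simp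
  from add_I[OF this D'_top] have D'B: "(D' * B) $ n - defect A c y j n \<in> I"
    by simp
  have "A * B * fps_const (y j) - twist (c * c') y j * (A * B) = A * D + D' * B"
    by (simp add: D_def D'_def algebra_simps)
  then have "defect (A * B) (c * c') y j n = (A * D) $ n + (D' * B) $ n"
    by (simp only: defect_def fps_add_nth)
  then show ?thesis
    using add_I[OF AD D'B] by (simp add: algebra_simps)
qed

lemma intertwines_mult:
  assumes "intertwines y n A c" "intertwines y n B c'"
  shows "intertwines y n (A * B) (c * c')"
  unfolding intertwines_def
proof (intro conjI allI impI)
  fix j k assume "k < n"
  then have *: "intertwines y k A c" "intertwines y k B c'"
    using assms by (auto simp: intertwines_def)
  have "defect A c y j k + defect B c' y j k \<in> I"
    using assms \<open>k < n\<close> by (auto simp: intertwines_def intro: add_I)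
  with cong_I[OF defect_mult[OF *]] show "defect (A * B) (c * c') y j k \<in> I"
    by blast
qed (use assms in \<open>auto simp: intertwines_def\<close>)

text \<open>A relation \<open>A(t) a(t w) y(w) = b(t w) y(w) A(t)\<close> can be divided by \<open>a\<close>, one order at a
  time, because \<open>a\<close> has constant term 1.\<close>

lemma intertwines_cancel:
  assumes "\<And>j m. (A * twist a y j - twist (c * a) y j * A) $ m \<in> I"
    and "A $ 0 = 1" "a $ 0 = 1" "c $ 0 = 1"
  shows "intertwines y n A c"
proof -
  have "\<forall>j. defect A c y j m \<in> I" for m
  proof (induction m rule: less_induct)
    case (less m)
    show ?case
    proof
      fix j
      have "(\<Sum>k=0..m. sc (a $ k) * defect A c y (j + int k) (m - k)) \<in> I"
        using assms(1)[of j m] unfolding commute_past_twist .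
      then have "defect A c y j m + (\<Sum>k=1..m. sc (a $ k) * defect A c y (j + int k) (m - k)) \<in> I"
        using assms(3) by (simp add: sum.atLeast_Suc_atMost sc_one)
      moreover have "(\<Sum>k=1..m. sc (a $ k) * defect A c y (j + int k) (m - k)) \<in> I"
        using less by (auto intro!: sum_I left_I)
      ultimately show "defect A c y j m \<in> I"
        by (metis cancel_I add.commute)
    qed
  qed
  then show ?thesis
    using assms by (simp add: intertwines_def)
qed

end

text \<open>With \<open>x y z = 1\<close>, the difference of \<open>x + y + z\<close> and \<open>1/x + 1/y + 1/z\<close> is
  \<open>-(1 - x)(1 - y)(1 - z)\<close>; this is where the genericity of the \<open>q\<^sub>i\<close> enters.\<close>

lemma sum_power_diff_nonzero:
  fixes q1 q2 q3 :: complex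
  assumes "q1 * q2 * q3 = 1" "q1 ^ n \<noteq> 1" "q2 ^ n \<noteq> 1" "q3 ^ n \<noteq> 1"
  shows "(q1 ^ n + q2 ^ n + q3 ^ n) - (inverse q1 ^ n + inverse q2 ^ n + inverse q3 ^ n) \<noteq> 0"
proof -
  define x y z where "x = q1 ^ n" and "y = q2 ^ n" and "z = q3 ^ n"
  have xyz: "x * y * z = 1"
    using assms(1) by (metis power_mult_distrib power_one x_def y_def z_def)
  then have "inverse x = y * z" "inverse y = x * z" "inverse z = x * y"
    by (auto intro!: inverse_unique simp: ac_simps)
  then have "(x + y + z) - (inverse x + inverse y + inverse z) = - ((1 - x) * (1 - y) * (1 - z))"
    using xyz by (simp add: algebra_simps)
  also have "\<dots> \<noteq> 0"
    using assms by (simp add: x_def y_def z_def)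
  finally show ?thesis
    by (simp add: x_def y_def z_def power_inverse)
qed

definition lin :: "complex \<Rightarrow> complex fps" where
  "lin a = 1 - fps_const a * fps_X"

lemma lin_nth: "lin a $ k = (if k = 0 then 1 else if k = 1 then - a else 0)"
  by (auto simp: lin_def)

lemma lin_rescale: "Abs_fps (\<lambda>n. a ^ n * lin 1 $ n) = lin a"
  by (rule fps_ext) (simp add: lin_nth)

context scalar_ideal begin

text \<open>If \<open>\<Phi>\<close> multiplies \<open>y(w)\<close> by \<open>\<Prod>\<^sub>i (1 - t w / q\<^sub>i) / (1 - t w q\<^sub>i)\<close>, then \<open>\<Phi>\<close> has a "root" \<open>U\<close> that
  multiplies \<open>y(w)\<close> by the elementary factor \<open>1 - t w\<close>. It solves
  \<open>\<Phi>(t) U(q\<^sub>1 t) U(q\<^sub>2 t) U(q\<^sub>3 t) = U(t/q\<^sub>1) U(t/q\<^sub>2) U(t/q\<^sub>3)\<close>. The coefficient of \<open>U\<close> at \<open>t\<^sup>n\<close> enters this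
  equation with the factor \<open>\<Sum>\<^sub>i (q\<^sub>i\<^sup>n - q\<^sub>i\<^sup>-\<^sup>n)\<close>, up to terms in lower coefficients, so the equation can be
  solved recursively. By additivity of defects the same factor multiplies the defect of \<open>U\<close>, which
  therefore vanishes. All coefficients but the constant one stay in any subalgebra \<open>R\<close> that
  contains those of \<open>\<Phi>\<close>.\<close>

lemma intertwiner_exists:
  assumes prod: "q1 * q2 * q3 = 1"
    and nontorsion: "\<And>m::nat. m > 0 \<Longrightarrow> q1 ^ m \<noteq> 1 \<and> q2 ^ m \<noteq> 1 \<and> q3 ^ m \<noteq> 1"
    and R: "vs.subspace R" "\<And>a b. a \<in> R \<Longrightarrow> b \<in> R \<Longrightarrow> a * b \<in> R"
    and \<Phi>: "\<Phi> \<in> unipotent R" "\<And>n. intertwines y n \<Phi> c"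
    and c: "c * (lin q1 * lin q2 * lin q3) = lin (inverse q1) * lin (inverse q2) * lin (inverse q3)"
  shows "\<exists>E \<in> unipotent R. intertwines y (Suc n) E (lin 1)"
proof -
  \<comment> \<open>both sides of the equation for the root are of this form\<close>
  define T where "T a b d E = rescale a E * rescale b E * rescale d E" for a b d and E :: "'r fps"
  define T1 where "T1 = T q1 q2 q3"
  define T2 where "T2 = T (inverse q1) (inverse q2) (inverse q3)"
  have T_low: "T a b d E' $ k = T a b d E $ k"
    and T_top: "T a b d E' $ n = T a b d E $ n + sc (a ^ n + b ^ n + d ^ n) * (E' $ n - E $ n)"
    if "E $ 0 = 1" "n > 0" "\<And>k. k < n \<Longrightarrow> E' $ k = E $ k" "k < n" for a b d E E' n k
  proof -
    have r: "rescale x E' $ k = rescale x E $ k" if "k < n" for x k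
      using \<open>\<And>k. k < n \<Longrightarrow> E' $ k = E $ k\<close> that by (simp add: rescale_nth)
    have z: "rescale x E $ 0 = 1" for x
      using that by (simp add: rescale_nth sc_one)
    note 1 = mult_top_coeff[of n "rescale a E'" "rescale a E" "rescale b E'" "rescale b E",
        OF r r \<open>n > 0\<close> z z]
    have z2: "(rescale a E * rescale b E) $ 0 = 1"
      by (simp add: z)
    note 2 = mult_top_coeff[of n "rescale a E' * rescale b E'" "rescale a E * rescale b E"
        "rescale d E'" "rescale d E", OF 1(2) r \<open>n > 0\<close> z2 z]
    have e1: "(rescale a E' * rescale b E') $ n = (rescale a E * rescale b E) $ n
        + (rescale a E' $ n - rescale a E $ n) + (rescale b E' $ n - rescale b E $ n)"
      by (rule 1(1))
    have e2: "(rescale a E' * rescale b E' * rescale d E') $ n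
        = (rescale a E * rescale b E * rescale d E) $ n
        + ((rescale a E' * rescale b E') $ n - (rescale a E * rescale b E) $ n)
        + (rescale d E' $ n - rescale d E $ n)"
      by (rule 2(1))
    show "T a b d E' $ k = T a b d E $ k"
      using 2(2) \<open>k < n\<close> by (simp add: T_def)
    show "T a b d E' $ n = T a b d E $ n + sc (a ^ n + b ^ n + d ^ n) * (E' $ n - E $ n)"
      unfolding T_def e2 e1 by (simp add: rescale_nth sc_add algebra_simps)
  qed
  have T_unip: "T a b d E \<in> unipotent R" if "E \<in> unipotent R" for a b d E
    unfolding T_def using that by (intro unipotent_mult unipotent_rescale R)
  have resc_int: "intertwines y n (rescale a E) (lin a)" if "intertwines y n E (lin 1)" for n a E
    using that left_I
    by (auto simp: intertwines_def defect_rescale[of a E "lin 1" y, unfolded lin_rescale]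
        rescale_nth sc_one lin_nth)
  have T_int: "intertwines y n (T a b d E) (lin a * lin b * lin d)"
    if "intertwines y n E (lin 1)" for n a b d E
    unfolding T_def by (intro intertwines_mult resc_int that)
  have T_defect: "defect (T a b d E) (lin a * lin b * lin d) y j n
      - sc (a ^ n + b ^ n + d ^ n) * defect E (lin 1) y j n \<in> I"
    if E: "intertwines y n E (lin 1)" for n a b d E j
  proof -
    have r: "defect (rescale x E) (lin x) y j n = sc (x ^ n) * defect E (lin 1) y j n" for x
      using defect_rescale[of x E "lin 1" y j n] unfolding lin_rescale .
    note 1 = defect_mult[OF resc_int[OF E, of a] resc_int[OF E, of b], of j]
    note 2 = defect_mult[OF intertwines_mult[OF resc_int[OF E, of a] resc_int[OF E, of b]]
        resc_int[OF E, of d], of j]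
    show ?thesis
      using add_I[OF 1 2] by (simp add: r T_def sc_add algebra_simps)
  qed
  have "\<exists>E \<in> unipotent R. intertwines y (Suc n) E (lin 1) \<and> (\<forall>k\<le>n. (\<Phi> * T1 E) $ k = T2 E $ k)"
  proof (induction n)
    case 0
    have "1 \<in> unipotent R"
      using R(1) by (auto simp: unipotent_def vs.subspace_0)
    moreover from this have "T2 1 \<in> unipotent R" "\<Phi> * T1 1 \<in> unipotent R"
      unfolding T1_def T2_def using \<Phi> by (auto intro: T_unip unipotent_mult R)
    moreover have "defect 1 (lin 1) y j 0 = 0" for j
      by (simp add: defect_eq lin_nth sc_one)
    ultimately show ?case
      by (intro bexI[of _ 1]) (auto simp: unipotent_def intertwines_def lin_nth zero_I)
  next
    case (Suc n)
    then obtain E where E: "E \<in> unipotent R" "intertwines y (Suc n) E (lin 1)"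
      and agree: "\<And>k. k \<le> n \<Longrightarrow> (\<Phi> * T1 E) $ k = T2 E $ k"
      by blast
    define N where "N = Suc n"
    \<comment> \<open>raising the order to \<open>N\<close>: \<open>\<kappa>\<close> is the factor with which the coefficient of the root at \<open>t\<^sup>N\<close> enters, \<open>\<delta>\<close>
      the error to be
      corrected\<close>
    define \<kappa> where "\<kappa> = (q1 ^ N + q2 ^ N + q3 ^ N) - (inverse q1 ^ N + inverse q2 ^ N + inverse q3 ^ N)"
    have \<kappa>: "\<kappa> \<noteq> 0"
      unfolding \<kappa>_def using sum_power_diff_nonzero[OF prod, of N] nontorsion[of N]
      by (simp only: N_def zero_less_Suc simp_thms)
    define \<delta> where "\<delta> = (\<Phi> * T1 E) $ N - T2 E $ N"
    have "\<Phi> * T1 E \<in> unipotent R" "T2 E \<in> unipotent R"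
      unfolding T1_def T2_def using \<Phi>(1) E(1) by (auto intro: T_unip unipotent_mult R)
    then have "\<delta> \<in> R"
      unfolding \<delta>_def using R(1) by (auto simp: unipotent_def N_def intro: vs.subspace_diff)
    define E' where "E' = E - fps_const (sc (1 / \<kappa>) * \<delta>) * fps_X ^ N"
    have E'_nth: "E' $ k = (if k = N then E $ N - sc (1 / \<kappa>) * \<delta> else E $ k)" for k
      by (simp add: E'_def fps_X_power_mult_right_nth)
    have E': "E' \<in> unipotent R"
      using E(1) \<open>\<delta> \<in> R\<close> R(1)
      by (auto simp: unipotent_def E'_nth N_def intro!: vs.subspace_diff vs.subspace_scale)
    have low: "E' $ k = E $ k" if "k < N" for k
      using that by (simp add: E'_nth)
    have E0: "E $ 0 = 1" "N > 0"
      using E(1) by (auto simp: unipotent_def N_def)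
    have int': "intertwines y N E' (lin 1)"
    proof -
      have "defect E' (lin 1) y j k = defect E (lin 1) y j k" if "k < N" for j k
        using that by (intro defect_cong) (simp add: low)
      then show ?thesis
        using E(2) E' by (auto simp: intertwines_def N_def unipotent_def)
    qed
    have T1_top: "T1 E' $ N = T1 E $ N - sc ((q1 ^ N + q2 ^ N + q3 ^ N) / \<kappa>) * \<delta>"
      unfolding T1_def
      using T_top[OF E0 low E0(2)]
      by (simp add: E'_nth low)
    have T2_top: "T2 E' $ N = T2 E $ N
        - sc ((inverse q1 ^ N + inverse q2 ^ N + inverse q3 ^ N) / \<kappa>) * \<delta>"
      unfolding T2_def
      using T_top[OF E0 low E0(2)]
      by (simp add: E'_nth low)
    have T1_low: "T1 E' $ k = T1 E $ k" "T2 E' $ k = T2 E $ k" if "k < N" for k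
      unfolding T1_def T2_def using T_low[OF E0 low that] by auto
    have \<Phi>0: "\<Phi> $ 0 = 1" "T1 E $ 0 = 1"
      using \<Phi>(1) T_unip[OF E(1)] by (auto simp: unipotent_def T1_def)
    note m = mult_top_coeff[of N \<Phi> \<Phi> "T1 E'" "T1 E", OF refl T1_low(1) \<open>N > 0\<close> \<Phi>0]
    have agree': "(\<Phi> * T1 E') $ k = T2 E' $ k" if "k \<le> N" for k
    proof (cases "k = N")
      case False
      then show ?thesis
        using that m(2)[of k] T1_low(2)[of k] agree[of k] by (simp add: N_def)
    next
      case True
      have "sc ((q1 ^ N + q2 ^ N + q3 ^ N) / \<kappa>)
          - sc ((inverse q1 ^ N + inverse q2 ^ N + inverse q3 ^ N) / \<kappa>) = 1"
        using \<kappa> by (simp add: \<kappa>_def flip: sc_diff diff_divide_distrib add: sc_one)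
      then have "sc ((q1 ^ N + q2 ^ N + q3 ^ N) / \<kappa>) * \<delta>
          - sc ((inverse q1 ^ N + inverse q2 ^ N + inverse q3 ^ N) / \<kappa>) * \<delta> = \<delta>"
        by (metis left_diff_distrib mult_1)
      moreover have "(\<Phi> * T1 E') $ N = (\<Phi> * T1 E) $ N - sc ((q1 ^ N + q2 ^ N + q3 ^ N) / \<kappa>) * \<delta>"
        using m(1) by (simp add: T1_top)
      moreover have "(\<Phi> * T1 E) $ N = T2 E $ N + \<delta>"
        by (simp add: \<delta>_def)
      ultimately show ?thesis
        unfolding True T2_top by (simp add: algebra_simps)
    qed
    have "defect E' (lin 1) y j N \<in> I" for j
    proof -
      have "defect (\<Phi> * T1 E') (c * (lin q1 * lin q2 * lin q3)) y j N
          - (defect \<Phi> c y j N + defect (T1 E') (lin q1 * lin q2 * lin q3) y j N) \<in> I" (is "?a - (?b + ?c) \<in> I")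
        unfolding T1_def by (intro defect_mult \<Phi> T_int int')
      moreover have "?b \<in> I"
        using \<Phi>(2)[of "Suc N"] by (auto simp: intertwines_def)
      moreover have "?c - sc (q1 ^ N + q2 ^ N + q3 ^ N) * defect E' (lin 1) y j N \<in> I"
        unfolding T1_def by (rule T_defect[OF int'])
      ultimately have "?b + (?c - sc (q1 ^ N + q2 ^ N + q3 ^ N) * defect E' (lin 1) y j N) \<in> I"
        and abc: "?a - (?b + ?c) \<in> I"
        by (blast intro: add_I)+
      then have "?b + ?c - sc (q1 ^ N + q2 ^ N + q3 ^ N) * defect E' (lin 1) y j N \<in> I"
        by (simp only: add_diff_eq)
      from trans_I[OF abc this]
      have a: "?a - sc (q1 ^ N + q2 ^ N + q3 ^ N) * defect E' (lin 1) y j N \<in> I" .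
      have "?a = defect (T2 E') (lin (inverse q1) * lin (inverse q2) * lin (inverse q3)) y j N"
        unfolding c by (rule defect_cong) (rule agree')
      then have "?a - sc (inverse q1 ^ N + inverse q2 ^ N + inverse q3 ^ N) * defect E' (lin 1) y j N \<in> I"
        unfolding T2_def using T_defect[OF int'] by metis
      from diff_I[OF this a] have "sc \<kappa> * defect E' (lin 1) y j N \<in> I"
        by (simp add: \<kappa>_def sc_diff algebra_simps)
      then have "sc (1 / \<kappa>) * (sc \<kappa> * defect E' (lin 1) y j N) \<in> I"
        by (rule left_I)
      then show ?thesis
        using \<kappa> by (simp add: sc_one flip: mult.assoc sc_mult)
    qed
    then have "intertwines y (Suc N) E' (lin 1)"
      using int' by (auto simp: intertwines_def less_Suc_eq)
    then show ?case
      using E' agree' by (auto simp: N_def)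
  qed
  then show ?thesis
    by blast
qed

end

section \<open>Exchange relations\<close>

definition cubic :: "complex \<Rightarrow> complex \<Rightarrow> complex fps" where
  "cubic s t = Abs_fps (\<lambda>k. if k = 0 then 1 else if k = 1 then - s else if k = 2 then t
     else if k = 3 then - 1 else 0)"

text \<open>The cubic factors of the exchange relations, in the form \<open>1 - s x + t x\<^sup>2 - x\<^sup>3\<close>.\<close>

lemma lin_product:
  assumes "q1 * q2 * q3 = 1"
  shows "lin q1 * lin q2 * lin q3 = cubic (q1 + q2 + q3) (q1 * q2 + q1 * q3 + q2 * q3)"
proof (rule fps_ext)
  fix n
  have step: "(U * lin a) $ n = U $ n - a * (if n = 0 then 0 else U $ (n - 1))" for U a n
  proof -
    have "U * lin a = U - fps_const a * (U * fps_X)"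
      by (simp add: lin_def algebra_simps)
    then show ?thesis
      by (simp only: fps_sub_nth fps_mult_left_const_nth fps_X_mult_right_nth)
  qed
  have "q3 * (q1 * q2) = 1"
    using assms by (simp add: mult.commute)
  then show "(lin q1 * lin q2 * lin q3) $ n = cubic (q1 + q2 + q3) (q1 * q2 + q1 * q3 + q2 * q3) $ n"
    unfolding step by (auto simp: lin_nth cubic_def algebra_simps numeral_2_eq_2 numeral_3_eq_3)
qed

context scalar_ideal begin

text \<open>The coefficients of \<open>x(z) y(w) \<Prod>\<^sub>i (z - q\<^sub>i w) = - y(w) x(z) \<Prod>\<^sub>i (w - q\<^sub>i z)\<close>, where \<open>s\<close> and \<open>t\<close> are
  the first two elementary symmetric functions of the \<open>q\<^sub>i\<close> and the third one is 1. Indices are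
  those of the generators, that is, the negatives of the exponents of \<open>z\<close> and \<open>w\<close>.\<close>

definition exchange :: "complex \<Rightarrow> complex \<Rightarrow> (int \<Rightarrow> 'r) \<Rightarrow> (int \<Rightarrow> 'r) \<Rightarrow> bool" where
  "exchange s t x y \<longleftrightarrow> (\<forall>m j.
     (x m * y j - sc s * (x (m - 1) * y (j + 1)) + sc t * (x (m - 2) * y (j + 2)) - x (m - 3) * y (j + 3))
     - (y j * x m - sc t * (y (j + 1) * x (m - 1)) + sc s * (y (j + 2) * x (m - 2)) - y (j + 3) * x (m - 3))
     \<in> I)"

text \<open>Reading both series backwards amounts to \<open>z \<mapsto> 1/z\<close>, \<open>w \<mapsto> 1/w\<close>, which inverts the \<open>q\<^sub>i\<close>, that is,
  swaps \<open>s\<close> and \<open>t\<close>. It turns statements about \<open>\<psi>\<^sup>+\<close> into statements about \<open>\<psi>\<^sup>-\<close>.\<close>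

lemma exchange_reverse:
  assumes "exchange s t x y"
  shows "exchange t s (\<lambda>n. x (- n)) (\<lambda>n. y (- n))"
  unfolding exchange_def
proof (intro allI)
  fix m j :: int
  have *: "- (m - 3) - 1 = - (m - 2)" "- (m - 3) - 2 = - (m - 1)" "- (m - 3) - 3 = - m"
    "- (j + 3) + 1 = - (j + 2)" "- (j + 3) + 2 = - (j + 1)" "- (j + 3) + 3 = - j"
    by simp_all
  note minus_I[OF assms[unfolded exchange_def, THEN spec, of "- (m - 3)", THEN spec, of "- (j + 3)"]]
  then show "(x (- m) * y (- j) - sc t * (x (- (m - 1)) * y (- (j + 1))) + sc s * (x (- (m - 2)) * y (- (j
    + 2))) - x (- (m - 3)) * y (- (j + 3)))
     - (y (- j) * x (- m) - sc s * (y (- (j + 1)) * x (- (m - 1))) + sc t * (y (- (j + 2)) * x (- (m - 2)))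
       - y (- (j + 3)) * x (- (m - 3)))
     \<in> I"
    unfolding * by (simp only: algebra_simps minus_diff_eq)
qed

lemma exchange_diff:
  assumes "exchange s t x y" "exchange s t x' y"
  shows "exchange s t (\<lambda>n. x n - x' n) y"
  unfolding exchange_def
proof (intro allI)
  fix m j
  note diff_I[OF assms[unfolded exchange_def, THEN spec, of m, THEN spec, of j]]
  then show "((x m - x' m) * y j - sc s * ((x (m - 1) - x' (m - 1)) * y (j + 1)) + sc t * ((x (m - 2) - x' (m
    - 2)) * y (j + 2)) - (x (m - 3) - x' (m - 3)) * y (j + 3))
     - (y j * (x m - x' m) - sc t * (y (j + 1) * (x (m - 1) - x' (m - 1))) + sc s * (y (j + 2) * (x (m - 2)
       - x' (m - 2))) - y (j + 3) * (x (m - 3) - x' (m - 3)))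
     \<in> I"
    by (simp add: algebra_simps)
qed

lemma exchange_commute_mod:
  assumes ex: "exchange s t x y"
    and H: "vs.subspace H" "\<And>r. r \<in> I \<Longrightarrow> r * z \<in> H"
    and lower: "\<And>k j. k < m \<Longrightarrow> x k * (y j * z) \<in> H" "\<And>k j. k < m \<Longrightarrow> y j * (x k * z) \<in> H"
  shows "x m * (y j * z) \<in> H \<longleftrightarrow> y j * (x m * z) \<in> H"
proof -
  define u where "u = sc s * (x (m - 1) * (y (j + 1) * z)) - sc t * (x (m - 2) * (y (j + 2) * z)) + x (m
    - 3) * (y (j + 3) * z)
    - (sc t * (y (j + 1) * (x (m - 1) * z)) - sc s * (y (j + 2) * (x (m - 2) * z)) + y (j + 3) * (x (m - 3) * z))"
  have u: "u \<in> H"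
    unfolding u_def
    by (intro vs.subspace_add[OF H(1)] vs.subspace_diff[OF H(1)] vs.subspace_scale[OF H(1)] lower) auto
  have "((x m * y j - sc s * (x (m - 1) * y (j + 1)) + sc t * (x (m - 2) * y (j + 2)) - x (m - 3) * y (j + 3))
     - (y j * x m - sc t * (y (j + 1) * x (m - 1)) + sc s * (y (j + 2) * x (m - 2)) - y (j + 3) * x (m - 3))) * z
     \<in> H"
    using ex unfolding exchange_def by (blast intro: H(2))
  then have "x m * (y j * z) - y j * (x m * z) - u \<in> H"
    by (simp add: u_def algebra_simps)
  with u have d: "x m * (y j * z) - y j * (x m * z) \<in> H"
    using vs.subspace_add[OF H(1)] by fastforce
  show ?thesis
    using vs.subspace_add[OF H(1) d] vs.subspace_diff[OF H(1) _ d] by fastforce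
qed

text \<open>If \<open>x\<close> is one-sided, the exchange relation rewrites \<open>x\<^sub>m y\<^sub>j\<close> as \<open>y\<^sub>j x\<^sub>m\<close> plus products with smaller
  index of \<open>x\<close>, so the order of the two factors can be reversed by induction on that index.\<close>

lemma exchange_pass:
  assumes ex: "exchange s t x y" and zero: "\<And>n. n < 0 \<Longrightarrow> x n = 0"
    and H: "vs.subspace H" "\<And>r. r \<in> I \<Longrightarrow> r * z \<in> H"
  shows "(\<forall>k j. y j * (x k * z) \<in> H) \<longleftrightarrow> (\<forall>k j. x k * (y j * z) \<in> H)"
proof -
  have both: "(\<forall>j. y j * (x k * z) \<in> H) \<and> (\<forall>j. x k * (y j * z) \<in> H)"
    if P: "(\<forall>k j. y j * (x k * z) \<in> H) \<or> (\<forall>k j. x k * (y j * z) \<in> H)" for k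
  proof -
    have "\<forall>k. nat k = n \<longrightarrow> (\<forall>j. y j * (x k * z) \<in> H) \<and> (\<forall>j. x k * (y j * z) \<in> H)" for n
    proof (induction n rule: less_induct)
      case (less n)
      show ?case
      proof (intro allI impI)
        fix k assume k: "nat k = n"
        show "(\<forall>j. y j * (x k * z) \<in> H) \<and> (\<forall>j. x k * (y j * z) \<in> H)"
        proof (cases "k < 0")
          case True
          then show ?thesis
            using vs.subspace_0[OF H(1)] by (simp add: zero)
        next
          case False
          have low: "(\<forall>j. y j * (x l * z) \<in> H) \<and> (\<forall>j. x l * (y j * z) \<in> H)" if "l < k" for l
          proof (cases "l < 0")
            case True
            then show ?thesis
              using vs.subspace_0[OF H(1)] by (simp add: zero)
          next
            case False
            then have "nat l < n"
              using that k by auto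
            then show ?thesis
              using less by blast
          qed
          show ?thesis
            using exchange_commute_mod[OF ex H, of k] low P by blast
        qed
      qed
    qed
    then show ?thesis
      by blast
  qed
  then show ?thesis
    by blast
qed

lemma exchange_series:
  assumes ex: "exchange s t x y" and zero: "\<And>n. n < 0 \<Longrightarrow> x n = 0"
  defines "X \<equiv> Abs_fps (\<lambda>n. x (int n))"
  shows "(X * twist (cubic s t) y j - twist (cubic t s) y j * X) $ m \<in> I"
proof -
  \<comment> \<open>only four coefficients of the cubic contribute; \<open>g k = 0\<close> beyond \<open>m\<close> covers the case \<open>m < 3\<close>\<close>
  have four: "(\<Sum>k=0..m. sc (cubic u v $ k) * g (int k))
      = g 0 - sc u * g 1 + sc v * g 2 - g 3"
    if g: "\<And>k. k > int m \<Longrightarrow> g k = 0" for u v and g :: "int \<Rightarrow> 'r"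
  proof -
    have "(\<Sum>k=0..m. sc (cubic u v $ k) * g (int k)) = (\<Sum>k\<in>{0..m} \<union> {0..3}. sc (cubic u v $ k) * g (int k))"
      by (rule sum.mono_neutral_left) (auto simp: g)
    also have "\<dots> = (\<Sum>k\<in>{0..3}. sc (cubic u v $ k) * g (int k))"
      by (rule sum.mono_neutral_right) (auto simp: cubic_def sc_zero)
    also have "{0..3::nat} = {0, 1, 2, 3}"
      by auto
    finally show ?thesis
      by (simp add: cubic_def sc_minus sc_one)
  qed
  have "(X * twist (cubic s t) y j) $ m = (\<Sum>k=0..m. X $ (m - k) * twist (cubic s t) y j $ k)"
    unfolding fps_mult_nth by (rule sum.reindex_bij_witness[of _ "\<lambda>k. m - k" "\<lambda>k. m - k"]) auto
  also have "\<dots> = (\<Sum>k=0..m. sc (cubic s t $ k) * (x (int m - int k) * y (j + int k)))"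
    by (intro sum.cong) (auto simp: X_def twist_nth sc_left_commute of_nat_diff)
  also have "\<dots> = x (int m) * y j - sc s * (x (int m - 1) * y (j + 1))
      + sc t * (x (int m - 2) * y (j + 2)) - x (int m - 3) * y (j + 3)"
    by (subst four[of "\<lambda>k. x (int m - k) * y (j + k)"]) (auto simp: zero)
  finally have 1: "(X * twist (cubic s t) y j) $ m = \<dots>" .
  have "(twist (cubic t s) y j * X) $ m = (\<Sum>k=0..m. sc (cubic t s $ k) * (y (j + int k) * x (int m - int k)))"
    unfolding fps_mult_nth by (intro sum.cong) (auto simp: X_def twist_nth mult.assoc of_nat_diff)
  also have "\<dots> = y j * x (int m) - sc t * (y (j + 1) * x (int m - 1))
      + sc s * (y (j + 2) * x (int m - 2)) - y (j + 3) * x (int m - 3)"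
    by (subst four[of "\<lambda>k. y (j + k) * x (int m - k)"]) (auto simp: zero)
  finally have 2: "(twist (cubic t s) y j * X) $ m = \<dots>" .
  show ?thesis
    using ex unfolding fps_sub_nth 1 2 exchange_def by blast
qed

lemma fps_left_I: "(\<And>n. U $ n \<in> I) \<Longrightarrow> (W * U) $ n \<in> I"
  unfolding fps_mult_nth by (intro sum_I left_I)

lemma fps_right_I: "(\<And>n. U $ n \<in> I) \<Longrightarrow> (U * W) $ n \<in> I"
  unfolding fps_mult_nth by (intro sum_I right_I)

definition sc_fps :: "complex fps \<Rightarrow> 'r fps" where
  "sc_fps g = Abs_fps (\<lambda>n. sc (g $ n))"

lemma sc_fps_central: "sc_fps g * U = U * sc_fps g"
proof (rule fps_ext)
  fix n
  have "(\<Sum>i=0..n. sc (g $ i) * U $ (n - i)) = (\<Sum>i=0..n. U $ i * sc (g $ (n - i)))"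
    by (rule sum.reindex_bij_witness[of _ "\<lambda>k. n - k" "\<lambda>k. n - k"]) (auto simp: sc_central)
  then show "(sc_fps g * U) $ n = (U * sc_fps g) $ n"
    by (simp add: fps_mult_nth sc_fps_def)
qed

lemma twist_commute_const:
  assumes "\<And>j. c * y j - y j * c \<in> I"
  shows "(fps_const c * twist a y j - twist a y j * fps_const c) $ n \<in> I"
proof -
  have "(fps_const c * twist a y j - twist a y j * fps_const c) $ n
      = sc (a $ n) * (c * y (j + int n) - y (j + int n) * c)"
    by (simp add: twist_nth sc_left_commute mult.assoc right_diff_distrib)
  then show ?thesis
    using left_I[OF assms] by metis
qed

text \<open>An invertible leading coefficient of \<open>x\<close> is divided out by its inverse \<open>c\<close>, and \<open>g\<close> normalizes the
  action on the highest weight vector. The coefficient of \<open>\<Phi>\<close> at 0 is congruent to 1 and is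
  replaced by 1 itself.\<close>

lemma normalized_intertwiner:
  assumes ex: "exchange (q1 + q2 + q3) (q1 * q2 + q1 * q3 + q2 * q3) x y"
    and prod: "q1 * q2 * q3 = 1" and zero: "\<And>n. n < 0 \<Longrightarrow> x n = 0"
    and c: "c * x 0 - 1 \<in> I" "\<And>j. c * y j - y j * c \<in> I"
    and g: "g $ 0 = 1"
  defines "\<Phi> \<equiv> Abs_fps (\<lambda>n. if n = 0 then 1 else (\<Sum>k=0..n. sc (g $ (n - k)) * (c * x (int k))))"
  shows "intertwines y n \<Phi> (lin (inverse q1) * lin (inverse q2) * lin (inverse q3)
      * inverse (lin q1 * lin q2 * lin q3))"
proof (rule intertwines_cancel)
  define a where "a = lin q1 * lin q2 * lin q3"
  define b where "b = lin (inverse q1) * lin (inverse q2) * lin (inverse q3)"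
  define s t where "s = q1 + q2 + q3" and "t = q1 * q2 + q1 * q3 + q2 * q3"
  have a: "a = cubic s t"
    using lin_product[OF prod] by (simp add: a_def s_def t_def)
  have nz: "q1 \<noteq> 0" "q2 \<noteq> 0" "q3 \<noteq> 0"
    using prod by auto
  have inv: "inverse q1 = q2 * q3" "inverse q2 = q1 * q3" "inverse q3 = q1 * q2"
    using prod by (auto intro!: inverse_unique simp: ac_simps)
  have b: "b = cubic t s"
  proof -
    have "inverse q1 * inverse q2 * inverse q3 = 1"
      using prod by (simp flip: inverse_mult_distrib)
    note lin_product[OF this]
    moreover have "inverse q1 + inverse q2 + inverse q3 = t"
      unfolding inv t_def by (simp add: algebra_simps)
    moreover have "inverse (q1 * q2) = q3" "inverse (q1 * q3) = q2" "inverse (q2 * q3) = q1"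
      by (rule inverse_unique, use prod in \<open>simp add: ac_simps\<close>)+
    ultimately show ?thesis
      by (simp add: b_def s_def add_ac)
  qed
  have a0: "a $ 0 = 1" "b $ 0 = 1"
    by (simp_all add: a b cubic_def)
  show "\<Phi> $ 0 = 1"
    by (simp add: \<Phi>_def)
  show "(lin q1 * lin q2 * lin q3) $ 0 = 1"
    using a0 by (simp add: a_def)
  show "(b * inverse a) $ 0 = 1"
    using a0 by simp
  define X where "X = Abs_fps (\<lambda>n. x (int n))"
  define \<Phi>' where "\<Phi>' = sc_fps g * (fps_const c * X)"
  have nth': "\<Phi>' $ n = (\<Sum>k=0..n. sc (g $ (n - k)) * (c * x (int k)))" for n
  proof -
    have "\<Phi>' $ n = (\<Sum>i=0..n. sc (g $ i) * (c * x (int (n - i))))"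
      unfolding \<Phi>'_def fps_mult_nth[of "sc_fps g"] by (simp add: sc_fps_def X_def)
    also have "\<dots> = (\<Sum>k=0..n. sc (g $ (n - k)) * (c * x (int k)))"
      by (rule sum.reindex_bij_witness[of _ "\<lambda>k. n - k" "\<lambda>k. n - k"]) auto
    finally show ?thesis .
  qed
  have diff: "(\<Phi> - \<Phi>') $ n \<in> I" for n
    using minus_I[OF c(1)] by (cases "n = 0") (simp_all add: \<Phi>_def nth' g sc_one zero_I)
  fix j m
  have X: "(X * twist a y j - twist b y j * X) $ n \<in> I" for n
    unfolding a b X_def s_def t_def by (rule exchange_series[OF ex zero])
  have C: "(fps_const c * twist b y j - twist b y j * fps_const c) $ n \<in> I" for n
    by (rule twist_commute_const[OF c(2)])
  have split: "\<Phi>' * twist a y j - twist b y j * \<Phi>'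
      = sc_fps g * (fps_const c * (X * twist a y j - twist b y j * X)
          + (fps_const c * twist b y j - twist b y j * fps_const c) * X)"
  proof -
    have "twist b y j * (sc_fps g * (fps_const c * X)) = sc_fps g * (twist b y j * (fps_const c * X))"
      by (metis mult.assoc sc_fps_central)
    then show ?thesis
      by (simp add: \<Phi>'_def algebra_simps)
  qed
  have "(\<Phi>' * twist a y j - twist b y j * \<Phi>') $ m \<in> I"
    unfolding split
    by (rule fps_left_I) (unfold fps_add_nth, intro add_I fps_left_I fps_right_I X C)
  moreover have "((\<Phi> - \<Phi>') * twist a y j - twist b y j * (\<Phi> - \<Phi>')) $ m \<in> I"
    unfolding fps_sub_nth[of "(\<Phi> - \<Phi>') * _"] by (intro diff_I fps_left_I fps_right_I diff)
  ultimately have "(\<Phi>' * twist a y j - twist b y j * \<Phi>' + ((\<Phi> - \<Phi>') * twist a y j - twist b y j * (\<Phi> - \<Phi>'))) $ m \<in> I"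
    unfolding fps_add_nth[of "_ - _"] by (rule add_I)
  moreover have "\<Phi>' * twist a y j - twist b y j * \<Phi>' + ((\<Phi> - \<Phi>') * twist a y j - twist b y j * (\<Phi> - \<Phi>'))
      = \<Phi> * twist a y j - twist b y j * \<Phi>"
    by (simp add: algebra_simps)
  ultimately have "(\<Phi> * twist a y j - twist b y j * \<Phi>) $ m \<in> I"
    by simp
  moreover have "b * inverse a * a = b"
    using a0 by (simp add: mult.assoc inverse_mult_eq_1)
  ultimately show "(\<Phi> * twist (lin q1 * lin q2 * lin q3) y j
       - twist (lin (inverse q1) * lin (inverse q2) * lin (inverse q3)
         * inverse (lin q1 * lin q2 * lin q3) * (lin q1 * lin q2 * lin q3)) y j * \<Phi>) $ m \<in> I"
    by (simp only: a_def[symmetric] b_def[symmetric])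
qed

end

section \<open>Rational functions and linear recurrences\<close>

unbundle fps_syntax

text \<open>The coefficients at \<open>z\<^sup>-\<^sup>n\<close> of \<open>x\<^sup>+(z) = \<Sum>\<^sub>n\<^sub>\<ge>\<^sub>0 x\<^sub>n z\<^sup>-\<^sup>n\<close> and \<open>x\<^sup>-(z) = x\<^sub>0\<^sup>-\<^sup>1 + \<Sum>\<^sub>n\<^sub><\<^sub>0 x\<^sub>n z\<^sup>-\<^sup>n\<close>; the
  argument \<open>x0\<close> stands for \<open>x\<^sub>0\<^sup>-\<^sup>1\<close>.\<close>

definition pos_part :: "(int \<Rightarrow> 'a::zero) \<Rightarrow> int \<Rightarrow> 'a" where
  "pos_part x n = (if n \<ge> 0 then x n else 0)"

definition neg_part :: "'a \<Rightarrow> (int \<Rightarrow> 'a::zero) \<Rightarrow> int \<Rightarrow> 'a" where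
  "neg_part x0 x n = (if n > 0 then 0 else if n = 0 then x0 else x n)"

definition weight_gap :: "(int \<Rightarrow> complex) \<Rightarrow> int \<Rightarrow> complex" where
  "weight_gap p n = pos_part p n - neg_part (inverse (p 0)) p n"

text \<open>The bilateral series \<open>\<Sum>\<^sub>n u\<^sub>n z\<^sup>-\<^sup>n\<close> is annihilated by \<open>A(z)\<close>.\<close>

definition recurrent :: "complex poly \<Rightarrow> (int \<Rightarrow> complex) \<Rightarrow> bool" where
  "recurrent A u \<longleftrightarrow> (\<forall>j. (\<Sum>i\<le>degree A. coeff A i * u (j + int i)) = 0)"

text \<open>On bilateral series \<open>z\<close> is invertible, so \<open>A\<close> can be divided by powers of \<open>z\<close>.\<close>

lemma recurrent_strip:
  assumes "A \<noteq> 0" "recurrent A u"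
  shows "\<exists>B. coeff B 0 \<noteq> 0 \<and> recurrent B u"
  using assms
proof (induction A)
  case (pCons a A)
  show ?case
  proof (cases "a = 0")
    case False
    then show ?thesis
      using pCons.prems by (intro exI[of _ "pCons a A"]) auto
  next
    case True
    have A: "A \<noteq> 0"
      using True pCons.prems(1) by auto
    have "(\<Sum>i\<le>degree A. coeff A i * u (j + int i)) = 0" for j
    proof -
      have "(\<Sum>i\<le>degree (pCons a A). coeff (pCons a A) i * u (j - 1 + int i)) = 0"
        using pCons.prems(2) unfolding recurrent_def by blast
      then show ?thesis
        using A True by (simp add: sum.atMost_Suc_shift algebra_simps del: sum.atMost_Suc)
    qed
    then show ?thesis
      using pCons.IH[OF A] by (simp add: recurrent_def)
  qed
qed simp

lemma eval_fls_X_inv_mult_nth: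
  "(poly (map_poly fls_const A) fls_X_inv * W) $$ j = (\<Sum>i\<le>degree A. coeff A i * W $$ (j + int i))"
  for A :: "complex poly"
proof -
  have "(fls_const a * fls_X_inv ^ i * W) $$ j = a * W $$ (j + int i)" for a and i :: nat
    by (subst mult.assoc) (simp only: fls_X_inv_power_times_conv_shift(1) fls_mult_const_nth fls_shift_nth)
  then show ?thesis
    by (simp add: poly_altdef degree_map_poly coeff_map_poly sum_distrib_right fls_nth_sum)
qed

lemma eval_fls_X_mult_nth:
  "(poly (map_poly fls_const A) fls_X * W) $$ j = (\<Sum>i\<le>degree A. coeff A i * W $$ (j - int i))"
  for A :: "complex poly"
proof -
  have "(fls_const a * fls_X ^ i * W) $$ j = a * W $$ (j - int i)" for a and i :: nat
    by (subst mult.assoc) (simp only: fls_X_power_times_conv_shift(1) fls_mult_const_nth fls_shift_nth, simp)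
  then show ?thesis
    by (simp add: poly_altdef degree_map_poly coeff_map_poly sum_distrib_right fls_nth_sum)
qed

lemma eval_fls_X_inv_nth:
  "poly (map_poly fls_const A) fls_X_inv $$ j = (if j \<le> 0 then coeff A (nat (- j)) else 0)"
  for A :: "complex poly"
proof -
  have "poly (map_poly fls_const A) fls_X_inv $$ j = (\<Sum>i\<le>degree A. if i = nat (- j) \<and> j \<le> 0 then coeff A i else 0)"
    using eval_fls_X_inv_mult_nth[of A 1 j] by (auto intro!: sum.cong)
  also have "\<dots> = (if j \<le> 0 then coeff A (nat (- j)) else 0)"
    by (auto simp: coeff_eq_0)
  finally show ?thesis .
qed

lemma eval_fls_X_nth:
  "poly (map_poly fls_const A) fls_X $$ j = (if j \<ge> 0 then coeff A (nat j) else 0)"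
  for A :: "complex poly"
proof -
  have "poly (map_poly fls_const A) fls_X $$ j = (\<Sum>i\<le>degree A. if i = nat j \<and> j \<ge> 0 then coeff A i else 0)"
    using eval_fls_X_mult_nth[of A 1 j] by (auto intro!: sum.cong)
  also have "\<dots> = (if j \<ge> 0 then coeff A (nat j) else 0)"
    by (auto simp: coeff_eq_0)
  finally show ?thesis .
qed

lemma eval_fls_nonzero:
  fixes A :: "complex poly"
  assumes "A \<noteq> 0"
  shows "poly (map_poly fls_const A) fls_X_inv \<noteq> 0" "poly (map_poly fls_const A) fls_X \<noteq> 0"
proof -
  from assms obtain k where "coeff A k \<noteq> 0"
    by (metis leading_coeff_0_iff)
  then show "poly (map_poly fls_const A) fls_X_inv \<noteq> 0" "poly (map_poly fls_const A) fls_X \<noteq> 0"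
    using eval_fls_X_inv_nth[of A "- int k"] eval_fls_X_nth[of A "int k"] by auto
qed

lemma weight_plus_nth: "fps_to_fls (weight_plus p) $$ j = pos_part p j"
  by (simp add: weight_plus_def pos_part_def)

lemma weight_minus_nth: "fps_to_fls (weight_minus p) $$ j = neg_part (inverse (p 0)) p (- j)"
  by (auto simp: weight_minus_def neg_part_def nat_eq_iff)

lemma expansions_iff:
  assumes "B \<noteq> 0"
  shows "fps_to_fls (weight_plus p) = expansion_infinity A B \<and> fps_to_fls (weight_minus p) = expansion_zero A B
    \<longleftrightarrow> (\<forall>j. (\<Sum>i\<le>degree B. coeff B i * pos_part p (j + int i)) = (if j \<le> 0 then coeff A (nat (- j)) else 0)
          \<and> (\<Sum>i\<le>degree B. coeff B i * neg_part (inverse (p 0)) p (j + int i))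
            = (if j \<le> 0 then coeff A (nat (- j)) else 0))"
proof -
  have all_neg: "(\<forall>j. P j) \<longleftrightarrow> (\<forall>j. P (- j))" for P :: "int \<Rightarrow> bool"
    by (metis minus_minus)
  note nz = eval_fls_nonzero[OF assms]
  have "fps_to_fls (weight_plus p) = expansion_infinity A B \<longleftrightarrow>
      poly (map_poly fls_const B) fls_X_inv * fps_to_fls (weight_plus p) = poly (map_poly fls_const A) fls_X_inv"
    using nz by (simp add: expansion_infinity_def field_simps)
  also have "\<dots> \<longleftrightarrow> (\<forall>j. (\<Sum>i\<le>degree B. coeff B i * pos_part p (j + int i)) = (if j \<le> 0 then coeff A (nat (- j)) else 0))"
    by (simp add: fls_eq_iff eval_fls_X_inv_mult_nth eval_fls_X_inv_nth weight_plus_nth del: fps_to_fls_nth)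
  finally have 1: "fps_to_fls (weight_plus p) = expansion_infinity A B \<longleftrightarrow> \<dots>" .
  have "fps_to_fls (weight_minus p) = expansion_zero A B \<longleftrightarrow>
      poly (map_poly fls_const B) fls_X * fps_to_fls (weight_minus p) = poly (map_poly fls_const A) fls_X"
    using nz by (simp add: expansion_zero_def field_simps)
  also have "\<dots> \<longleftrightarrow> (\<forall>j. (\<Sum>i\<le>degree B. coeff B i * neg_part (inverse (p 0)) p (- (j - int i)))
    = (if j \<ge> 0 then coeff A (nat j) else 0))"
    by (simp add: fls_eq_iff eval_fls_X_mult_nth eval_fls_X_nth weight_minus_nth del: fps_to_fls_nth)
  also have "\<dots> \<longleftrightarrow> (\<forall>j. (\<Sum>i\<le>degree B. coeff B i * neg_part (inverse (p 0)) p (- (- j - int i))) = (if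
    - j \<ge> 0 then coeff A (nat (- j)) else 0))"
    by (rule all_neg)
  finally have 2: "fps_to_fls (weight_minus p) = expansion_zero A B \<longleftrightarrow>
     (\<forall>j. (\<Sum>i\<le>degree B. coeff B i * neg_part (inverse (p 0)) p (j + int i))
       = (if j \<le> 0 then coeff A (nat (- j)) else 0))"
    by (simp add: add.commute)
  show ?thesis
    unfolding 1 2 by blast
qed

text \<open>If \<open>p\<^sup>\<plusminus>\<close> are the expansions of \<open>B/A\<close>, then \<open>A p\<^sup>+ = B = A p\<^sup>-\<close>. Conversely, if
  \<open>A (p\<^sup>+ - p\<^sup>-) = 0\<close> as bilateral series, the common value \<open>A p\<^sup>+ = A p\<^sup>-\<close> has no coefficients above
  the degree of \<open>A\<close> (look at \<open>p\<^sup>+\<close>) and none below 0 (look at \<open>p\<^sup>-\<close>), so it is a polynomial \<open>B\<close>.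
  The values of \<open>B/A\<close> at \<open>\<infinity>\<close> and 0 are then \<open>p\<^sub>0\<close> and \<open>p\<^sub>0\<^sup>-\<^sup>1\<close>.\<close>

lemma rational_weight_iff_recurrent:
  assumes p0: "p 0 \<noteq> 0"
  shows "rational_weight p \<longleftrightarrow> (\<exists>A. A \<noteq> 0 \<and> recurrent A (weight_gap p))"
proof
  assume "rational_weight p"
  then obtain A B where "B \<noteq> 0" and ex: "fps_to_fls (weight_plus p) = expansion_infinity A B
      \<and> fps_to_fls (weight_minus p) = expansion_zero A B"
    unfolding rational_weight_def by blast
  have "recurrent B (weight_gap p)"
    using ex unfolding expansions_iff[OF \<open>B \<noteq> 0\<close>]
    by (auto simp: recurrent_def weight_gap_def right_diff_distrib sum_subtractf)
  with \<open>B \<noteq> 0\<close> show "\<exists>A. A \<noteq> 0 \<and> recurrent A (weight_gap p)"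
    by blast
next
  assume "\<exists>A. A \<noteq> 0 \<and> recurrent A (weight_gap p)"
  then obtain A where A0: "coeff A 0 \<noteq> 0" and rec: "recurrent A (weight_gap p)"
    using recurrent_strip by metis
  have [simp]: "A \<noteq> 0"
    using A0 by auto
  define n where "n = degree A"
  \<comment> \<open>the coefficient at \<open>z\<^sup>-\<^sup>j\<close> of \<open>A p\<^sup>+\<close>, and by the recurrence also of \<open>A p\<^sup>-\<close>\<close>
  define c where "c j = (\<Sum>i\<le>n. coeff A i * pos_part p (j + int i))" for j
  have c_neg: "c j = (\<Sum>i\<le>n. coeff A i * neg_part (inverse (p 0)) p (j + int i))" for j
    using rec by (simp add: recurrent_def weight_gap_def right_diff_distrib sum_subtractf c_def n_def)
  define B where "B = (\<Sum>k\<le>n. monom (c (- int k)) k)"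
  have B_coeff: "coeff B k = (if k \<le> n then c (- int k) else 0)" for k
    by (simp add: B_def coeff_sum)
  have c_high: "c j = 0" if "j > 0" for j
    unfolding c_neg using that by (intro sum.neutral) (auto simp: neg_part_def)
  have c_low: "c j = 0" if "j < - int n" for j
    unfolding c_def using that by (intro sum.neutral) (auto simp: pos_part_def)
  have c: "c j = (if j \<le> 0 then coeff B (nat (- j)) else 0)" for j
    using c_high[of j] c_low[of j] by (auto simp: B_coeff nat_le_iff)
  have ex: "fps_to_fls (weight_plus p) = expansion_infinity B A \<and> fps_to_fls (weight_minus p) = expansion_zero B A"
    unfolding expansions_iff[OF \<open>A \<noteq> 0\<close>] n_def[symmetric] c_def[symmetric] c_neg[symmetric]
    using c by simp
  have c0: "c 0 = coeff A 0 * inverse (p 0)"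
  proof -
    have "c 0 = (\<Sum>i\<le>n. if i = 0 then coeff A 0 * inverse (p 0) else 0)"
      unfolding c_neg by (intro sum.cong) (auto simp: neg_part_def)
    then show ?thesis
      by simp
  qed
  have cn: "c (- int n) = lead_coeff A * p 0"
  proof -
    have "c (- int n) = (\<Sum>i\<le>n. if i = n then coeff A n * p 0 else 0)"
      unfolding c_def by (intro sum.cong) (auto simp: pos_part_def)
    then show ?thesis
      by (simp add: n_def)
  qed
  have lead: "coeff B n = lead_coeff A * p 0"
    by (simp add: B_coeff cn)
  have deg: "degree B = n"
    using p0 lead by (intro antisym degree_le le_degree) (auto simp: B_coeff)
  have "((\<lambda>z. poly B z / poly A z) \<longlongrightarrow> poly B 0 / poly A 0) (at 0)"
    using A0 by (intro tendsto_intros isContD poly_isCont) (simp_all add: poly_0_coeff_0)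
  moreover have "poly B 0 / poly A 0 = inverse (p 0)"
    using A0 by (simp add: poly_0_coeff_0 B_coeff c0)
  ultimately have lim0: "((\<lambda>z. poly B z / poly A z) \<longlongrightarrow> inverse (p 0)) (at 0)"
    by simp
  \<comment> \<open>both polynomials have degree \<open>n\<close>, so reflecting them moves \<open>\<infinity>\<close> to 0\<close>
  have "((\<lambda>z. poly (reflect_poly B) (inverse z) / poly (reflect_poly A) (inverse z))
      \<longlongrightarrow> poly (reflect_poly B) 0 / poly (reflect_poly A) 0) at_infinity"
    by (intro tendsto_divide isCont_tendsto_compose[OF poly_isCont] tendsto_inverse_0) simp
  moreover have "\<forall>\<^sub>F z in at_infinity. poly (reflect_poly B) (inverse z) / poly (reflect_poly A) (inverse z)
      = poly B z / poly A z"
    using eventually_not_equal_at_infinity[of 0]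
    by eventually_elim (simp add: poly_reflect_poly_nz deg n_def)
  ultimately have "((\<lambda>z. poly B z / poly A z) \<longlongrightarrow> poly (reflect_poly B) 0 / poly (reflect_poly A) 0) at_infinity"
    by (rule Lim_transform_eventually)
  moreover have "poly (reflect_poly B) 0 / poly (reflect_poly A) 0 = p 0"
    using lead deg by (simp add: n_def)
  ultimately have liminf: "((\<lambda>z. poly B z / poly A z) \<longlongrightarrow> p 0) at_infinity"
    by (simp only:)
  have "inverse (p 0) * p 0 = 1"
    using p0 by simp
  with ex lim0 liminf show "rational_weight p"
    unfolding rational_weight_def using \<open>A \<noteq> 0\<close> by blast
qed

section \<open>Polynomials acting on sequences by shifts\<close>

context scalar_ring begin

text \<open>The coefficients of \<open>A(w) u(w)\<close>, where \<open>w\<close> raises the index by one.\<close>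

definition act :: "complex poly \<Rightarrow> (int \<Rightarrow> 'r) \<Rightarrow> int \<Rightarrow> 'r" where
  "act A u j = (\<Sum>i\<le>degree A. sc (coeff A i) * u (j + int i))"

lemma act_eq: "degree A \<le> n \<Longrightarrow> act A u j = (\<Sum>i\<le>n. sc (coeff A i) * u (j + int i))"
  unfolding act_def by (rule sum.mono_neutral_left) (auto simp: coeff_eq_0 sc_zero)

lemma act_0: "act 0 u j = 0"
  by (simp add: act_def)

lemma act_pCons: "act (pCons a A) u j = sc a * u j + act A u (j + 1)"
  by (subst act_eq[of _ "Suc (degree A)"])
     (simp_all add: degree_pCons_le act_def sum.atMost_Suc_shift add_ac del: sum.atMost_Suc)

lemma act_diff: "act A (\<lambda>i. u i - v i) j = act A u j - act A v j"
  by (simp add: act_def right_diff_distrib sum_subtractf)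

lemma act_poly_add: "act (A + B) u j = act A u j + act B u j"
proof -
  have "degree (A + B) \<le> max (degree A) (degree B)"
    by (rule degree_add_le_max)
  then show ?thesis
    by (simp add: act_eq[of _ "max (degree A) (degree B)"] sc_add distrib_right sum.distrib)
qed

lemma act_poly_smult: "act (Polynomial.smult a A) u j = sc a * act A u j"
  by (subst act_eq[of _ "degree A"]) (simp_all add: degree_smult_le act_def sum_distrib_left)

lemma act_mult: "act (A * B) u j = act A (act B u) j"
  by (induction A arbitrary: j) (simp_all add: act_0 act_pCons act_poly_add act_poly_smult sc_zero)

lemma act_left: "act A (\<lambda>i. a * u i) j = a * act A u j"
  by (simp add: act_def sum_distrib_left sc_left_commute)

lemma act_subspace:
  assumes "vs.subspace H" "\<And>i. u i \<in> H"
  shows "act A u j \<in> H"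
  unfolding act_def by (intro vs.subspace_sum[OF assms(1)] vs.subspace_scale[OF assms(1)] assms(2))

lemma act_cong_mod:
  assumes "vs.subspace H" "\<And>i. u i - v i \<in> H"
  shows "act A u j \<in> H \<longleftrightarrow> act A v j \<in> H"
proof -
  have d: "act A u j - act A v j \<in> H"
    using act_subspace[OF assms] by (simp add: act_diff)
  show ?thesis
    using vs.subspace_add[OF assms(1) d, of "act A v j"] vs.subspace_diff[OF assms(1) _ d, of "act A u j"]
    by auto
qed

lemma subspace_act: "vs.subspace H \<Longrightarrow> vs.subspace {x. \<forall>j. act A (\<lambda>i. g i * x) j \<in> H}"
proof (rule vs.subspaceI)
  assume H: "vs.subspace H"
  show "0 \<in> {x. \<forall>j. act A (\<lambda>i. g i * x) j \<in> H}"
    using vs.subspace_0[OF H] by (simp add: act_def)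
  fix x y assume "x \<in> {x. \<forall>j. act A (\<lambda>i. g i * x) j \<in> H}" "y \<in> {x. \<forall>j. act A (\<lambda>i. g i * x) j \<in> H}"
  moreover have "act A (\<lambda>i. g i * (x + y)) j = act A (\<lambda>i. g i * x) j + act A (\<lambda>i. g i * y) j" for j
    by (simp add: act_def distrib_left sum.distrib)
  ultimately show "x + y \<in> {x. \<forall>j. act A (\<lambda>i. g i * x) j \<in> H}"
    using vs.subspace_add[OF H] by auto
next
  fix c x assume H: "vs.subspace H" and x: "x \<in> {x. \<forall>j. act A (\<lambda>i. g i * x) j \<in> H}"
  have "g i * (sc c * x) = sc c * (g i * x)" for i
    by (rule sc_left_commute)
  then have "act A (\<lambda>i. g i * (sc c * x)) j = sc c * act A (\<lambda>i. g i * x) j" for j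
    by (simp only: act_left)
  then show "sc c * x \<in> {x. \<forall>j. act A (\<lambda>i. g i * x) j \<in> H}"
    using x vs.subspace_scale[OF H] by auto
qed

lemma subspace_left_mult: "vs.subspace H \<Longrightarrow> vs.subspace {x. a * x \<in> H}"
  using vs.subspace_0 vs.subspace_add vs.subspace_scale
  by (intro vs.subspaceI) (auto simp: distrib_left sc_left_commute)

text \<open>Elimination of a variable. Let \<open>w\<close> and \<open>x\<close> shift the first and second index of \<open>Z\<close>. If \<open>A(x)\<close> kills \<open>Z\<close>
  and \<open>C(w)\<close> kills \<open>(w - q x) Z\<close>, then \<open>C(w) A(w/q)\<close> kills \<open>Z\<close>, because \<open>A(w/q) - A(x)\<close> is a
  multiple of \<open>w - q x\<close>.\<close>

lemma act_eliminate:
  assumes H: "vs.subspace H" and q: "q \<noteq> 0"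
    and Z: "\<And>m l. act A (Z m) l \<in> H"
    and Y: "\<And>m l. act C (\<lambda>i. Z (i + 1) l - sc q * Z i (l + 1)) m \<in> H"
  shows "act (C * pcompose A [:0, 1 / q:]) (\<lambda>i. Z i l) m \<in> H"
proof -
  \<comment> \<open>\<open>(B(w/q) - B(x)) Z\<close>; by induction on \<open>B\<close> it is killed by \<open>C(w)\<close>\<close>
  define D where "D B m l = act (pcompose B [:0, 1 / q:]) (\<lambda>i. Z i l) m - act B (Z m) l" for B m l
  have "\<forall>m l. act C (\<lambda>i. D B i l) m \<in> H" for B
  proof (induction B)
    case 0
    then show ?case
      using vs.subspace_0[OF H] by (simp add: D_def act_0 act_def)
  next
    case (pCons b B)
    define W where "W i l = Z (i + 1) l - sc q * Z i (l + 1)" for i l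
    have qq: "sc (1 / q) * sc q = 1"
      using q by (simp add: sc_one flip: sc_mult)
    have D: "D (pCons b B) i l = sc (1 / q) * (D B (i + 1) l + act B (W i) l)" for i l
    proof -
      have "act B (\<lambda>k. sc q * Z i (k + 1)) l = sc q * act B (Z i) (l + 1)"
        by (simp add: act_left) (simp add: act_def add_ac)
      then have "act B (W i) l = act B (Z (i + 1)) l - sc q * act B (Z i) (l + 1)"
        by (simp add: W_def[abs_def] act_diff)
      moreover have "sc (1 / q) * (sc q * act B (Z i) (l + 1)) = act B (Z i) (l + 1)"
        using qq by (simp add: sc_one flip: mult.assoc)
      ultimately show ?thesis
        by (simp add: D_def pcompose_pCons act_poly_add act_pCons act_poly_smult act_0 sc_zero
            right_diff_distrib distrib_left)
    qed
    have 1: "act C (\<lambda>i. D B (i + 1) l) m \<in> H" for m l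
    proof -
      have "act C (\<lambda>i. D B (i + 1) l) m = act C (\<lambda>i. D B i l) (m + 1)"
        by (simp add: act_def add_ac)
      then show ?thesis
        using pCons.IH by simp
    qed
    have 2: "act C (\<lambda>i. act B (W i) l) m \<in> H" for m l
    proof -
      have "act C (\<lambda>i. act B (W i) l) m
          = (\<Sum>k\<le>degree B. sc (coeff B k) * act C (\<lambda>i. W i (l + int k)) m)"
        unfolding act_def sum_distrib_left by (subst sum.swap) (simp add: mult.commute)
      also have "\<dots> \<in> H"
        unfolding W_def by (intro vs.subspace_sum[OF H] vs.subspace_scale[OF H] Y)
      finally show ?thesis .
    qed
    have "act C (\<lambda>i. D (pCons b B) i l) m = sc (1 / q) * (act C (\<lambda>i. D B (i + 1) l) m
      + act C (\<lambda>i. act B (W i) l) m)" for m l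
      unfolding D act_left by (simp add: act_def distrib_left sum.distrib)
    then show ?case
      using vs.subspace_scale[OF H] vs.subspace_add[OF H] 1 2 by simp
  qed
  then have "act C (\<lambda>i. D A i l) m \<in> H"
    by blast
  moreover have "act C (\<lambda>i. D A i l) m = act (C * pcompose A [:0, 1 / q:]) (\<lambda>i. Z i l) m
    - act C (\<lambda>i. act A (Z i) l) m"
    unfolding D_def act_diff act_mult ..
  moreover have "act C (\<lambda>i. act A (Z i) l) m \<in> H"
    by (rule act_subspace[OF H Z])
  ultimately show ?thesis
    using vs.subspace_add[OF H] by fastforce
qed

text \<open>A linear recurrence with nonzero outer coefficients determines a bilateral sequence by as many
  consecutive terms as the degree; it can be solved in both directions.\<close>

lemma act_window:
  assumes H: "vs.subspace H" and A0: "coeff A 0 \<noteq> 0" and act: "\<And>j. act A u j \<in> H"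
    and window: "\<And>j. 0 \<le> j \<Longrightarrow> j < int (degree A) \<Longrightarrow> u j \<in> H"
  shows "u j \<in> H"
proof -
  define n where "n = degree A"
  \<comment> \<open>the term with a nonzero coefficient is determined by the others; used with \<open>r = n\<close> to go up, with \<open>r
    = 0\<close> to go down\<close>
  have solve: "u (k + int r) \<in> H"
    if r: "r \<le> n" "coeff A r \<noteq> 0" and others: "\<And>i. i \<le> n \<Longrightarrow> i \<noteq> r \<Longrightarrow> u (k + int i) \<in> H" for k r
  proof -
    have "act A u k = sc (coeff A r) * u (k + int r) + (\<Sum>i\<in>{..n} - {r}. sc (coeff A i) * u (k + int i))"
      unfolding act_def n_def[symmetric] using r by (simp add: sum.remove)
    moreover have "(\<Sum>i\<in>{..n} - {r}. sc (coeff A i) * u (k + int i)) \<in> H"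
      using others by (intro vs.subspace_sum[OF H] vs.subspace_scale[OF H]) auto
    ultimately have "sc (coeff A r) * u (k + int r) \<in> H"
      using vs.subspace_diff[OF H act[of k]] by fastforce
    then have "sc (1 / coeff A r) * (sc (coeff A r) * u (k + int r)) \<in> H"
      by (rule vs.subspace_scale[OF H])
    then show ?thesis
      using r by simp
  qed
  have lead: "coeff A n \<noteq> 0"
    using A0 unfolding n_def by (metis coeff_0 leading_coeff_neq_0)
  have up: "u (int k) \<in> H" for k
  proof (induction k rule: less_induct)
    case (less k)
    show ?case
    proof (cases "k < n")
      case True
      then show ?thesis
        using window by (simp add: n_def)
    next
      case False
      have "u (int k - int n + int n) \<in> H"
      proof (rule solve[OF le_refl lead])
        fix i assume "i \<le> n" "i \<noteq> n"
        then have "u (int (k - n + i)) \<in> H"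
          using False by (intro less) auto
        moreover have "int (k - n + i) = int k - int n + int i"
          using False by (simp add: of_nat_diff)
        ultimately show "u (int k - int n + int i) \<in> H"
          by (simp only:)
      qed
      then show ?thesis
        by simp
    qed
  qed
  have down: "u (int n - int k) \<in> H" for k
  proof (induction k rule: less_induct)
    case (less k)
    show ?case
    proof (cases "k \<le> n")
      case True
      then show ?thesis
        using up[of "n - k"] by (simp add: of_nat_diff)
    next
      case False
      have "u (int n - int k + int 0) \<in> H"
      proof (rule solve)
        fix i assume i: "i \<le> n" "i \<noteq> 0"
        then have "u (int n - int (k - i)) \<in> H"
          using False by (intro less) auto
        moreover have "int n - int (k - i) = int n - int k + int i"
          using i False by (simp add: of_nat_diff)
        ultimately show "u (int n - int k + int i) \<in> H"
          by (simp only:)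
      qed (use A0 in auto)
      then show ?thesis
        by simp
    qed
  qed
  show ?thesis
    using up[of "nat j"] down[of "nat (int n - j)"] by (cases "j \<ge> 0") auto
qed

text \<open>A sequence in a space that is finite dimensional modulo \<open>H\<close> satisfies a linear relation modulo
  \<open>H\<close>. Induction on the number of generators: one generator is eliminated by means of a term whose
  coefficient \<open>c r\<close> at it does not vanish, applied to the terms after \<open>r\<close>, so that the relation
  found for them stays nontrivial.\<close>

lemma relation_in_span:
  assumes "finite B" "vs.subspace H" "\<And>i. u i \<in> vs.span (B \<union> H)"
  shows "\<exists>A. A \<noteq> 0 \<and> (\<Sum>i\<le>degree A. sc (coeff A i) * u i) \<in> H"
  using assms(1,3)
proof (induction B arbitrary: u)
  case empty
  have "u 0 \<in> H"
    using empty[of 0] assms(2) by (metis Un_empty_left vs.span_eq_iff)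
  then show ?case
    by (intro exI[of _ 1]) (simp add: sc_one)
next
  case (insert b B)
  define S where "S = vs.span (B \<union> H)"
  have S: "vs.subspace S"
    by (simp add: S_def)
  have "\<exists>c. u i - sc c * b \<in> S" for i
    using insert.prems[of i] by (simp add: S_def vs.span_breakdown_eq)
  then obtain c where c: "\<And>i. u i - sc (c i) * b \<in> S"
    by metis
  show ?case
  proof (cases "\<forall>i. c i = 0")
    case True
    then have "\<And>i. u i \<in> vs.span (B \<union> H)"
      using c by (simp add: S_def)
    then show ?thesis
      by (rule insert.IH)
  next
    case False
    then obtain r where r: "c r \<noteq> 0"
      by blast
    \<comment> \<open>the \<open>b\<close>-components cancel in \<open>v\<close>\<close>
    define v where "v i = sc (c r) * u (Suc r + i) - sc (c (Suc r + i)) * u r" for i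
    have "v i \<in> vs.span (B \<union> H)" for i
    proof -
      have "v i = sc (c r) * (u (Suc r + i) - sc (c (Suc r + i)) * b) - sc (c (Suc r + i)) * (u r - sc (c r) * b)"
        by (simp add: v_def right_diff_distrib mult.commute)
      moreover have "\<dots> \<in> S"
        by (intro vs.subspace_diff[OF S] vs.subspace_scale[OF S] c)
      ultimately show ?thesis
        by (simp add: S_def)
    qed
    then have "\<exists>A. A \<noteq> 0 \<and> (\<Sum>i\<le>degree A. sc (coeff A i) * v i) \<in> H"
      by (rule insert.IH)
    then obtain A where A: "A \<noteq> 0" "(\<Sum>i\<le>degree A. sc (coeff A i) * v i) \<in> H"
      by (elim exE conjE)
    define d where "d = (\<Sum>i\<le>degree A. coeff A i * c (Suc r + i))"
    define A' where "A' = monom 1 (Suc r) * Polynomial.smult (c r) A - monom d r"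
    have coeff_A': "coeff A' i = (if i \<ge> Suc r then c r * coeff A (i - Suc r) else 0) - (if i
      = r then d else 0)" for i
      unfolding A'_def coeff_diff coeff_monom_mult by (auto simp: mult.commute)
    have "coeff A' (Suc r + degree A) \<noteq> 0"
      using A r by (simp add: coeff_A')
    then have "A' \<noteq> 0"
      by auto
    have deg: "degree A' \<le> Suc r + degree A"
      by (rule degree_le) (auto simp: coeff_A' coeff_eq_0)
    have "(\<Sum>i\<le>degree A'. sc (coeff A' i) * u i) = (\<Sum>i\<le>Suc r + degree A. sc (coeff A' i) * u i)"
      using deg by (intro sum.mono_neutral_left) (auto simp: coeff_eq_0 sc_zero)
    also have "\<dots> = (\<Sum>i\<in>{r} \<union> {Suc r..Suc r + degree A}. sc (coeff A' i) * u i)"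
      by (intro sum.mono_neutral_right) (auto simp: coeff_A' sc_zero not_less_eq_eq)
    also have "\<dots> = sc (- d) * u r + (\<Sum>i\<in>{Suc r..Suc r + degree A}. sc (coeff A' i) * u i)"
      by (subst sum.union_disjoint) (auto simp: coeff_A')
    also have "(\<Sum>i\<in>{Suc r..Suc r + degree A}. sc (coeff A' i) * u i)
        = (\<Sum>i\<le>degree A. sc (c r * coeff A i) * u (Suc r + i))"
      by (rule sum.reindex_bij_witness[of _ "\<lambda>i. Suc r + i" "\<lambda>i. i - Suc r"]) (auto simp: coeff_A')
    also have "sc (- d) * u r + \<dots> = (\<Sum>i\<le>degree A. sc (coeff A i) * v i)"
      by (simp add: v_def d_def sc_minus sc_sum sum_distrib_right right_diff_distrib sum_subtractf
          mult.commute)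
    finally have "(\<Sum>i\<le>degree A'. sc (coeff A' i) * u i) \<in> H"
      using A by simp
    with \<open>A' \<noteq> 0\<close> show ?thesis
      by blast
  qed
qed

end

section \<open>Highest weight quotients\<close>

text \<open>An irreducible highest weight module as \<open>'r / J\<close>, with \<open>J\<close> the left ideal that annihilates the
  highest weight vector, the class of 1. The algebra itself is \<open>'r / I\<close>.\<close>

locale hw_quotient = scalar_ideal sc I for sc :: "complex \<Rightarrow> 'r::ring_1" and I +
  fixes q1 q2 q3 :: complex and p :: "int \<Rightarrow> complex"
    and e f \<psi> :: "int \<Rightarrow> 'r" and \<psi>inv :: 'r and J :: "'r set"
  assumes q_prod: "q1 * q2 * q3 = 1"
    and q_nontorsion: "\<And>m::nat. m > 0 \<Longrightarrow> q1 ^ m \<noteq> 1 \<and> q2 ^ m \<noteq> 1 \<and> q3 ^ m \<noteq> 1"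
    and p0: "p 0 \<noteq> 0"
    and psi_psiinv: "\<psi> 0 * \<psi>inv - 1 \<in> I" "\<psi>inv * \<psi> 0 - 1 \<in> I"
    and plus_e: "exchange (q1 + q2 + q3) (q1 * q2 + q1 * q3 + q2 * q3) (pos_part \<psi>) e"
    and minus_e: "exchange (q1 + q2 + q3) (q1 * q2 + q1 * q3 + q2 * q3) (neg_part \<psi>inv \<psi>) e"
    and plus_f: "exchange (q1 * q2 + q1 * q3 + q2 * q3) (q1 + q2 + q3) (pos_part \<psi>) f"
    and minus_f: "exchange (q1 * q2 + q1 * q3 + q2 * q3) (q1 + q2 + q3) (neg_part \<psi>inv \<psi>) f"
    and ef: "e i * f j - f j * e i
      - sc (1 / ((1 - q1) * (1 - q2) * (1 - q3))) * (pos_part \<psi> (i + j) - neg_part \<psi>inv \<psi> (i + j)) \<in> I"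
    and generated: "\<lbrakk>vs.subspace Z; \<And>g x. \<lbrakk>g \<in> range e \<union> range f \<union> range \<psi> \<union> {\<psi>inv}; x \<in> Z\<rbrakk> \<Longrightarrow> g * x \<in> Z; x \<in> Z\<rbrakk>
      \<Longrightarrow> a * x \<in> Z"
    and subspace_J: "vs.subspace J"
    and left_J: "x \<in> J \<Longrightarrow> a * x \<in> J"
    and I_J: "I \<subseteq> J"
    and f_J: "f j \<in> J"
    and psi_J: "\<psi> i - sc (p i) \<in> J"
    and psiinv_J: "\<psi>inv - sc (inverse (p 0)) \<in> J"
    and one_J: "1 \<notin> J"
    and maximal: "\<lbrakk>vs.subspace Z; \<And>a x. x \<in> Z \<Longrightarrow> a * x \<in> Z; J \<subseteq> Z\<rbrakk> \<Longrightarrow> Z = J \<or> Z = UNIV"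
begin

lemmas J_add = vs.subspace_add[OF subspace_J]
  and J_diff = vs.subspace_diff[OF subspace_J]
  and J_zero = vs.subspace_0[OF subspace_J]
  and J_sum = vs.subspace_sum[OF subspace_J]

lemma I_mult_J: "r \<in> I \<Longrightarrow> r * a \<in> J"
  using right_I I_J by blast

lemma J_cong: "x - y \<in> J \<Longrightarrow> x \<in> J \<longleftrightarrow> y \<in> J"
  using J_add[of "x - y" y] J_diff[of x "x - y"] by auto

lemma J_trans: "x - y \<in> J \<Longrightarrow> y - z \<in> J \<Longrightarrow> x - z \<in> J"
  using J_add[of "x - y" "y - z"] by simp

lemma span_left_mult:
  assumes "vs.subspace H" "\<And>x. x \<in> S \<Longrightarrow> a * x \<in> H" "x \<in> vs.span S"
  shows "a * x \<in> H"
  using vs.span_minimal[of S "{x. a * x \<in> H}"] subspace_left_mult[OF assms(1)] assms(2,3) by blast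

definition cartan :: "'r set" where
  "cartan = range \<psi> \<union> {\<psi>inv}"

text \<open>The coefficients of \<open>\<psi>\<^sup>+ - \<psi>\<^sup>-\<close>, the right-hand side of the relation between \<open>e\<close> and \<open>f\<close>.\<close>

definition gap :: "int \<Rightarrow> 'r" where
  "gap i = pos_part \<psi> i - neg_part \<psi>inv \<psi> i"

definition \<beta> :: complex where
  "\<beta> = 1 / ((1 - q1) * (1 - q2) * (1 - q3))"

lemma beta_nonzero: "\<beta> \<noteq> 0"
  using q_nontorsion[of 1] by (auto simp: \<beta>_def)

lemma fe: "f j * (e i * z) - (e i * (f j * z) - sc \<beta> * (gap (i + j) * z)) \<in> J"
proof -
  have "- ((e i * f j - f j * e i - sc \<beta> * gap (i + j)) * z) \<in> J"
    using ef[of i j] by (intro vs.subspace_neg[OF subspace_J] I_mult_J) (simp add: \<beta>_def gap_def)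
  then show ?thesis
    by (simp add: algebra_simps)
qed

lemma gap_J: "gap i - sc (weight_gap p i) \<in> J"
proof -
  have "pos_part \<psi> i - sc (pos_part p i) \<in> J"
    using psi_J J_zero by (simp add: pos_part_def sc_zero)
  moreover have "neg_part \<psi>inv \<psi> i - sc (neg_part (inverse (p 0)) p i) \<in> J"
    using psi_J psiinv_J J_zero by (simp add: neg_part_def sc_zero)
  ultimately have "(pos_part \<psi> i - sc (pos_part p i)) - (neg_part \<psi>inv \<psi> i - sc (neg_part (inverse (p 0)) p i)) \<in> J"
    by (rule J_diff)
  then show ?thesis
    by (simp add: gap_def weight_gap_def sc_diff algebra_simps)
qed

lemma cartan_weight: "g \<in> cartan \<Longrightarrow> \<exists>c. g - sc c \<in> J"
  using psi_J psiinv_J by (auto simp: cartan_def)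

lemma pos_part_cartan: "pos_part \<psi> n \<in> insert 0 cartan"
  by (simp add: pos_part_def cartan_def)

lemma neg_part_cartan: "neg_part \<psi>inv \<psi> n \<in> insert 0 cartan"
  by (simp add: neg_part_def cartan_def)

lemma cartan_cases:
  assumes "g \<in> cartan"
  obtains n where "g = pos_part \<psi> n" | n where "g = neg_part \<psi>inv \<psi> n"
proof -
  have "\<psi> n = (if n \<ge> 0 then pos_part \<psi> n else neg_part \<psi>inv \<psi> n)" for n
    by (simp add: pos_part_def neg_part_def)
  moreover have "\<psi>inv = neg_part \<psi>inv \<psi> 0"
    by (simp add: neg_part_def)
  ultimately show ?thesis
    using assms that unfolding cartan_def by (metis UnE imageE singletonD)
qed

text \<open>Every element of \<open>cartan\<close> is a coefficient of \<open>\<psi>\<^sup>+\<close> or of \<open>\<psi>\<^sup>-\<close>, and the latter is one-sided in the sense of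
  \<open>exchange_pass\<close> when read backwards.\<close>

lemma cartan_pass:
  assumes plus: "exchange s t (pos_part \<psi>) y" and minus: "exchange s t (neg_part \<psi>inv \<psi>) y"
    and H: "vs.subspace H" "\<And>r. r \<in> I \<Longrightarrow> r * z \<in> H"
  shows "(\<forall>g\<in>cartan. \<forall>j. y j * (g * z) \<in> H) \<longleftrightarrow> (\<forall>g\<in>cartan. \<forall>j. g * (y j * z) \<in> H)"
proof -
  have P: "(\<forall>k j. y j * (pos_part \<psi> k * z) \<in> H) \<longleftrightarrow> (\<forall>k j. pos_part \<psi> k * (y j * z) \<in> H)"
    by (rule exchange_pass[OF plus _ H]) (simp_all add: pos_part_def)
  have "(\<forall>k j. y (- j) * (neg_part \<psi>inv \<psi> (- k) * z) \<in> H) \<longleftrightarrow> (\<forall>k j. neg_part \<psi>inv \<psi> (- k) * (y (- j) * z) \<in> H)"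
    by (rule exchange_pass[OF exchange_reverse[OF minus] _ H]) (simp_all add: neg_part_def)
  then have M: "(\<forall>k j. y j * (neg_part \<psi>inv \<psi> k * z) \<in> H) \<longleftrightarrow> (\<forall>k j. neg_part \<psi>inv \<psi> k * (y j * z) \<in> H)"
    by (metis minus_minus)
  have H0: "0 \<in> H"
    using H by (simp add: vs.subspace_0)
  have all: "(\<forall>g\<in>cartan. Q g) \<longleftrightarrow> (\<forall>k. Q (pos_part \<psi> k)) \<and> (\<forall>k. Q (neg_part \<psi>inv \<psi> k))" if "Q 0" for Q
    using pos_part_cartan neg_part_cartan cartan_cases that by (metis insertE)
  show ?thesis
    using P M H0 by (subst (1 2) all) auto
qed

section \<open>Words in the lowering operators\<close>

definition eword :: "int list \<Rightarrow> 'r" where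
  "eword js = prod_list (map e js)"

lemma eword_Nil: "eword [] = 1"
  and eword_Cons: "eword (j # js) = e j * eword js"
  by (simp_all add: eword_def)

text \<open>The full preimage of the component of degree \<open>-k\<close>: it contains \<open>J\<close>, so that membership can be
  tested modulo \<open>J\<close>.\<close>

definition level :: "nat \<Rightarrow> 'r set" where
  "level k = vs.span (eword ` {js. length js = k} \<union> J)"

lemma subspace_level: "vs.subspace (level k)"
  by (simp add: level_def)

lemma J_level: "J \<subseteq> level k"
  unfolding level_def by (auto intro: vs.span_base)

lemma eword_level: "eword js \<in> level (length js)"
  unfolding level_def by (rule vs.span_base) blast

lemma level_left_mult:
  assumes "vs.subspace H" "J \<subseteq> H" "\<And>js. length js = k \<Longrightarrow> a * eword js \<in> H" "x \<in> level k"
  shows "a * x \<in> H"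
  using assms(4) unfolding level_def
  by (rule span_left_mult[OF assms(1), rotated]) (use assms(2,3) left_J in blast)

lemma e_level: "x \<in> level k \<Longrightarrow> e i * x \<in> level (Suc k)"
  by (erule level_left_mult[OF subspace_level J_level, rotated]) (metis eword_Cons eword_level length_Cons)

lemma I_level: "r \<in> I \<Longrightarrow> r * a \<in> level k"
  using I_mult_J J_level by blast

lemma cartan_level: "g \<in> cartan \<Longrightarrow> x \<in> level k \<Longrightarrow> g * x \<in> level k"
proof (induction k arbitrary: g x)
  case 0
  obtain c where c: "g - sc c \<in> J"
    using cartan_weight[OF 0(1)] by blast
  have "sc c * 1 \<in> level 0"
    using eword_level[of "[]"] by (intro vs.subspace_scale[OF subspace_level]) (simp add: eword_Nil)
  then have "sc c * 1 + (g - sc c) \<in> level 0"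
    using c J_level by (intro vs.subspace_add[OF subspace_level]) auto
  then have "g \<in> level 0"
    by simp
  then show ?case
    by (intro level_left_mult[OF subspace_level J_level _ 0(2)]) (simp add: eword_Nil)
next
  case (Suc k)
  show ?case
  proof (rule level_left_mult[OF subspace_level J_level _ Suc.prems(2)])
    fix js :: "int list" assume "length js = Suc k"
    then obtain j js' where js: "js = j # js'" "length js' = k"
      by (metis length_Suc_conv)
    have "eword js' \<in> level k"
      using eword_level[of js'] js by simp
    then have "\<forall>g\<in>cartan. \<forall>j. e j * (g * eword js') \<in> level (Suc k)"
      by (blast intro: e_level Suc.IH)
    then have "\<forall>g\<in>cartan. \<forall>j. g * (e j * eword js') \<in> level (Suc k)"
      by (subst (asm) cartan_pass[OF plus_e minus_e subspace_level I_level])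
    then show "g * eword js \<in> level (Suc k)"
      using Suc.prems(1) js by (simp add: eword_Cons)
  qed
qed

lemma gap_level: "x \<in> level k \<Longrightarrow> gap i * x \<in> level k"
proof -
  assume x: "x \<in> level k"
  have "g * x \<in> level k" if "g \<in> insert 0 cartan" for g
    using that x cartan_level vs.subspace_0[OF subspace_level] by auto
  then show ?thesis
    using pos_part_cartan neg_part_cartan
    by (auto simp: gap_def left_diff_distrib intro!: vs.subspace_diff[OF subspace_level])
qed

lemma f_level_0: "x \<in> level 0 \<Longrightarrow> f j * x \<in> J"
  by (erule level_left_mult[OF subspace_J order_refl, rotated]) (simp add: eword_Nil f_J)

lemma f_level_Suc: "x \<in> level (Suc k) \<Longrightarrow> f j * x \<in> level k"
proof (induction k arbitrary: x j)
  case (0 x j)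
  show ?case
  proof (rule level_left_mult[OF subspace_level J_level _ 0])
    fix js :: "int list" assume "length js = Suc 0"
    then obtain i where "js = [i]"
      by (metis length_0_conv length_Suc_conv)
    have one: "1 \<in> level 0"
      using eword_level[of "[]"] by (simp add: eword_Nil)
    have "e i * (f j * 1) - sc \<beta> * (gap (i + j) * 1) \<in> level 0"
      using f_J[of j] left_J J_level gap_level[OF one]
      by (intro vs.subspace_diff[OF subspace_level] vs.subspace_scale[OF subspace_level]) auto
    then show "f j * eword js \<in> level 0"
      using fe[of j i 1] J_level[of 0] vs.subspace_add[OF subspace_level]
      by (fastforce simp: \<open>js = [i]\<close> eword_def)
  qed
next
  case (Suc k)
  show ?case
  proof (rule level_left_mult[OF subspace_level J_level _ Suc.prems])
    fix js :: "int list" assume "length js = Suc (Suc k)"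
    then obtain i js' where js: "js = i # js'" "length js' = Suc k"
      by (metis length_Suc_conv)
    have w: "eword js' \<in> level (Suc k)"
      using eword_level[of js'] js by simp
    have "e i * (f j * eword js') - sc \<beta> * (gap (i + j) * eword js') \<in> level (Suc k)"
      by (intro vs.subspace_diff[OF subspace_level] vs.subspace_scale[OF subspace_level] e_level Suc.IH gap_level w)
    then show "f j * eword js \<in> level (Suc k)"
      using fe[of j i "eword js'"] J_level[of "Suc k"] vs.subspace_add[OF subspace_level]
      by (fastforce simp: js eword_Cons)
  qed
qed

definition level_preserving :: "'r set" where
  "level_preserving = {a. \<forall>k. \<forall>x\<in>level k. a * x \<in> level k}"

lemma subspace_level_preserving: "vs.subspace level_preserving"
  by (intro vs.subspaceI)
     (auto simp: level_preserving_def distrib_right mult.assoc intro: vs.subspace_0[OF subspace_level]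
       vs.subspace_add[OF subspace_level] vs.subspace_scale[OF subspace_level])

lemma level_preserving_mult: "a \<in> level_preserving \<Longrightarrow> b \<in> level_preserving \<Longrightarrow> a * b \<in> level_preserving"
  by (auto simp: level_preserving_def mult.assoc)

lemma cartan_level_preserving: "insert 0 cartan \<subseteq> level_preserving"
  using cartan_level vs.subspace_0[OF subspace_level_preserving] by (auto simp: level_preserving_def)

section \<open>Separating degrees by Cartan elements\<close>

text \<open>After normalization \<open>\<psi>\<^sup>+\<close>, and likewise \<open>\<psi>\<^sup>-\<close>, fixes the highest weight vector and has all
  coefficients of positive index in \<open>J\<close>; the root \<open>U\<close> from \<open>intertwiner_exists\<close> inherits this.\<close>

lemma elementary_operators:
  assumes ex: "exchange (a1 + a2 + a3) (a1 * a2 + a1 * a3 + a2 * a3) x y"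
    and a: "a1 * a2 * a3 = 1" "\<And>m::nat. m > 0 \<Longrightarrow> a1 ^ m \<noteq> 1 \<and> a2 ^ m \<noteq> 1 \<and> a3 ^ m \<noteq> 1"
    and zero: "\<And>n. n < 0 \<Longrightarrow> x n = 0"
    and c: "c * x 0 - 1 \<in> I" "\<And>j. c * y j - y j * c \<in> I"
    and level_preserving: "\<And>k. x k \<in> level_preserving" "c \<in> level_preserving"
    and weight: "\<And>k. x (int k) - sc (w k) \<in> J" "c - sc (1 / w 0) \<in> J" "w 0 \<noteq> 0"
  shows "\<exists>U \<in> unipotent (J \<inter> level_preserving). intertwines y (Suc n) U (lin 1)"
proof -
  define P where "P = Abs_fps (\<lambda>k. w k / w 0)"
  define g where "g = inverse P"
  have P0: "P $ 0 = 1"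
    using weight(3) by (simp add: P_def)
  then have g0: "g $ 0 = 1"
    by (simp add: g_def)
  define \<Phi> where "\<Phi> = Abs_fps (\<lambda>n. if n = 0 then 1 else (\<Sum>k=0..n. sc (g $ (n - k)) * (c * x (int k))))"
  have cx: "c * x (int k) - sc (P $ k) \<in> J" for k
  proof -
    have "c * (x (int k) - sc (w k)) + sc (w k) * (c - sc (1 / w 0)) \<in> J"
      using weight by (intro J_add left_J)
    moreover have "c * sc (w k) = sc (w k) * c"
      by (rule sc_central[symmetric])
    ultimately show ?thesis
      by (simp add: P_def algebra_simps flip: sc_mult)
  qed
  have "\<Phi> $ n \<in> J \<inter> level_preserving" if "n > 0" for n
  proof
    show "\<Phi> $ n \<in> level_preserving"
      using that level_preserving unfolding \<Phi>_def
      by (auto intro!: vs.subspace_sum[OF subspace_level_preserving] vs.subspace_scale[OF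
        subspace_level_preserving] level_preserving_mult)
    have "(\<Sum>k=0..n. sc (g $ (n - k)) * (c * x (int k) - sc (P $ k))) \<in> J"
      by (intro J_sum left_J cx)
    moreover have "(\<Sum>k=0..n. sc (g $ (n - k)) * sc (P $ k)) = 0"
    proof -
      have "(\<Sum>k=0..n. sc (g $ (n - k)) * sc (P $ k)) = sc ((P * g) $ n)"
        by (simp add: fps_mult_nth sc_sum sc_mult[symmetric] mult.commute)
      also have "P * g = 1"
        using P0 by (simp add: g_def inverse_mult_eq_1')
      finally show ?thesis
        using that by (simp add: sc_zero)
    qed
    ultimately show "\<Phi> $ n \<in> J"
      using that by (simp add: \<Phi>_def right_diff_distrib sum_subtractf)
  qed
  then have U: "\<Phi> \<in> unipotent (J \<inter> level_preserving)"
    by (simp add: unipotent_def \<Phi>_def)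
  have "vs.subspace (J \<inter> level_preserving)"
    by (intro vs.subspace_inter subspace_J subspace_level_preserving)
  moreover have "a * b \<in> J \<inter> level_preserving" if "a \<in> J \<inter> level_preserving" "b \<in> J \<inter> level_preserving" for a b
    using that left_J level_preserving_mult by blast
  moreover have "(lin a1 * lin a2 * lin a3) $ 0 = 1"
    by (simp add: lin_nth)
  then have "lin (inverse a1) * lin (inverse a2) * lin (inverse a3) * inverse (lin a1 * lin a2 * lin a3)
      * (lin a1 * lin a2 * lin a3) = lin (inverse a1) * lin (inverse a2) * lin (inverse a3)"
    by (subst mult.assoc) (simp add: inverse_mult_eq_1)
  ultimately show ?thesis
    using normalized_intertwiner[OF ex a(1) zero c g0] U unfolding \<Phi>_def
    by (intro intertwiner_exists[OF a]) auto
qed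

text \<open>A series that multiplies each \<open>y(w)\<close> by \<open>1 - t w\<close> and fixes the highest weight vector multiplies a word of
  length \<open>m\<close> by \<open>\<Prod>\<^sub>i (1 - t w\<^sub>i)\<close>. So its coefficients beyond \<open>m\<close> kill the word and its coefficient at
  \<open>m\<close> is, up to sign, the shift of all indices by one.\<close>

lemma intertwiner_on_words:
  assumes U: "U \<in> unipotent J" "intertwines y (Suc n) U (lin 1)" and len: "length js \<le> n"
  shows "(\<forall>k. length js < k \<and> k \<le> n \<longrightarrow> U $ k * prod_list (map y js) \<in> J)
    \<and> U $ length js * prod_list (map y js)
        - sc ((- 1) ^ length js) * prod_list (map (\<lambda>j. y (j + 1)) js) \<in> J"
  using len
proof (induction js)
  case Nil
  then show ?case
    using U(1) J_zero by (auto simp: unipotent_def sc_one)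
next
  case (Cons j js)
  define w where "w = prod_list (map y js)"
  define w' where "w' = prod_list (map (\<lambda>j. y (j + 1)) js)"
  have step: "U $ k * (y j * w) - (y j * (U $ k * w) - y (j + 1) * (U $ (k - 1) * w)) \<in> J"
    if k: "0 < k" "k \<le> n" for k
  proof -
    have "(\<Sum>i=0..k. sc (lin 1 $ i) * y (j + int i) * U $ (k - i))
        = (\<Sum>i\<in>{0, 1}. sc (lin 1 $ i) * y (j + int i) * U $ (k - i))"
      using k by (intro sum.mono_neutral_right) (auto simp: lin_nth sc_zero)
    then have "defect U (lin 1) y j k = U $ k * y j - (y j * U $ k - y (j + 1) * U $ (k - 1))"
      by (simp add: defect_eq lin_nth sc_one sc_minus)
    moreover have "defect U (lin 1) y j k \<in> I"
      using U(2) k by (auto simp: intertwines_def)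
    ultimately have "(U $ k * y j - (y j * U $ k - y (j + 1) * U $ (k - 1))) * w \<in> J"
      by (metis I_mult_J)
    then show ?thesis
      by (simp add: algebra_simps)
  qed
  have IH: "\<And>k. length js < k \<Longrightarrow> k \<le> n \<Longrightarrow> U $ k * w \<in> J"
    "U $ length js * w - sc ((- 1) ^ length js) * w' \<in> J"
    using Cons by (auto simp: w_def w'_def)
  show ?case
  proof (intro conjI allI impI)
    fix k assume k: "length (j # js) < k \<and> k \<le> n"
    then have "y j * (U $ k * w) - y (j + 1) * (U $ (k - 1) * w) \<in> J"
      by (intro J_diff left_J IH) auto
    then show "U $ k * prod_list (map y (j # js)) \<in> J"
      using J_cong[OF step[of k]] k by (simp add: w_def)
  next
    define k where "k = length (j # js)"
    have "U $ k * w \<in> J" "U $ (k - 1) * w - sc ((- 1) ^ length js) * w' \<in> J"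
      using Cons.prems IH by (simp_all add: k_def)
    then have "y j * (U $ k * w) - y (j + 1) * (U $ (k - 1) * w - sc ((- 1) ^ length js) * w') \<in> J"
      by (rule J_diff[OF left_J left_J])
    moreover have "y (j + 1) * (sc ((- 1) ^ length js) * w') = sc ((- 1) ^ length js) * (y (j + 1) * w')"
      by (rule sc_left_commute)
    ultimately have "(y j * (U $ k * w) - y (j + 1) * (U $ (k - 1) * w)) - sc ((- 1) ^ k) * (y (j + 1) * w') \<in> J"
      by (simp add: k_def algebra_simps sc_minus)
    with step[of k] have "U $ k * (y j * w) - sc ((- 1) ^ k) * (y (j + 1) * w') \<in> J"
      using Cons.prems J_trans unfolding k_def by (metis length_greater_0_conv list.distinct(1))
    then show "U $ length (j # js) * prod_list (map y (j # js))
        - sc ((- 1) ^ length (j # js)) * prod_list (map (\<lambda>j. y (j + 1)) (j # js)) \<in> J"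
      by (simp add: k_def w_def w'_def)
  qed
qed

lemma psi0_commute: "\<psi> 0 * e j - e j * \<psi> 0 \<in> I"
  \<comment> \<open>at this index only the leading coefficient of \<open>\<psi>\<^sup>+\<close> is left in the relation\<close>
  using plus_e[unfolded exchange_def, THEN spec, of 0, THEN spec, of j] by (simp add: pos_part_def)

lemma psiinv_commute: "\<psi>inv * e j - e j * \<psi>inv \<in> I"
  \<comment> \<open>at this index only the top coefficient \<open>\<psi>inv\<close> of \<open>\<psi>\<^sup>-\<close> is left in the relation\<close>
  using minus_I[OF minus_e[unfolded exchange_def, THEN spec, of 3, THEN spec, of "j - 3"]]
  by (simp add: neg_part_def)

text \<open>The roots built from \<open>\<psi>\<^sup>+\<close> and \<open>\<psi>\<^sup>-\<close> shift all indices of a word of length \<open>n\<close> up and down,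
  respectively, so the product of their coefficients at \<open>n\<close> acts as the identity in degree \<open>-n\<close>,
  while it kills the highest weight vector. Such an operator takes the place of a grading element.\<close>

lemma degree_detector:
  assumes "n > 0"
  shows "\<exists>T \<in> J \<inter> level_preserving. \<forall>js. length js = n \<longrightarrow> T * eword js - eword js \<in> J"
proof -
  have nz: "q1 \<noteq> 0" "q2 \<noteq> 0" "q3 \<noteq> 0"
    using q_prod by auto
  have inv: "inverse q1 = q2 * q3" "inverse q2 = q1 * q3" "inverse q3 = q1 * q2"
    using q_prod by (auto intro!: inverse_unique simp: ac_simps)
  have pos_Stab: "pos_part \<psi> k \<in> level_preserving" and neg_Stab: "neg_part \<psi>inv \<psi> k \<in> level_preserving" for k
    using pos_part_cartan neg_part_cartan cartan_level_preserving by blast+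
  have "\<exists>U \<in> unipotent (J \<inter> level_preserving). intertwines e (Suc n) U (lin 1)"
  proof (rule elementary_operators[OF plus_e q_prod q_nontorsion, where c = \<psi>inv and w = "\<lambda>k. p (int k)"])
    show "\<psi>inv \<in> level_preserving"
      using neg_Stab[of 0] by (simp add: neg_part_def)
  qed (use p0 psi_J psiinv_J psi_psiinv psiinv_commute pos_Stab in \<open>simp_all add: pos_part_def inverse_eq_divide\<close>)
  then obtain U where U: "U \<in> unipotent (J \<inter> level_preserving)" "intertwines e (Suc n) U (lin 1)"
    by blast
  \<comment> \<open>for \<open>\<psi>\<^sup>-\<close> everything is read backwards, and the \<open>q\<^sub>i\<close> are inverted\<close>
  define y where "y j = e (- j)" for j
  have s: "inverse q1 + inverse q2 + inverse q3 = q1 * q2 + q1 * q3 + q2 * q3"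
    unfolding inv by simp
  have t: "inverse q1 * inverse q2 + inverse q1 * inverse q3 + inverse q2 * inverse q3 = q1 + q2 + q3"
  proof -
    have "inverse (q1 * q2) = q3" "inverse (q1 * q3) = q2" "inverse (q2 * q3) = q1"
      by (rule inverse_unique, use q_prod in \<open>simp add: ac_simps\<close>)+
    then show ?thesis
      by simp
  qed
  have ex: "exchange (inverse q1 + inverse q2 + inverse q3)
      (inverse q1 * inverse q2 + inverse q1 * inverse q3 + inverse q2 * inverse q3) (\<lambda>n. neg_part \<psi>inv \<psi> (- n)) y"
    unfolding s t y_def by (rule exchange_reverse[OF minus_e])
  have "\<exists>U \<in> unipotent (J \<inter> level_preserving). intertwines y (Suc n) U (lin 1)"
  proof (rule elementary_operators[OF ex, where c = "\<psi> 0" and w = "\<lambda>k. if k = 0 then inverse (p 0) else p (- int k)"])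
    show "inverse q1 * inverse q2 * inverse q3 = 1"
      using q_prod by (simp flip: inverse_mult_distrib)
    show "inverse q1 ^ m \<noteq> 1 \<and> inverse q2 ^ m \<noteq> 1 \<and> inverse q3 ^ m \<noteq> 1" if "m > 0" for m
      using q_nontorsion[OF that] by (simp add: power_inverse)
    show "\<psi> 0 \<in> level_preserving"
      using pos_Stab[of 0] by (simp add: pos_part_def)
    show "neg_part \<psi>inv \<psi> (- k) \<in> level_preserving" for k
      by (rule neg_Stab)
  qed (use p0 psi_J psiinv_J psi_psiinv psi0_commute in \<open>simp_all add: neg_part_def y_def inverse_eq_divide\<close>)
  then obtain U' where U': "U' \<in> unipotent (J \<inter> level_preserving)" "intertwines y (Suc n) U' (lin 1)"
    by blast
  have unip: "U \<in> unipotent J" "U' \<in> unipotent J"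
    using U(1) U'(1) by (auto simp: unipotent_def)
  show ?thesis
  proof (intro bexI allI impI)
    have "U $ n \<in> J \<inter> level_preserving" "U' $ n \<in> J \<inter> level_preserving"
      using U(1) U'(1) assms by (auto simp: unipotent_def)
    then show "U' $ n * U $ n \<in> J \<inter> level_preserving"
      using left_J level_preserving_mult by blast
    fix js :: "int list" assume len: "length js = n"
    define w where "w = prod_list (map (\<lambda>j. e (j + 1)) js)"
    have 1: "U $ n * eword js - sc ((- 1) ^ n) * w \<in> J"
      using intertwiner_on_words[OF unip(1) U(2), of js] len by (simp add: eword_def w_def)
    \<comment> \<open>raising the negated indices by one lowers the indices of \<open>w\<close> back to those of \<open>js\<close>\<close>
    have "U' $ n * w - sc ((- 1) ^ n) * eword js \<in> J"
      using intertwiner_on_words[OF unip(2) U'(2), of "map (\<lambda>j. - (j + 1)) js"] len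
      by (simp add: eword_def w_def y_def comp_def add.commute)
    then have "U' $ n * (U $ n * eword js - sc ((- 1) ^ n) * w)
        + sc ((- 1) ^ n) * (U' $ n * w - sc ((- 1) ^ n) * eword js) \<in> J"
      using 1 by (intro J_add left_J)
    moreover have "U' $ n * (sc ((- 1) ^ n) * w) = sc ((- 1) ^ n) * (U' $ n * w)"
      by (rule sc_left_commute)
    moreover have "sc ((- 1) ^ n) * (sc ((- 1) ^ n) * eword js) = eword js"
      by (simp add: sc_one flip: power_add)
    ultimately show "U' $ n * U $ n * eword js - eword js \<in> J"
      by (simp add: right_diff_distrib mult.assoc del: vs.scale_scale)
  qed
qed

definition levels_upto :: "nat \<Rightarrow> 'r set" where
  "levels_upto K = vs.span (eword ` {js. js \<noteq> [] \<and> length js \<le> K} \<union> J)"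

lemma subspace_levels_upto: "vs.subspace (levels_upto K)"
  by (simp add: levels_upto_def)

lemma J_levels_upto: "J \<subseteq> levels_upto K"
  unfolding levels_upto_def by (auto intro: vs.span_base)

lemma level_subset_levels_upto: "0 < k \<Longrightarrow> k \<le> K \<Longrightarrow> level k \<subseteq> levels_upto K"
  unfolding level_def levels_upto_def by (intro vs.span_mono) auto

text \<open>If the highest weight vector were a sum of vectors of degrees \<open>-1, \<dots>, -K\<close>, then \<open>1 - T\<close>, with \<open>T\<close> the
  detector of degree \<open>-K\<close>, would remove the last summand and keep the highest weight vector.\<close>

lemma one_notin_levels_upto: "1 \<notin> levels_upto K"
proof (induction K)
  case 0
  have "levels_upto 0 = J"
    using subspace_J by (simp add: levels_upto_def)
  then show ?case
    using one_J by simp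
next
  case (Suc K)
  obtain T where T: "T \<in> J" "T \<in> level_preserving" "\<And>js. length js = Suc K \<Longrightarrow> T * eword js - eword js \<in> J"
    using degree_detector[of "Suc K"] by blast
  have "(1 - T) * x \<in> levels_upto K" if "x \<in> levels_upto (Suc K)" for x
    using that unfolding levels_upto_def[of "Suc K"]
  proof (rule span_left_mult[OF subspace_levels_upto, rotated])
    fix x assume "x \<in> eword ` {js. js \<noteq> [] \<and> length js \<le> Suc K} \<union> J"
    then consider "x \<in> J" | js where "x = eword js" "js \<noteq> []" "length js \<le> K" | js where "x = eword js"
      "length js = Suc K"
      by force
    then show "(1 - T) * x \<in> levels_upto K"
    proof cases
      case 1
      then show ?thesis
        using left_J J_levels_upto by blast
    next
      case 2
      have "x - T * x \<in> level (length js)"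
        using T(2) eword_level[of js] 2 by (intro vs.subspace_diff[OF subspace_level]) (auto simp:
          level_preserving_def)
      then show ?thesis
        using level_subset_levels_upto[of "length js" K] 2 by (auto simp: left_diff_distrib)
    next
      case 3
      have "- (T * x - x) \<in> J"
        using T(3) 3 by (intro vs.subspace_neg[OF subspace_J]) auto
      then show ?thesis
        using J_levels_upto[of K] by (auto simp: left_diff_distrib)
    qed
  qed
  then have "1 \<in> levels_upto (Suc K) \<Longrightarrow> 1 - T + T \<in> levels_upto K"
    using T(1) J_levels_upto[of K] vs.subspace_add[OF subspace_levels_upto, of "1 - T" K T] by fastforce
  then show ?case
    using Suc by auto
qed

section \<open>Singular vectors\<close>

text \<open>The vectors of degree \<open>-k\<close> that all \<open>f\<^sub>j\<close> kill generate a submodule \<open>Z\<close> in degrees at most \<open>-k\<close>: the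
  \<open>\<psi>\<close>'s preserve the space of such vectors, and moving \<open>\<psi>\<close>'s and \<open>f\<close>'s to the right shows that words in
  the \<open>e\<close>'s applied to it span \<open>Z\<close>. By irreducibility \<open>Z\<close> is zero or everything, and it does
  not contain the highest weight vector.\<close>

lemma singular_vanish:
  assumes k: "0 < k" and x: "x \<in> level k" "\<And>j. f j * x \<in> J"
  shows "x \<in> J"
proof -
  define Y where "Y = {y \<in> level k. \<forall>j. f j * y \<in> J}"
  define Z where "Z = vs.span {eword js * y | js y. y \<in> Y}"
  have Z: "vs.subspace Z"
    by (simp add: Z_def)
  have base: "eword js * y \<in> Z" if "y \<in> Y" for js y
    using that unfolding Z_def by (intro vs.span_base) blast
  have Y_Z: "Y \<subseteq> Z"
    using base[of _ "[]"] by (auto simp: eword_Nil)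
  have J_Y: "J \<subseteq> Y"
    using J_level left_J by (auto simp: Y_def)
  then have J_Z: "J \<subseteq> Z"
    using Y_Z by blast
  have I_Z: "r * z \<in> Z" if "r \<in> I" for r z
    using I_mult_J[OF that] J_Z by blast
  have closed: "a * z \<in> Z" if "\<And>js y. y \<in> Y \<Longrightarrow> a * (eword js * y) \<in> Z" "z \<in> Z" for a z
    using that(2) unfolding Z_def
    by (rule span_left_mult[OF Z[unfolded Z_def], rotated]) (use that(1) Z_def in auto)
  have e_Z: "e j * z \<in> Z" if "z \<in> Z" for j z
  proof (rule closed[OF _ that])
    fix js y assume "y \<in> Y"
    then show "e j * (eword js * y) \<in> Z"
      using base[of y "j # js"] by (simp add: eword_Cons mult.assoc)
  qed
  have cartan_Y: "g * y \<in> Y" if "g \<in> cartan" "y \<in> Y" for g y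
  proof -
    have "\<forall>g\<in>cartan. \<forall>j. g * (f j * y) \<in> J"
      using that(2) left_J by (auto simp: Y_def)
    then have "\<forall>g\<in>cartan. \<forall>j. f j * (g * y) \<in> J"
      by (subst cartan_pass[OF plus_f minus_f subspace_J I_mult_J])
    then show ?thesis
      using that cartan_level by (auto simp: Y_def)
  qed
  have cartan_word: "\<forall>g\<in>cartan. g * (eword js * y) \<in> Z" if "y \<in> Y" for js y
  proof (induction js)
    case Nil
    then show ?case
      using cartan_Y[OF _ that] Y_Z by (auto simp: eword_Nil)
  next
    case (Cons j js)
    then have "\<forall>g\<in>cartan. \<forall>j. e j * (g * (eword js * y)) \<in> Z"
      using e_Z by blast
    then have "\<forall>g\<in>cartan. \<forall>j. g * (e j * (eword js * y)) \<in> Z"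
      by (subst (asm) cartan_pass[OF plus_e minus_e Z I_Z])
    then show ?case
      by (simp add: eword_Cons mult.assoc)
  qed
  have cartan_Z: "g * z \<in> Z" if "g \<in> cartan" "z \<in> Z" for g z
    by (rule closed[OF _ that(2)]) (use cartan_word that(1) in blast)
  have gap_Z: "gap i * z \<in> Z" if "z \<in> Z" for i z
  proof -
    have "g * z \<in> Z" if "g \<in> insert 0 cartan" for g
      using that \<open>z \<in> Z\<close> cartan_Z vs.subspace_0[OF Z] by auto
    then show ?thesis
      using pos_part_cartan neg_part_cartan
      by (auto simp: gap_def left_diff_distrib intro!: vs.subspace_diff[OF Z])
  qed
  have f_word: "f j * (eword js * y) \<in> Z" if "y \<in> Y" for j js y
  proof (induction js arbitrary: j)
    case Nil
    then show ?case
      using that J_Z by (auto simp: Y_def eword_Nil)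
  next
    case (Cons i js)
    have "e i * (f j * (eword js * y)) - sc \<beta> * (gap (i + j) * (eword js * y)) \<in> Z"
      by (intro vs.subspace_diff[OF Z] vs.subspace_scale[OF Z] e_Z gap_Z Cons.IH base that)
    then show ?case
      using fe[of j i "eword js * y"] J_Z vs.subspace_add[OF Z]
      by (fastforce simp: eword_Cons mult.assoc)
  qed
  have f_Z: "f j * z \<in> Z" if "z \<in> Z" for j z
    by (rule closed[OF _ that]) (rule f_word)
  have "a * z \<in> Z" if "z \<in> Z" for a z
    by (rule generated[OF Z _ that]) (use e_Z f_Z cartan_Z in \<open>auto simp: cartan_def\<close>)
  then consider "Z = J" | "Z = UNIV"
    using maximal[OF Z _ J_Z] by blast
  then show ?thesis
  proof cases
    case 1
    then show ?thesis
      using x Y_Z by (auto simp: Y_def)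
  next
    case 2
    have "vs.subspace (\<Union>K. levels_upto K)"
    proof (rule vs.subspaceI)
      have mono: "levels_upto K \<subseteq> levels_upto K'" if "K \<le> K'" for K K'
        unfolding levels_upto_def using that by (intro vs.span_mono) auto
      fix x y assume "x \<in> (\<Union>K. levels_upto K)" "y \<in> (\<Union>K. levels_upto K)"
      then obtain K K' where "x \<in> levels_upto K" "y \<in> levels_upto K'"
        by blast
      then have "x \<in> levels_upto (max K K')" "y \<in> levels_upto (max K K')"
        using mono[of K "max K K'"] mono[of K' "max K K'"] by auto
      then show "x + y \<in> (\<Union>K. levels_upto K)"
        using vs.subspace_add[OF subspace_levels_upto] by blast
    qed (auto intro: vs.subspace_0[OF subspace_levels_upto] vs.subspace_scale[OF subspace_levels_upto])
    moreover have "eword js * y \<in> (\<Union>K. levels_upto K)" if "y \<in> Y" for js y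
    proof -
      have "eword js * y \<in> level (length js + k)"
      proof (induction js)
        case Nil
        then show ?case
          using that by (simp add: eword_Nil Y_def)
      next
        case (Cons j js)
        then show ?case
          using e_level by (simp add: eword_Cons mult.assoc)
      qed
      then show ?thesis
        using level_subset_levels_upto[of "length js + k" "length js + k"] k by auto
    qed
    ultimately have "Z \<subseteq> (\<Union>K. levels_upto K)"
      unfolding Z_def by (intro vs.span_minimal) auto
    then show ?thesis
      using 2 one_notin_levels_upto by blast
  qed
qed

section \<open>Annihilating polynomials\<close>

text \<open>\<open>A(w)\<close> kills \<open>e(w)\<close> and \<open>\<psi>\<^sup>+(w) - \<psi>\<^sup>-(w)\<close> in degree \<open>-k\<close>.\<close>

definition annihilates :: "complex poly \<Rightarrow> nat \<Rightarrow> bool" where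
  "annihilates A k \<longleftrightarrow> (\<forall>x\<in>level k. \<forall>j. act A (\<lambda>i. e i * x) j \<in> J \<and> act A (\<lambda>i. gap i * x) j \<in> J)"

text \<open>\<open>A(w) e(w) x\<close> vanishes as soon as all \<open>f\<^sub>l\<close> kill it, and the commutator of \<open>f\<^sub>l\<close> with \<open>A(w) e(w)\<close> is a
  multiple of \<open>A(w) (\<psi>\<^sup>+(w) - \<psi>\<^sup>-(w))\<close>.\<close>

lemma annihilates_e:
  assumes gap: "\<And>j. act A (\<lambda>i. gap i * x) j \<in> J"
    and lower: "\<And>l j. act A (\<lambda>i. e i * (f l * x)) j \<in> J"
    and x: "x \<in> level k"
  shows "act A (\<lambda>i. e i * x) j \<in> J"
proof (rule singular_vanish)
  show "act A (\<lambda>i. e i * x) j \<in> level (Suc k)"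
    by (intro act_subspace[OF subspace_level] e_level x)
  fix l
  have "f l * act A (\<lambda>i. e i * x) j = act A (\<lambda>i. f l * (e i * x)) j"
    by (simp only: act_left)
  moreover have "act A (\<lambda>i. f l * (e i * x)) j \<in> J
      \<longleftrightarrow> act A (\<lambda>i. e i * (f l * x) - sc \<beta> * (gap (i + l) * x)) j \<in> J"
    by (rule act_cong_mod[OF subspace_J fe])
  moreover have "act A (\<lambda>i. e i * (f l * x) - sc \<beta> * (gap (i + l) * x)) j
      = act A (\<lambda>i. e i * (f l * x)) j - sc \<beta> * act A (\<lambda>i. gap i * x) (j + l)"
    by (simp only: act_diff act_left) (simp add: act_def add_ac)
  ultimately show "f l * act A (\<lambda>i. e i * x) j \<in> J"
    using J_diff[OF lower left_J[OF gap]] by simp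
qed simp

lemma annihilates_0:
  assumes "recurrent A (weight_gap p)"
  shows "annihilates A 0"
proof -
  have "act A (\<lambda>i. gap i * 1) j \<in> J" for j
  proof -
    have "act A (\<lambda>i. sc (weight_gap p i)) j = sc (\<Sum>i\<le>degree A. coeff A i * weight_gap p (j + int i))"
      by (simp add: act_def sc_sum sc_mult)
    also have "\<dots> \<in> J"
      using assms J_zero by (simp add: recurrent_def sc_zero)
    finally show ?thesis
      using act_cong_mod[OF subspace_J, of "\<lambda>i. gap i * 1" "\<lambda>i. sc (weight_gap p i)"] gap_J by simp
  qed
  then have "level 0 \<subseteq> {x. \<forall>j. act A (\<lambda>i. gap i * x) j \<in> J}"
    unfolding level_def
    by (intro vs.span_minimal subspace_act[OF subspace_J])
       (auto simp: eword_Nil intro: act_subspace[OF subspace_J] left_J)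
  then have gap: "act A (\<lambda>i. gap i * x) j \<in> J" if "x \<in> level 0" for x j
    using that by blast
  have "act A (\<lambda>i. e i * x) j \<in> J" if "x \<in> level 0" for x j
    by (rule annihilates_e[OF gap[OF that] _ that])
       (intro act_subspace[OF subspace_J] left_J[OF f_level_0] that)
  with gap show ?thesis
    by (auto simp: annihilates_def)
qed

text \<open>Let \<open>A\<close> work in degree \<open>-k\<close> and \<open>d = \<psi>\<^sup>+ - \<psi>\<^sup>-\<close>. In degree \<open>-k-1\<close>, on \<open>e(x) y\<close> with \<open>y\<close> of degree \<open>-k\<close>, the
  exchange relation gives \<open>A(w) \<Prod>\<^sub>i (w - q\<^sub>i x) d(w) e(x) y = 0\<close>, and \<open>A(x) d(w) e(x) y = 0\<close>.
  Eliminating \<open>x\<close> yields \<open>A(w) A(w/q\<^sub>1) A(w/q\<^sub>2) A(w/q\<^sub>3) d(w) e(x) y = 0\<close>. This polynomial is a multiple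
  of \<open>A\<close>, so its product with \<open>e(w)\<close> kills degree \<open>-k\<close>, which is what \<open>annihilates_e\<close> asks for.\<close>

lemma annihilates_Suc:
  assumes A: "annihilates A k" "coeff A 0 \<noteq> 0"
  shows "\<exists>A'. annihilates A' (Suc k) \<and> coeff A' 0 \<noteq> 0"
proof -
  have nz: "q1 \<noteq> 0" "q2 \<noteq> 0" "q3 \<noteq> 0"
    using q_prod by auto
  define R where "R q = pcompose A [:0, 1 / q:]" for q
  define A' where "A' = A * R q1 * R q2 * R q3"
  have A'0: "coeff A' 0 \<noteq> 0"
    using A(2) by (simp add: A'_def R_def coeff_mult pcompose_coeff_0 poly_0_coeff_0)
  have gap_word: "act A' (\<lambda>i. gap i * (e l * y)) j \<in> J" if y: "y \<in> level k" for y l j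
  proof -
    \<comment> \<open>\<open>Z\<close> is \<open>d(w) e(x) y\<close>; \<open>Z2\<close>, \<open>Z1\<close> and \<open>Z0\<close> result from multiplying it by the factors \<open>w
      - q\<^sub>i x\<close> one after the other\<close>
    define Z where "Z m l = gap m * (e l * y)" for m l
    define Z2 where "Z2 m l = Z (m + 1) l - sc q3 * Z m (l + 1)" for m l
    define Z1 where "Z1 m l = Z2 (m + 1) l - sc q2 * Z2 m (l + 1)" for m l
    define Z0 where "Z0 m l = Z1 (m + 1) l - sc q1 * Z1 m (l + 1)" for m l
    have AZ: "act A (Z m) l \<in> J" for m l
    proof -
      have "act A (\<lambda>i. e i * y) l \<in> J"
        using A y by (auto simp: annihilates_def)
      then have "gap m * act A (\<lambda>i. e i * y) l \<in> J"
        by (rule left_J)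
      then show ?thesis
        by (simp add: Z_def[abs_def] act_left)
    qed
    have shift: "act A (W' m) l \<in> J"
      if in_J: "\<And>m l. act A (W m) l \<in> J" and eq: "\<And>m l. W' m l = W (m + 1) l - sc q * W m (l + 1)" for W W' ::
        "int \<Rightarrow> int \<Rightarrow> 'r" and q m l
    proof -
      have "act A (\<lambda>i. sc q * W m (i + 1)) l = sc q * act A (W m) (l + 1)"
        by (simp only: act_left) (simp add: act_def add_ac)
      then have "act A (W' m) l = act A (W (m + 1)) l - sc q * act A (W m) (l + 1)"
        using eq by (simp add: act_diff ext[of "W' m", OF eq])
      then show ?thesis
        using in_J by (simp add: J_diff left_J)
    qed
    have AZ2: "act A (Z2 m) l \<in> J" for m l
      by (rule shift[where W = Z and W' = Z2]) (rule AZ, rule Z2_def)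
    have AZ1: "act A (Z1 m) l \<in> J" for m l
      by (rule shift[where W = Z2 and W' = Z1]) (rule AZ2, rule Z1_def)
    define s t where "s = q1 + q2 + q3" and "t = q1 * q2 + q1 * q3 + q2 * q3"
    have Z0: "Z0 m l = Z (m + 3) l - sc s * Z (m + 2) (l + 1) + sc t * Z (m + 1) (l + 2) - Z m (l + 3)" for m l
    proof -
      have "sc q1 * (sc q2 * (sc q3 * Z m (l + 3))) = Z m (l + 3)"
        using q_prod by (simp add: sc_one mult.assoc)
      then show ?thesis
        unfolding Z0_def Z1_def Z2_def
        by (simp add: s_def t_def sc_add distrib_right right_diff_distrib mult_ac add_ac)
    qed
    have ex: "exchange s t gap e"
      unfolding s_def t_def gap_def[abs_def] by (rule exchange_diff[OF plus_e minus_e])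
    \<comment> \<open>the other side of the exchange relation, with \<open>e(x)\<close> on the left of \<open>d(w)\<close>\<close>
    define V where "V m l = e l * (gap (m + 3) * y) - sc t * (e (l + 1) * (gap (m + 2) * y))
      + sc s * (e (l + 2) * (gap (m + 1) * y)) - e (l + 3) * (gap m * y)" for m l
    have ZV: "Z0 m l - V m l \<in> J" for m l
    proof -
      note I_mult_J[OF ex[unfolded exchange_def, THEN spec, of "m + 3", THEN spec, of l], of y]
      then show ?thesis
        unfolding Z0 V_def Z_def by (simp add: algebra_simps)
    qed
    have AV: "act A (\<lambda>i. V i l) m \<in> J" for m l
    proof -
      have g: "act A (\<lambda>i. e l * (gap (i + c) * y)) m \<in> J" for l c
      proof -
        have "act A (\<lambda>i. e l * (gap (i + c) * y)) m = e l * act A (\<lambda>i. gap i * y) (m + c)"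
          by (simp only: act_left) (simp add: act_def add_ac)
        then show ?thesis
          using A y by (auto simp: annihilates_def intro: left_J)
      qed
      have "act A (\<lambda>i. V i l) m = act A (\<lambda>i. e l * (gap (i + 3) * y)) m - sc t * act A (\<lambda>i. e (l + 1) * (gap (i
        + 2) * y)) m
         + sc s * act A (\<lambda>i. e (l + 2) * (gap (i + 1) * y)) m - act A (\<lambda>i. e (l + 3) * (gap (i + 0) * y)) m"
        unfolding V_def act_left[of _ "sc t", symmetric] act_left[of _ "sc s", symmetric]
        by (simp add: act_def algebra_simps sum.distrib sum_subtractf)
      also have "\<dots> \<in> J"
        by (intro J_diff J_add left_J g)
      finally show ?thesis .
    qed
    have "act A (\<lambda>i. Z0 i l) m \<in> J" for m l
      using act_cong_mod[OF subspace_J, of "\<lambda>i. Z0 i l" "\<lambda>i. V i l"] ZV AV by blast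
    then have "act (A * R q1) (\<lambda>i. Z1 i l) m \<in> J" for m l
      unfolding R_def Z0_def by (rule act_eliminate[OF subspace_J nz(1) AZ1])
    then have "act (A * R q1 * R q2) (\<lambda>i. Z2 i l) m \<in> J" for m l
      unfolding R_def[of q2] Z1_def by (rule act_eliminate[OF subspace_J nz(2) AZ2])
    then have "act (A * R q1 * R q2 * R q3) (\<lambda>i. Z i l) m \<in> J" for m l
      unfolding R_def[of q3] Z2_def by (rule act_eliminate[OF subspace_J nz(3) AZ])
    then show ?thesis
      by (simp add: A'_def Z_def)
  qed
  have "level (Suc k) \<subseteq> {x. \<forall>j. act A' (\<lambda>i. gap i * x) j \<in> J}"
    unfolding level_def
  proof (intro vs.span_minimal subspace_act[OF subspace_J] subsetI)
    fix x assume "x \<in> eword ` {js. length js = Suc k} \<union> J"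
    then consider "x \<in> J" | l js where "x = e l * eword js" "length js = k"
      by (auto simp: length_Suc_conv eword_Cons)
    then show "x \<in> {x. \<forall>j. act A' (\<lambda>i. gap i * x) j \<in> J}"
    proof cases
      case 1
      then show ?thesis
        by (auto intro: act_subspace[OF subspace_J] left_J)
    next
      case 2
      then show ?thesis
        using gap_word[OF eword_level[of js, unfolded 2(2)]] by simp
    qed
  qed
  then have gap: "act A' (\<lambda>i. gap i * x) j \<in> J" if "x \<in> level (Suc k)" for x j
    using that by blast
  have e_lower: "act A' (\<lambda>i. e i * y) j \<in> J" if "y \<in> level k" for y j
  proof -
    have "A' = (R q1 * R q2 * R q3) * A"
      by (simp add: A'_def ac_simps)
    then have "act A' (\<lambda>i. e i * y) j = act (R q1 * R q2 * R q3) (act A (\<lambda>i. e i * y)) j"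
      by (simp only: act_mult)
    then show ?thesis
      using A that by (auto simp: annihilates_def intro: act_subspace[OF subspace_J])
  qed
  have "act A' (\<lambda>i. e i * x) j \<in> J" if "x \<in> level (Suc k)" for x j
    by (rule annihilates_e[OF gap[OF that] e_lower[OF f_level_Suc[OF that]] that])
  with gap A'0 show ?thesis
    unfolding annihilates_def by blast
qed

lemma annihilator_exists:
  assumes "recurrent A (weight_gap p)" "coeff A 0 \<noteq> 0"
  shows "\<exists>A. annihilates A k \<and> coeff A 0 \<noteq> 0"
  by (induction k) (use annihilates_0[OF assms(1)] assms(2) annihilates_Suc in blast)+

text \<open>By the annihilating polynomial, finitely many \<open>e\<^sub>i\<close> suffice in each step.\<close>

theorem finite_span_of_recurrent:
  assumes "recurrent A (weight_gap p)" "coeff A 0 \<noteq> 0"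
  shows "\<exists>B. finite B \<and> B \<subseteq> eword ` {js. length js = k} \<and> level k \<subseteq> vs.span (B \<union> J)"
proof (induction k)
  case 0
  show ?case
    by (intro exI[of _ "{1}"]) (simp add: level_def eword_Nil image_def)
next
  case (Suc k)
  then obtain B where B: "finite B" "B \<subseteq> eword ` {js. length js = k}" "level k \<subseteq> vs.span (B \<union> J)"
    by blast
  obtain C where C: "annihilates C k" "coeff C 0 \<noteq> 0"
    using annihilator_exists[OF assms] by blast
  define B' where "B' = (\<lambda>(i, b). e (int i) * b) ` ({..<degree C} \<times> B)"
  define H where "H = vs.span (B' \<union> J)"
  have H: "vs.subspace H"
    by (simp add: H_def)
  have J_H: "J \<subseteq> H"
    unfolding H_def by (auto intro: vs.span_base)
  have eb: "e i * b \<in> H" if "b \<in> B" for b i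
  proof (rule act_window[where u = "\<lambda>i. e i * b", OF H C(2)])
    have "b \<in> level k"
      using that B(2) eword_level by auto
    then show "act C (\<lambda>i. e i * b) j \<in> H" for j
      using C(1) J_H by (auto simp: annihilates_def)
    fix j assume j: "0 \<le> j" "j < int (degree C)"
    then have "e j * b = (\<lambda>(i, b). e (int i) * b) (nat j, b)"
      by simp
    then have "e j * b \<in> B'"
      unfolding B'_def using j that by (intro image_eqI[of _ _ "(nat j, b)"]) auto
    then show "e j * b \<in> H"
      unfolding H_def by (intro vs.span_base) blast
  qed
  have eL: "e i * x \<in> H" if "x \<in> level k" for i x
    using subsetD[OF B(3) that] by (rule span_left_mult[OF H, rotated]) (use eb J_H left_J in blast)
  have "level (Suc k) \<subseteq> H"
    unfolding level_def
  proof (intro vs.span_minimal H subsetI)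
    fix x assume "x \<in> eword ` {js. length js = Suc k} \<union> J"
    then consider "x \<in> J" | l js where "x = e l * eword js" "length js = k"
      by (auto simp: length_Suc_conv eword_Cons)
    then show "x \<in> H"
      by cases (use J_H eL eword_level in blast)+
  qed
  moreover have "B' \<subseteq> eword ` {js. length js = Suc k}"
  proof
    fix x assume "x \<in> B'"
    then obtain i js where "x = e (int i) * eword js" "length js = k"
      using B(2) by (auto simp: B'_def)
    then show "x \<in> eword ` {js. length js = Suc k}"
      by (intro image_eqI[of _ _ "int i # js"]) (auto simp: eword_Cons)
  qed
  moreover have "finite B'"
    using B(1) by (simp add: B'_def)
  ultimately show ?case
    unfolding H_def by blast
qed

text \<open>A linear relation between the vectors \<open>e\<^sub>i v\<close> becomes, after applying \<open>f\<^sub>j\<close>, a relation between scalars with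
  the same coefficients.\<close>

theorem recurrent_of_finite_span:
  assumes "finite B" "\<And>i. e i \<in> vs.span (B \<union> J)"
  shows "\<exists>A. A \<noteq> 0 \<and> recurrent A (weight_gap p)"
proof -
  obtain A where A: "A \<noteq> 0" "(\<Sum>i\<le>degree A. sc (coeff A i) * e (int i)) \<in> J"
    using relation_in_span[OF assms(1) subspace_J, of "\<lambda>i. e (int i)"] assms(2) by blast
  have "recurrent A (weight_gap p)"
    unfolding recurrent_def
  proof
    fix j
    define D where "D = (\<Sum>i\<le>degree A. coeff A i * weight_gap p (j + int i))"
    have "f j * act A e 0 \<in> J"
      using A(2) by (intro left_J) (simp add: act_def)
    then have "act A (\<lambda>i. f j * (e i * 1)) 0 \<in> J"
      by (simp add: act_left)
    moreover have "f j * (e i * 1) - sc (- \<beta> * weight_gap p (i + j)) \<in> J" for i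
    proof -
      have "e i * f j - sc \<beta> * (gap (i + j) - sc (weight_gap p (i + j))) \<in> J"
        by (intro J_diff left_J f_J gap_J)
      from J_add[OF fe[of j i 1] this] show ?thesis
        by (simp add: right_diff_distrib sc_minus sc_mult)
    qed
    ultimately have "act A (\<lambda>i. sc (- \<beta> * weight_gap p (i + j))) 0 \<in> J"
      using act_cong_mod[OF subspace_J, of "\<lambda>i. f j * (e i * 1)" "\<lambda>i. sc (- \<beta> * weight_gap p (i + j))"]
      by blast
    also have "act A (\<lambda>i. sc (- \<beta> * weight_gap p (i + j))) 0 = sc (- \<beta> * D)"
      unfolding D_def sum_distrib_left sc_sum by (simp add: act_def add_ac mult_ac flip: sc_mult)
    finally have "sc (1 / (- \<beta> * D)) * sc (- \<beta> * D) \<in> J"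
      by (rule left_J)
    then have "D = 0"
      using one_J beta_nonzero by (cases "D = 0") (auto simp: sc_one simp flip: sc_mult)
    then show "(\<Sum>i\<le>degree A. coeff A i * weight_gap p (j + int i)) = 0"
      by (simp add: D_def)
  qed
  with A(1) show ?thesis
    by blast
qed

end

section \<open>Modules as quotients of an algebra\<close>

text \<open>The module \<open>M\<close> over \<open>R\<close> is a quotient of the regular module of a ring that maps onto \<open>R\<close> by \<open>\<kappa>\<close>.
  Submodules of \<open>M\<close> then are left ideals of that ring, and the iterated quotients that make up an
  irreducible module can be replaced by a single left ideal of the free algebra.\<close>

definition presents :: "('c, 'd) ring_scheme \<Rightarrow> ('a::ring_1 \<Rightarrow> 'c) \<Rightarrow> ('c, 'm, 'e) module_scheme \<Rightarrow> ('a \<Rightarrow> 'm) \<Rightarrow>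
  bool" where
  "presents R \<kappa> M \<pi> \<longleftrightarrow> abelian_group M \<and> carrier R = range \<kappa> \<and> carrier M = range \<pi>
     \<and> (\<forall>x y. \<pi> (x + y) = \<pi> x \<oplus>\<^bsub>M\<^esub> \<pi> y) \<and> (\<forall>a x. \<kappa> a \<odot>\<^bsub>M\<^esub> \<pi> x = \<pi> (a * x))"

definition left_ideal :: "'a::ring_1 set \<Rightarrow> bool" where
  "left_ideal Z \<longleftrightarrow> 0 \<in> Z \<and> (\<forall>x\<in>Z. \<forall>y\<in>Z. x + y \<in> Z) \<and> (\<forall>a. \<forall>x\<in>Z. a * x \<in> Z)"

lemma abelian_group_of_comm_group:
  assumes "comm_group K" "carrier H = carrier K" "add H = monoid.mult K" "zero H = one K"
  shows "abelian_group H"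
proof -
  interpret K: comm_group K
    by (rule assms(1))
  show ?thesis
    by (rule abelian_groupI) (use assms(2-4) K.m_assoc K.m_comm K.l_inv in \<open>auto intro: K.inv_closed\<close>)
qed

lemma presents_zero:
  assumes "presents R \<kappa> M \<pi>"
  shows "\<pi> 0 = \<zero>\<^bsub>M\<^esub>"
proof -
  interpret M: abelian_group M
    using assms by (simp add: presents_def)
  have c: "\<pi> 0 \<in> carrier M"
    using assms by (simp add: presents_def)
  have "\<pi> 0 \<oplus>\<^bsub>M\<^esub> \<pi> 0 = \<pi> (0 + 0)"
    using assms by (simp only: presents_def)
  also have "\<dots> = \<pi> 0 \<oplus>\<^bsub>M\<^esub> \<zero>\<^bsub>M\<^esub>"
    using c by simp
  finally show ?thesis
    using c by (metis M.r_neg1 M.zero_closed)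
qed

lemma presents_minus:
  assumes "presents R \<kappa> M \<pi>"
  shows "\<pi> (- x) = \<ominus>\<^bsub>M\<^esub> \<pi> x"
proof -
  interpret M: abelian_group M
    using assms by (simp add: presents_def)
  have c: "\<pi> x \<in> carrier M" "\<pi> (- x) \<in> carrier M"
    using assms by (simp_all add: presents_def)
  have "\<pi> (- x) \<oplus>\<^bsub>M\<^esub> \<pi> x = \<pi> (- x + x)"
    using assms by (simp only: presents_def)
  then have "\<pi> (- x) \<oplus>\<^bsub>M\<^esub> \<pi> x = \<zero>\<^bsub>M\<^esub>"
    using presents_zero[OF assms] by simp
  then show ?thesis
    using c by (metis M.minus_equality)
qed

lemma presents_submodule_iff:
  assumes P: "presents R \<kappa> M \<pi>"
  shows "submodule H R M \<longleftrightarrow> H \<subseteq> carrier M \<and> left_ideal (\<pi> -` H)"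
proof -
  interpret M: abelian_group M
    using P by (simp add: presents_def)
  note p = P[unfolded presents_def]
  show ?thesis
  proof
    assume H: "submodule H R M"
    then interpret H: subgroup H "add_monoid M"
      by (rule submodule.axioms)
    have "H \<subseteq> carrier M"
      using H.subset by simp
    moreover have "left_ideal (\<pi> -` H)"
      unfolding left_ideal_def
    proof (intro conjI ballI allI)
      show "0 \<in> \<pi> -` H"
        using H.one_closed presents_zero[OF P] by simp
      show "x + y \<in> \<pi> -` H" if "x \<in> \<pi> -` H" "y \<in> \<pi> -` H" for x y
        using that p H.m_closed by simp
      show "a * x \<in> \<pi> -` H" if "x \<in> \<pi> -` H" for a x
        using that p submodule.smult_closed[OF H, of "\<kappa> a" "\<pi> x"] by simp
    qed
    ultimately show "H \<subseteq> carrier M \<and> left_ideal (\<pi> -` H)" ..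
  next
    assume H: "H \<subseteq> carrier M \<and> left_ideal (\<pi> -` H)"
    then have rep: "\<exists>x. h = \<pi> x" if "h \<in> H" for h
      using that p by auto
    have I: "left_ideal (\<pi> -` H)"
      using H by simp
    have "subgroup H (add_monoid M)"
    proof
      show "H \<subseteq> carrier (add_monoid M)"
        using H by simp
      show "x \<otimes>\<^bsub>add_monoid M\<^esub> y \<in> H" if xy: "x \<in> H" "y \<in> H" for x y
      proof -
        obtain x' y' where "x = \<pi> x'" "y = \<pi> y'"
          using rep xy by metis
        then show ?thesis
          using I xy p unfolding left_ideal_def by (metis vimageE vimageI2 monoid.select_convs(1))
      qed
      show "\<one>\<^bsub>add_monoid M\<^esub> \<in> H"
        using I presents_zero[OF P] by (simp add: left_ideal_def)
      show "inv\<^bsub>add_monoid M\<^esub> x \<in> H" if x: "x \<in> H" for x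
      proof -
        obtain x' where x': "x = \<pi> x'"
          using rep x by metis
        then have "(- 1) * x' \<in> \<pi> -` H"
          using I x unfolding left_ideal_def by blast
        then have "\<ominus>\<^bsub>M\<^esub> x \<in> H"
          using presents_minus[OF P, of x'] x' by simp
        then show ?thesis
          by (simp add: a_inv_def)
      qed
    qed
    moreover have "a \<odot>\<^bsub>M\<^esub> x \<in> H" if "a \<in> carrier R" "x \<in> H" for a x
    proof -
      have "a \<in> range \<kappa>"
        using that p by simp
      then obtain a' where a': "a = \<kappa> a'"
        by blast
      obtain x' where x': "x = \<pi> x'"
        using rep \<open>x \<in> H\<close> by blast
      have "a' * x' \<in> \<pi> -` H"
        using I \<open>x \<in> H\<close> x' unfolding left_ideal_def by blast
      then show ?thesis
        using a' x' p by simp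
    qed
    ultimately show "submodule H R M"
      by (simp add: submodule_def submodule_axioms_def)
  qed
qed

lemma abelian_subgroup_of_submodule:
  assumes "abelian_group M" "submodule N R M"
  shows "abelian_subgroup N M"
  using assms by (intro abelian_subgroupI3 additive_subgroupI) (auto dest: submodule.axioms)

text \<open>The scalar multiple of a coset is a union over its elements; all members of this union are the same coset,
  because \<open>N\<close> is stable under scalars.\<close>

lemma presents_quot_module:
  assumes P: "presents R \<kappa> M \<pi>" and N: "submodule N R M"
  shows "presents R \<kappa> (quot_module M N) (\<lambda>x. N +>\<^bsub>M\<^esub> \<pi> x)"
proof -
  note p = P[unfolded presents_def]
  interpret N: abelian_subgroup N M
    using p N by (auto intro: abelian_subgroup_of_submodule)
  have "abelian_group (quot_module M N)"
    by (rule abelian_group_of_comm_group[OF N.a_factorgroup_is_comm_group])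
       (simp_all add: quot_module_def A_FactGroup_def')
  moreover have "carrier (quot_module M N) = range (\<lambda>x. N +>\<^bsub>M\<^esub> \<pi> x)"
    using p by (auto simp: quot_module_def A_RCOSETS_def')
  moreover have "N +>\<^bsub>M\<^esub> \<pi> (x + y) = (N +>\<^bsub>M\<^esub> \<pi> x) \<oplus>\<^bsub>quot_module M N\<^esub> (N +>\<^bsub>M\<^esub> \<pi> y)" for x y
    using p N.a_rcos_sum[of "\<pi> x" "\<pi> y"] by (simp add: quot_module_def)
  moreover have "\<kappa> a \<odot>\<^bsub>quot_module M N\<^esub> (N +>\<^bsub>M\<^esub> \<pi> y) = N +>\<^bsub>M\<^esub> \<pi> (a * y)" for a y
  proof -
    have coset: "N +>\<^bsub>M\<^esub> (\<kappa> a \<odot>\<^bsub>M\<^esub> x) = N +>\<^bsub>M\<^esub> \<pi> (a * y)" if x: "x \<in> N +>\<^bsub>M\<^esub> \<pi> y" for x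
    proof -
      obtain n where n: "n \<in> N" "x = n \<oplus>\<^bsub>M\<^esub> \<pi> y"
        using x by (auto simp: a_r_coset_def')
      moreover have "n \<in> carrier M"
        using n N.a_subset by blast
      ultimately obtain n' where n': "n = \<pi> n'"
        using p by auto
      have "x = \<pi> (n' + y)"
        using n n' p by simp
      moreover have "\<kappa> a \<odot>\<^bsub>M\<^esub> \<pi> (n' + y) = \<pi> (a * (n' + y))"
        using p by blast
      ultimately have "\<kappa> a \<odot>\<^bsub>M\<^esub> x = \<pi> (a * n' + a * y)"
        by (simp add: distrib_left)
      then have eq: "\<kappa> a \<odot>\<^bsub>M\<^esub> x = \<pi> (a * n') \<oplus>\<^bsub>M\<^esub> \<pi> (a * y)"
        using p by simp
      have "\<pi> (a * n') \<in> N"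
        using N n n' unfolding presents_submodule_iff[OF P] left_ideal_def by auto
      then have "\<kappa> a \<odot>\<^bsub>M\<^esub> x \<in> N +>\<^bsub>M\<^esub> \<pi> (a * y)"
        unfolding eq by (auto simp: a_r_coset_def')
      then show ?thesis
        using N.a_repr_independence'[of "\<kappa> a \<odot>\<^bsub>M\<^esub> x" "\<pi> (a * y)"] p by simp
    qed
    have "\<pi> y \<in> N +>\<^bsub>M\<^esub> \<pi> y"
      using p by (intro N.a_rcos_self) simp
    then show ?thesis
      using coset by (auto simp: quot_module_def)
  qed
  ultimately show ?thesis
    using p by (simp add: presents_def)
qed

lemma coset_eq_submodule_iff:
  assumes P: "presents R \<kappa> M \<pi>" and N: "submodule N R M"
  shows "N +>\<^bsub>M\<^esub> \<pi> x = N \<longleftrightarrow> \<pi> x \<in> N"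
proof -
  note p = P[unfolded presents_def]
  interpret M: abelian_group M
    using p by simp
  have sub: "subgroup N (add_monoid M)"
    using N by (rule submodule.axioms)
  have "\<pi> x \<in> carrier M"
    using p by simp
  then show ?thesis
    using M.a_coset_join1 M.a_coset_join2 sub by blast
qed

lemma presents_eq_iff:
  assumes P: "presents R \<kappa> M \<pi>"
  shows "\<pi> x = \<pi> y \<longleftrightarrow> \<pi> (x - y) = \<zero>\<^bsub>M\<^esub>"
proof -
  note p = P[unfolded presents_def]
  interpret M: abelian_group M
    using p by simp
  have c: "\<pi> z \<in> carrier M" for z
    using p by simp
  have "\<pi> (x + - y) = \<pi> x \<oplus>\<^bsub>M\<^esub> \<pi> (- y)"
    using p by blast
  then have "\<pi> (x - y) = \<pi> x \<oplus>\<^bsub>M\<^esub> \<ominus>\<^bsub>M\<^esub> \<pi> y"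
    using presents_minus[OF P, of y] by simp
  then show ?thesis
    using c by (metis M.minus_equality M.minus_minus M.r_neg M.a_inv_closed)
qed

lemma submodule_left_ideal_gen:
  assumes P: "presents R \<kappa> (regular_module R) \<kappa>" and S: "S \<subseteq> carrier R"
  shows "submodule (left_ideal_gen R S) R (regular_module R)" "S \<subseteq> left_ideal_gen R S"
proof -
  note iff = presents_submodule_iff[OF P]
  have "submodule (carrier R) R (regular_module R)"
  proof -
    have "\<kappa> -` carrier R = UNIV"
      using P by (auto simp: presents_def)
    then show ?thesis
      unfolding iff by (simp add: left_ideal_def regular_module_def)
  qed
  then have "left_ideal_gen R S \<subseteq> carrier (regular_module R)"
    using S by (auto simp: left_ideal_gen_def regular_module_def)
  moreover have "left_ideal (\<kappa> -` left_ideal_gen R S)"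
    by (auto simp: left_ideal_gen_def left_ideal_def iff)
  ultimately show "submodule (left_ideal_gen R S) R (regular_module R)"
    by (simp add: iff)
  show "S \<subseteq> left_ideal_gen R S"
    by (auto simp: left_ideal_gen_def)
qed

section \<open>The free algebra and the toroidal algebra\<close>

lemma scal_central: "scal c * x = x * scal c"
proof -
  have x: "x = (\<Sum>u\<in>Poly_Mapping.keys x. Poly_Mapping.single u (Poly_Mapping.lookup x u))"
    by (rule poly_mapping_eqI) (auto simp: lookup_sum lookup_single when_def in_keys_iff)
  show ?thesis
    by (subst (1 2) x) (simp add: sum_distrib_left sum_distrib_right scal_def mult_single mult.commute)
qed

interpretation fa: scalar_ring scal
proof
  fix a b :: complex and x :: free_alg
  show "scal (a + b) = scal a + scal b"
    by (simp add: scal_def single_add)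
  show "scal (a * b) = scal a * scal b"
    by (simp add: scal_def mult_single)
  show "scal 1 = 1"
    by (simp add: scal_def)
  show "scal a * x = x * scal a"
    by (rule scal_central)
qed

lemma single_word: "Poly_Mapping.single (Word gs) 1 = prod_list (map gen gs)"
proof (induction gs)
  case Nil
  then show ?case
    by (simp flip: zero_word_def)
next
  case (Cons g gs)
  have "Poly_Mapping.single (Word (g # gs)) 1 = gen g * Poly_Mapping.single (Word gs) (1::complex)"
    by (simp add: gen_def mult_single plus_word_def)
  then show ?case
    by (simp add: Cons)
qed

lemma free_alg_expand:
  "x = (\<Sum>u\<in>Poly_Mapping.keys x. scal (Poly_Mapping.lookup x u) * prod_list (map gen (letters u)))"
proof -
  have "x = (\<Sum>u\<in>Poly_Mapping.keys x. Poly_Mapping.single u (Poly_Mapping.lookup x u))"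
    by (rule poly_mapping_eqI) (auto simp: lookup_sum lookup_single when_def in_keys_iff)
  also have "\<dots> = (\<Sum>u\<in>Poly_Mapping.keys x. scal (Poly_Mapping.lookup x u) * prod_list (map gen (letters u)))"
    by (intro sum.cong refl) (simp add: scal_def mult_single flip: single_word)
  finally show ?thesis .
qed

lemma free_alg_generated:
  assumes Z: "fa.vs.subspace Z" and gen: "\<And>g x. x \<in> Z \<Longrightarrow> gen g * x \<in> Z" and x: "x \<in> Z"
  shows "a * x \<in> Z"
proof -
  have word: "prod_list (map gen gs) * x \<in> Z" for gs
    by (induction gs) (use x gen in \<open>simp_all add: mult.assoc\<close>)
  have "(\<Sum>u\<in>Poly_Mapping.keys a. scal (Poly_Mapping.lookup a u) * prod_list (map gen (letters u))) * x \<in> Z"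
    unfolding sum_distrib_right mult.assoc
    by (intro fa.vs.subspace_sum[OF Z] fa.vs.subspace_scale[OF Z] word)
  then show ?thesis
    by (simp flip: free_alg_expand)
qed

lemma left_ideal_subspace: "left_ideal Z \<Longrightarrow> fa.vs.subspace Z"
  by (simp add: left_ideal_def fa.vs.subspace_def)

lemma cubic_zw_expand:
  "cubic_zw q1 q2 q3 A a b = A (a - 3) b - scal (q1 + q2 + q3) * A (a - 2) (b - 1)
     + scal (q1 * q2 + q1 * q3 + q2 * q3) * A (a - 1) (b - 2) - scal (q1 * q2 * q3) * A a (b - 3)"
proof -
  have "c - 1 - 1 = c - 2" "c - 2 - 1 = c - 3" for c :: int
    by simp_all
  then show ?thesis
    by (simp add: cubic_zw_def lin_mult_def fa.sc_minus fa.sc_add algebra_simps)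
qed

lemma cubic_wz_expand:
  "cubic_wz q1 q2 q3 A a b = A a (b - 3) - scal (q1 + q2 + q3) * A (a - 1) (b - 2)
     + scal (q1 * q2 + q1 * q3 + q2 * q3) * A (a - 2) (b - 1) - scal (q1 * q2 * q3) * A (a - 3) b"
proof -
  have "c - 1 - 1 = c - 2" "c - 2 - 1 = c - 3" for c :: int
    by simp_all
  then show ?thesis
    by (simp add: cubic_wz_def lin_mult_def fa.sc_minus fa.sc_add algebra_simps)
qed

lemma ring_FA: "ring FA"
proof (rule ringI)
  show "abelian_group FA"
    by (rule abelian_groupI) (auto simp: FA_def algebra_simps intro: exI[of _ "- _"] add.left_inverse)
  show "monoid FA"
    by (rule monoidI) (auto simp: FA_def mult.assoc)
qed (auto simp: FA_def algebra_simps)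

lemma ideal_toroidal_ideal: "ideal (toroidal_ideal q1 q2 q3) FA"
  unfolding toroidal_ideal_def by (rule ring.genideal_ideal[OF ring_FA]) (simp add: FA_def)

lemma toroidal_rels_ideal: "toroidal_rels q1 q2 q3 \<subseteq> toroidal_ideal q1 q2 q3"
  unfolding toroidal_ideal_def by (rule ring.genideal_self[OF ring_FA]) (simp add: FA_def)

lemma scalar_ideal_toroidal: "scalar_ideal scal (toroidal_ideal q1 q2 q3)"
proof -
  interpret I: ideal "toroidal_ideal q1 q2 q3" FA
    by (rule ideal_toroidal_ideal)
  show ?thesis
  proof (unfold_locales)
    show "0 \<in> toroidal_ideal q1 q2 q3"
      using additive_subgroup.zero_closed[OF I.additive_subgroup_axioms] by (simp add: FA_def)
    show "x + y \<in> toroidal_ideal q1 q2 q3" if "x \<in> toroidal_ideal q1 q2 q3" "y \<in> toroidal_ideal q1 q2 q3" for x y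
      using additive_subgroup.a_closed[OF I.additive_subgroup_axioms that] by (simp add: FA_def)
    show "a * x \<in> toroidal_ideal q1 q2 q3" "x * a \<in> toroidal_ideal q1 q2 q3" if "x \<in> toroidal_ideal q1 q2 q3" for x a
      using I.I_l_closed[OF that, of a] I.I_r_closed[OF that, of a] by (simp_all add: FA_def)
  qed
qed

lemma presents_regular_toroidal:
  "presents (toroidal q1 q2 q3) (toroidal_class q1 q2 q3) (regular_module (toroidal q1 q2 q3)) (toroidal_class
    q1 q2 q3)"
proof -
  interpret I: ideal "toroidal_ideal q1 q2 q3" FA
    by (rule ideal_toroidal_ideal)
  interpret U: ring "toroidal q1 q2 q3"
    unfolding toroidal_def by (rule I.quotient_is_ring)
  have "abelian_group (regular_module (toroidal q1 q2 q3))"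
    by (rule abelian_group_of_comm_group[OF U.a_comm_group]) (simp_all add: regular_module_def)
  moreover have "carrier (toroidal q1 q2 q3) = range (toroidal_class q1 q2 q3)"
    by (auto simp: toroidal_def FactRing_def A_RCOSETS_def' FA_def toroidal_class_def)
  moreover have "toroidal_class q1 q2 q3 (x + y) = toroidal_class q1 q2 q3 x
    \<oplus>\<^bsub>toroidal q1 q2 q3\<^esub> toroidal_class q1 q2 q3 y" for x y
    using I.a_rcos_sum[of x y] by (simp add: toroidal_def FactRing_def toroidal_class_def) (simp add: FA_def)
  moreover have "toroidal_class q1 q2 q3 (x * y) = toroidal_class q1 q2 q3 x \<otimes>\<^bsub>toroidal q1 q2 q3\<^esub> toroidal_class
    q1 q2 q3 y" for x y
    using I.rcoset_mult_add[of x y] by (simp add: toroidal_def FactRing_def toroidal_class_def) (simp add: FA_def)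
  ultimately show ?thesis
    by (simp add: presents_def regular_module_def)
qed

lemma toroidal_class_eq_zero_iff:
  "toroidal_class q1 q2 q3 x = toroidal_class q1 q2 q3 0 \<longleftrightarrow> x \<in> toroidal_ideal q1 q2 q3"
proof -
  interpret I: ideal "toroidal_ideal q1 q2 q3" FA
    by (rule ideal_toroidal_ideal)
  have 0: "toroidal_class q1 q2 q3 0 = toroidal_ideal q1 q2 q3"
    by (auto simp: toroidal_class_def a_r_coset_def' FA_def)
  have "x \<in> toroidal_class q1 q2 q3 x"
    using scalar_ideal.zero_I[OF scalar_ideal_toroidal]
    by (fastforce simp: toroidal_class_def a_r_coset_def' FA_def)
  moreover have "toroidal_class q1 q2 q3 x = toroidal_ideal q1 q2 q3" if "x \<in> toroidal_ideal q1 q2 q3"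
    using I.a_coset_join2[of x] that I.a_subgroup unfolding toroidal_class_def by (simp add: FA_def)
  ultimately show ?thesis
    unfolding 0 by blast
qed

section \<open>Irreducible quotients of universal highest weight modules\<close>

text \<open>Dimensions in the presented module are dimensions modulo the kernel. Representatives of a
  spanning set have to be chosen injectively, because the sum over an image counts a vector once.\<close>

lemma finite_dim_iff:
  assumes P: "presents (toroidal q1 q2 q3) (toroidal_class q1 q2 q3) V \<phi>"
  shows "finite_dim q1 q2 q3 V (\<phi> ` C) \<longleftrightarrow>
    (\<exists>B. finite B \<and> B \<subseteq> C \<and> C \<subseteq> fa.vs.span (B \<union> {x. \<phi> x = \<zero>\<^bsub>V\<^esub>}))"
proof -
  note p = P[unfolded presents_def]
  interpret V: abelian_group V
    using p by simp
  define J where "J = {x. \<phi> x = \<zero>\<^bsub>V\<^esub>}"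
  have J: "fa.vs.subspace J"
  proof (rule fa.vs.subspaceI)
    show "0 \<in> J"
      using presents_zero[OF P] by (simp add: J_def)
    show "x + y \<in> J" if "x \<in> J" "y \<in> J" for x y
      using that p V.l_zero[OF V.zero_closed] by (simp add: J_def)
    show "scal c * x \<in> J" if "x \<in> J" for c x
      using that p presents_zero[OF P] by (metis (mono_tags, lifting) J_def mem_Collect_eq mult_zero_right)
  qed
  have comb: "\<phi> (\<Sum>b\<in>B. scal (c (\<phi> b)) * b)
      = (\<Oplus>\<^bsub>V\<^esub>y\<in>\<phi> ` B. toroidal_class q1 q2 q3 (scal (c y)) \<odot>\<^bsub>V\<^esub> y)"
    if "finite B" "inj_on \<phi> B" for B c
    using that
  proof (induction B)
    case empty
    then show ?case
      using presents_zero[OF P] by simp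
  next
    case (insert b B)
    have clos: "toroidal_class q1 q2 q3 (scal (c (\<phi> x))) \<odot>\<^bsub>V\<^esub> \<phi> x \<in> carrier V" for x
      using p by auto
    have "\<phi> b \<notin> \<phi> ` B"
      using insert by auto
    then have "(\<Oplus>\<^bsub>V\<^esub>y\<in>\<phi> ` insert b B. toroidal_class q1 q2 q3 (scal (c y)) \<odot>\<^bsub>V\<^esub> y)
        = toroidal_class q1 q2 q3 (scal (c (\<phi> b))) \<odot>\<^bsub>V\<^esub> \<phi> b
          \<oplus>\<^bsub>V\<^esub> (\<Oplus>\<^bsub>V\<^esub>y\<in>\<phi> ` B. toroidal_class q1 q2 q3 (scal (c y)) \<odot>\<^bsub>V\<^esub> y)"
      using insert clos by (subst image_insert, subst V.finsum_insert) auto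
    also have "\<dots> = \<phi> (scal (c (\<phi> b)) * b) \<oplus>\<^bsub>V\<^esub> \<phi> (\<Sum>b\<in>B. scal (c (\<phi> b)) * b)"
      using insert p by simp
    also have "\<dots> = \<phi> (\<Sum>b\<in>insert b B. scal (c (\<phi> b)) * b)"
      using insert p by simp
    finally show ?case
      by simp
  qed
  have span: "x \<in> fa.vs.span (B \<union> J) \<longleftrightarrow> (\<exists>a. x - (\<Sum>b\<in>B. scal (a b) * b) \<in> J)" if "finite B" for x B
  proof -
    have "x \<in> fa.vs.span (B \<union> J) \<longleftrightarrow> (\<exists>y\<in>fa.vs.span B. x - y \<in> J)"
    proof
      assume "x \<in> fa.vs.span (B \<union> J)"
      then obtain y z where "x = y + z" "y \<in> fa.vs.span B" "z \<in> J"
        unfolding fa.vs.span_Un fa.vs.span_eq_iff[THEN iffD2, OF J] by blast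
      then show "\<exists>y\<in>fa.vs.span B. x - y \<in> J"
        by (intro bexI[of _ y]) auto
    next
      assume "\<exists>y\<in>fa.vs.span B. x - y \<in> J"
      then obtain y where y: "y \<in> fa.vs.span B" "x - y \<in> J"
        by blast
      have "y + (x - y) \<in> fa.vs.span (B \<union> J)"
        using y fa.vs.span_mono[of B "B \<union> J"] by (intro fa.vs.span_add) (auto intro: fa.vs.span_base)
      then show "x \<in> fa.vs.span (B \<union> J)"
        by simp
    qed
    then show ?thesis
      unfolding fa.vs.span_finite[OF that] by auto
  qed
  show ?thesis
    unfolding J_def[symmetric]
  proof
    assume "finite_dim q1 q2 q3 V (\<phi> ` C)"
    then obtain B where B: "finite B" "B \<subseteq> \<phi> ` C"
      and ex: "\<And>x. x \<in> \<phi> ` C \<Longrightarrow> \<exists>c. x = (\<Oplus>\<^bsub>V\<^esub>b\<in>B. toroidal_class q1 q2 q3 (scal (c b)) \<odot>\<^bsub>V\<^esub> b)"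
      unfolding finite_dim_def by blast
    \<comment> \<open>one preimage for each spanning vector\<close>
    obtain B' where B': "B' \<subseteq> C" "inj_on \<phi> B'" "B = \<phi> ` B'"
      using B(2) by (metis subset_image_inj)
    have fin: "finite B'"
      using B(1) B'(2,3) by (metis finite_imageD)
    have "x \<in> fa.vs.span (B' \<union> J)" if "x \<in> C" for x
    proof -
      have "\<exists>c. \<phi> x = (\<Oplus>\<^bsub>V\<^esub>b\<in>B. toroidal_class q1 q2 q3 (scal (c b)) \<odot>\<^bsub>V\<^esub> b)"
        using that by (intro ex imageI)
      then obtain c where "\<phi> x = (\<Oplus>\<^bsub>V\<^esub>b\<in>B. toroidal_class q1 q2 q3 (scal (c b)) \<odot>\<^bsub>V\<^esub> b)" ..
      then have "\<phi> x = \<phi> (\<Sum>b\<in>B'. scal (c (\<phi> b)) * b)"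
        using comb[OF fin B'(2), of c] B'(3) by simp
      then show ?thesis
        unfolding span[OF fin] using presents_eq_iff[OF P]
        by (intro exI[of _ "\<lambda>b. c (\<phi> b)"]) (simp add: J_def)
    qed
    then show "\<exists>B. finite B \<and> B \<subseteq> C \<and> C \<subseteq> fa.vs.span (B \<union> J)"
      using fin B'(1) by blast
  next
    assume "\<exists>B. finite B \<and> B \<subseteq> C \<and> C \<subseteq> fa.vs.span (B \<union> J)"
    then obtain B where B: "finite B" "B \<subseteq> C" "C \<subseteq> fa.vs.span (B \<union> J)"
      by blast
    obtain B' where B': "B' \<subseteq> B" "inj_on \<phi> B'" "\<phi> ` B = \<phi> ` B'"
      by (metis order_refl subset_image_inj)
    have fin: "finite B'"
      using B(1) B'(1) finite_subset by blast
    have "B \<union> J \<subseteq> fa.vs.span (B' \<union> J)"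
    proof
      fix x assume x: "x \<in> B \<union> J"
      show "x \<in> fa.vs.span (B' \<union> J)"
      proof (cases "x \<in> J")
        case False
        then obtain b where b: "b \<in> B'" "\<phi> x = \<phi> b"
          using x B'(3) by blast
        then have "x - b \<in> J"
          using presents_eq_iff[OF P] by (simp add: J_def)
        then have "b + (x - b) \<in> fa.vs.span (B' \<union> J)"
          using b by (intro fa.vs.span_add fa.vs.span_base) auto
        then show ?thesis
          by simp
      qed (auto intro: fa.vs.span_base)
    qed
    then have "fa.vs.span (B \<union> J) \<subseteq> fa.vs.span (B' \<union> J)"
      by (rule fa.vs.span_minimal) (rule fa.vs.subspace_span)
    with B(3) have sp: "C \<subseteq> fa.vs.span (B' \<union> J)"
      by (rule order_trans)
    show "finite_dim q1 q2 q3 V (\<phi> ` C)"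
      unfolding finite_dim_def
    proof (intro exI[of _ "\<phi> ` B'"] conjI ballI)
      fix y assume "y \<in> \<phi> ` C"
      then obtain x where x: "x \<in> C" "y = \<phi> x"
        by blast
      then have "x \<in> fa.vs.span (B' \<union> J)"
        using sp by blast
      then obtain a where "x - (\<Sum>b\<in>B'. scal (a b) * b) \<in> J"
        unfolding span[OF fin] ..
      then have "\<phi> x = \<phi> (\<Sum>b\<in>B'. scal (a b) * b)"
        using presents_eq_iff[OF P] by (simp add: J_def)
      also have "(\<Sum>b\<in>B'. scal (a b) * b) = (\<Sum>b\<in>B'. scal ((a \<circ> inv_into B' \<phi>) (\<phi> b)) * b)"
        using B'(2) by (intro sum.cong) auto
      finally show "\<exists>c. y = (\<Oplus>\<^bsub>V\<^esub>b\<in>\<phi> ` B'. toroidal_class q1 q2 q3 (scal (c b)) \<odot>\<^bsub>V\<^esub> b)"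
        unfolding comb[OF fin B'(2)] x(2) by blast
    qed (use fin B B' in auto)
  qed
qed

lemma exchange_e_imp:
  assumes q: "q1 * q2 * q3 = 1"
    and rel: "exchange_e q1 q2 q3 X Y \<subseteq> toroidal_ideal q1 q2 q3"
  shows "scalar_ideal.exchange scal (toroidal_ideal q1 q2 q3) (q1 + q2 + q3) (q1 * q2 + q1 * q3 + q2 * q3)
    (\<lambda>n. X (- n)) (\<lambda>n. Y (- n))"
proof -
  interpret I: scalar_ideal scal "toroidal_ideal q1 q2 q3"
    by (rule scalar_ideal_toroidal)
  show ?thesis
    unfolding I.exchange_def
  proof (intro allI)
    fix m j :: int
    have idx: "- j - 1 = - 1 - j"
      by simp
    have "cubic_zw q1 q2 q3 (\<lambda>m n. X m * Y n) (3 - m) (- j) + cubic_wz q1 q2 q3 (\<lambda>m n. Y n * X m) (3 - m) (- j)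
        \<in> toroidal_ideal q1 q2 q3"
      using rel unfolding exchange_e_def by blast
    then show "X (- m) * Y (- j) - scal (q1 + q2 + q3) * (X (- (m - 1)) * Y (- (j + 1)))
        + scal (q1 * q2 + q1 * q3 + q2 * q3) * (X (- (m - 2)) * Y (- (j + 2))) - X (- (m - 3)) * Y (- (j + 3))
      - (Y (- j) * X (- m) - scal (q1 * q2 + q1 * q3 + q2 * q3) * (Y (- (j + 1)) * X (- (m - 1)))
        + scal (q1 + q2 + q3) * (Y (- (j + 2)) * X (- (m - 2))) - Y (- (j + 3)) * X (- (m - 3)))
      \<in> toroidal_ideal q1 q2 q3"
      unfolding cubic_zw_expand cubic_wz_expand q fa.sc_one idx by (simp add: algebra_simps)
  qed
qed

lemma exchange_f_imp:
  assumes q: "q1 * q2 * q3 = 1"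
    and rel: "exchange_f q1 q2 q3 X Y \<subseteq> toroidal_ideal q1 q2 q3"
  shows "scalar_ideal.exchange scal (toroidal_ideal q1 q2 q3) (q1 * q2 + q1 * q3 + q2 * q3) (q1 + q2 + q3)
    (\<lambda>n. X (- n)) (\<lambda>n. Y (- n))"
proof -
  interpret I: scalar_ideal scal "toroidal_ideal q1 q2 q3"
    by (rule scalar_ideal_toroidal)
  show ?thesis
    unfolding I.exchange_def
  proof (intro allI)
    fix m j :: int
    have idx: "- j - 1 = - 1 - j"
      by simp
    have "- (cubic_wz q1 q2 q3 (\<lambda>m n. X m * Y n) (3 - m) (- j) + cubic_zw q1 q2 q3 (\<lambda>m n. Y n * X m) (3 - m) (- j))
        \<in> toroidal_ideal q1 q2 q3"
      using rel unfolding exchange_f_def by (blast intro: I.minus_I)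
    then show "X (- m) * Y (- j) - scal (q1 * q2 + q1 * q3 + q2 * q3) * (X (- (m - 1)) * Y (- (j + 1)))
        + scal (q1 + q2 + q3) * (X (- (m - 2)) * Y (- (j + 2))) - X (- (m - 3)) * Y (- (j + 3))
      - (Y (- j) * X (- m) - scal (q1 + q2 + q3) * (Y (- (j + 1)) * X (- (m - 1)))
        + scal (q1 * q2 + q1 * q3 + q2 * q3) * (Y (- (j + 2)) * X (- (m - 2))) - Y (- (j + 3)) * X (- (m - 3)))
      \<in> toroidal_ideal q1 q2 q3"
      unfolding cubic_zw_expand cubic_wz_expand q fa.sc_one idx by (simp add: algebra_simps)
  qed
qed

text \<open>The action of the free algebra on the highest weight vector of the quotient by \<open>N\<close>.\<close>

definition hw_map :: "complex \<Rightarrow> complex \<Rightarrow> complex \<Rightarrow> (int \<Rightarrow> complex) \<Rightarrow> free_alg set set set \<Rightarrow> free_alg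
    \<Rightarrow> free_alg set set set" where
  "hw_map q1 q2 q3 p N x = N +>\<^bsub>universal_hw_module q1 q2 q3 p\<^esub>
     (hw_left_ideal q1 q2 q3 p +>\<^bsub>regular_module (toroidal q1 q2 q3)\<^esub> toroidal_class q1 q2 q3 x)"

definition hw_annihilator :: "complex \<Rightarrow> complex \<Rightarrow> complex \<Rightarrow> (int \<Rightarrow> complex) \<Rightarrow> free_alg set set set
    \<Rightarrow> free_alg set" where
  "hw_annihilator q1 q2 q3 p N
     = {x. hw_map q1 q2 q3 p N x = \<zero>\<^bsub>quot_module (universal_hw_module q1 q2 q3 p) N\<^esub>}"

lemma quot_component_eq_image: "quot_component q1 q2 q3 p N d = hw_map q1 q2 q3 p N ` FA_component d"
  by (simp add: quot_component_def universal_hw_component_def toroidal_component_def hw_map_def image_image)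

lemma hw_left_ideal_submodule:
  "submodule (hw_left_ideal q1 q2 q3 p) (toroidal q1 q2 q3) (regular_module (toroidal q1 q2 q3))"
  and hw_left_ideal_generators:
  "toroidal_class q1 q2 q3 ` (range (\<lambda>i. gen (F i)) \<union> range (\<lambda>i. gen (Psi i) - scal (p i))
      \<union> {gen PsiInv - scal (inverse (p 0))}) \<subseteq> hw_left_ideal q1 q2 q3 p"
proof -
  have "toroidal_class q1 q2 q3 ` X \<subseteq> carrier (toroidal q1 q2 q3)" for X
    using presents_regular_toroidal[of q1 q2 q3] by (auto simp: presents_def)
  note * = submodule_left_ideal_gen[OF presents_regular_toroidal this, folded hw_left_ideal_def]
  show "submodule (hw_left_ideal q1 q2 q3 p) (toroidal q1 q2 q3) (regular_module (toroidal q1 q2 q3))"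
    unfolding hw_left_ideal_def by (rule *(1))
  show "toroidal_class q1 q2 q3 ` (range (\<lambda>i. gen (F i)) \<union> range (\<lambda>i. gen (Psi i) - scal (p i))
      \<union> {gen PsiInv - scal (inverse (p 0))}) \<subseteq> hw_left_ideal q1 q2 q3 p"
    unfolding hw_left_ideal_def by (rule *(2))
qed

lemma presents_universal:
  "presents (toroidal q1 q2 q3) (toroidal_class q1 q2 q3) (universal_hw_module q1 q2 q3 p)
     (\<lambda>x. hw_left_ideal q1 q2 q3 p +>\<^bsub>regular_module (toroidal q1 q2 q3)\<^esub> toroidal_class q1 q2 q3 x)"
  unfolding universal_hw_module_def
  by (rule presents_quot_module[OF presents_regular_toroidal hw_left_ideal_submodule])

lemma presents_hw_map:
  assumes "submodule N (toroidal q1 q2 q3) (universal_hw_module q1 q2 q3 p)"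
  shows "presents (toroidal q1 q2 q3) (toroidal_class q1 q2 q3)
    (quot_module (universal_hw_module q1 q2 q3 p) N) (hw_map q1 q2 q3 p N)"
  using presents_quot_module[OF presents_universal assms] unfolding hw_map_def[abs_def] .

text \<open>A left ideal \<open>Z\<close> above the annihilator is the preimage of its image, which is a submodule; so
  irreducibility makes the annihilator maximal.\<close>

lemma hw_quotient_irreducible:
  assumes q: "q1 * q2 * q3 = 1" "\<And>m::nat. m > 0 \<Longrightarrow> q1 ^ m \<noteq> 1 \<and> q2 ^ m \<noteq> 1 \<and> q3 ^ m \<noteq> 1"
    and p0: "p 0 \<noteq> 0"
    and irr: "irreducible_quotient q1 q2 q3 p N"
  shows "hw_quotient scal (toroidal_ideal q1 q2 q3) q1 q2 q3 p (\<lambda>i. gen (E i)) (\<lambda>i. gen (F i))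
    (\<lambda>i. gen (Psi i)) (gen PsiInv) (hw_annihilator q1 q2 q3 p N)"
proof -
  define U where "U = toroidal q1 q2 q3"
  define M where "M = universal_hw_module q1 q2 q3 p"
  define V where "V = quot_module M N"
  define \<phi> where "\<phi> = hw_map q1 q2 q3 p N"
  define J where "J = hw_annihilator q1 q2 q3 p N"
  have N: "submodule N U M" and irr: "irreducible_module U V"
    using irr by (auto simp: irreducible_quotient_def U_def M_def V_def)
  have P: "presents U (toroidal_class q1 q2 q3) V \<phi>"
    unfolding U_def V_def M_def \<phi>_def by (rule presents_hw_map) (use N in \<open>simp add: U_def M_def\<close>)
  note p = P[unfolded presents_def]
  have J: "J = {x. \<phi> x = \<zero>\<^bsub>V\<^esub>}"
    by (simp add: J_def hw_annihilator_def \<phi>_def V_def M_def)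
  interpret V: abelian_group V
    using p by blast
  have zero_sub: "submodule {\<zero>\<^bsub>V\<^esub>} U V"
  proof -
    have "\<phi> (x + y) = \<zero>\<^bsub>V\<^esub>" if "\<phi> x = \<zero>\<^bsub>V\<^esub>" "\<phi> y = \<zero>\<^bsub>V\<^esub>" for x y
      using that p V.l_zero[OF V.zero_closed] by metis
    moreover have "\<phi> (a * x) = \<zero>\<^bsub>V\<^esub>" if "\<phi> x = \<zero>\<^bsub>V\<^esub>" for a x
    proof -
      have "\<phi> (a * x) = toroidal_class q1 q2 q3 a \<odot>\<^bsub>V\<^esub> \<phi> 0"
        using that p presents_zero[OF P] by metis
      also have "\<dots> = \<phi> (a * 0)"
        using p by blast
      finally show ?thesis
        using presents_zero[OF P] by simp
    qed
    ultimately show ?thesis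
      unfolding presents_submodule_iff[OF P] left_ideal_def using presents_zero[OF P] by auto
  qed
  have J_left: "left_ideal J"
    using zero_sub unfolding presents_submodule_iff[OF P] J by (simp add: vimage_def)
  have I_J: "toroidal_ideal q1 q2 q3 \<subseteq> J"
  proof
    fix x assume "x \<in> toroidal_ideal q1 q2 q3"
    then have "\<phi> x = \<phi> 0"
      unfolding \<phi>_def hw_map_def toroidal_class_eq_zero_iff[symmetric] by simp
    then show "x \<in> J"
      using presents_zero[OF P] by (simp add: J)
  qed
  have gen_J: "g \<in> J"
    if g: "g \<in> range (\<lambda>i. gen (F i)) \<union> range (\<lambda>i. gen (Psi i) - scal (p i)) \<union> {gen PsiInv
      - scal (inverse (p 0))}" for g
  proof -
    have "toroidal_class q1 q2 q3 g \<in> hw_left_ideal q1 q2 q3 p"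
      using hw_left_ideal_generators g by blast
    then have "hw_left_ideal q1 q2 q3 p +>\<^bsub>regular_module (toroidal q1 q2 q3)\<^esub> toroidal_class q1 q2 q3 g
      = hw_left_ideal q1 q2 q3 p"
      unfolding coset_eq_submodule_iff[OF presents_regular_toroidal hw_left_ideal_submodule] .
    also have "\<dots> = \<zero>\<^bsub>M\<^esub>"
      by (simp add: M_def universal_hw_module_def quot_module_def)
    also have "\<dots> \<in> N"
      using subgroup.one_closed[OF submodule.axioms(1)[OF N]] by simp
    finally have "\<phi> g = N"
      using coset_eq_submodule_iff[OF presents_universal N[unfolded U_def M_def]]
      by (simp add: \<phi>_def hw_map_def)
    then show ?thesis
      by (simp add: J V_def quot_module_def)
  qed
  interpret I: scalar_ideal scal "toroidal_ideal q1 q2 q3"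
    by (rule scalar_ideal_toroidal)
  have rels: "toroidal_rels q1 q2 q3 \<subseteq> toroidal_ideal q1 q2 q3"
    by (rule toroidal_rels_ideal)
  have plus: "(\<lambda>n. psi_plus (- n)) = pos_part (\<lambda>i. gen (Psi i))"
    by (auto simp: psi_plus_def pos_part_def fun_eq_iff)
  have minus: "(\<lambda>n. psi_minus (- n)) = neg_part (gen PsiInv) (\<lambda>i. gen (Psi i))"
    by (auto simp: psi_minus_def neg_part_def fun_eq_iff)
  have es: "(\<lambda>n. e_ser (- n)) = (\<lambda>i. gen (E i))" and fs: "(\<lambda>n. f_ser (- n)) = (\<lambda>i. gen (F i))"
    by (simp_all add: e_ser_def f_ser_def)
  show ?thesis
    unfolding J_def[symmetric]
  proof unfold_locales
    show "gen (Psi 0) * gen PsiInv - 1 \<in> toroidal_ideal q1 q2 q3"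
      "gen PsiInv * gen (Psi 0) - 1 \<in> toroidal_ideal q1 q2 q3"
      using rels unfolding toroidal_rels_def by blast+
    show "I.exchange (q1 + q2 + q3) (q1 * q2 + q1 * q3 + q2 * q3) (pos_part (\<lambda>i. gen (Psi i))) (\<lambda>i. gen (E i))"
      unfolding plus[symmetric] es[symmetric]
      by (rule exchange_e_imp[OF q(1)]) (use rels in \<open>auto simp: toroidal_rels_def\<close>)
    show "I.exchange (q1 + q2 + q3) (q1 * q2 + q1 * q3
      + q2 * q3) (neg_part (gen PsiInv) (\<lambda>i. gen (Psi i))) (\<lambda>i. gen (E i))"
      unfolding minus[symmetric] es[symmetric]
      by (rule exchange_e_imp[OF q(1)]) (use rels in \<open>auto simp: toroidal_rels_def\<close>)
    show "I.exchange (q1 * q2 + q1 * q3 + q2 * q3) (q1 + q2 + q3) (pos_part (\<lambda>i. gen (Psi i))) (\<lambda>i. gen (F i))"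
      unfolding plus[symmetric] fs[symmetric]
      by (rule exchange_f_imp[OF q(1)]) (use rels in \<open>auto simp: toroidal_rels_def\<close>)
    show "I.exchange (q1 * q2 + q1 * q3 + q2 * q3) (q1 + q2
      + q3) (neg_part (gen PsiInv) (\<lambda>i. gen (Psi i))) (\<lambda>i. gen (F i))"
      unfolding minus[symmetric] fs[symmetric]
      by (rule exchange_f_imp[OF q(1)]) (use rels in \<open>auto simp: toroidal_rels_def\<close>)
    fix i j
    have "comm (e_ser (- i)) (f_ser (- j))
        - scal (1 / ((1 - q1) * (1 - q2) * (1 - q3))) * (psi_plus (- i + - j) - psi_minus (- i + - j))
          \<in> toroidal_ideal q1 q2 q3"
      using rels unfolding toroidal_rels_def ef_rel_def by blast
    moreover have "psi_plus (- i + - j) = pos_part (\<lambda>i. gen (Psi i)) (i + j)"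
      "psi_minus (- i + - j) = neg_part (gen PsiInv) (\<lambda>i. gen (Psi i)) (i + j)"
      unfolding plus[symmetric] minus[symmetric] by simp_all
    ultimately show "gen (E i) * gen (F j) - gen (F j) * gen (E i) - scal (1 / ((1 - q1) * (1 - q2) * (1 - q3)))
        * (pos_part (\<lambda>i. gen (Psi i)) (i + j) - neg_part (gen PsiInv) (\<lambda>i. gen (Psi i)) (i + j))
          \<in> toroidal_ideal q1 q2 q3"
      by (simp add: comm_def e_ser_def f_ser_def)
  next
    fix Z a x
    assume Z: "fa.vs.subspace Z" "x \<in> Z"
      and clos: "\<And>g x. g \<in> range (\<lambda>i. gen (E i)) \<union> range (\<lambda>i. gen (F i)) \<union> range (\<lambda>i. gen (Psi i)) \<union> {gen PsiInv}
        \<Longrightarrow> x \<in> Z \<Longrightarrow> g * x \<in> Z"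
    show "a * x \<in> Z"
    proof (rule free_alg_generated[OF Z(1) _ Z(2)])
      fix g x assume "x \<in> Z"
      then show "gen g * x \<in> Z"
        by (cases g) (auto intro: clos)
    qed
  next
    show "fa.vs.subspace J"
      by (rule left_ideal_subspace[OF J_left])
    show "a * x \<in> J" if "x \<in> J" for x a
      using that J_left by (simp add: left_ideal_def)
    show "1 \<notin> J"
    proof
      assume "1 \<in> J"
      then have "\<phi> (x * 1) = \<zero>\<^bsub>V\<^esub>" for x
        using J_left unfolding left_ideal_def J by blast
      then have "carrier V = {\<zero>\<^bsub>V\<^esub>}"
        using p by auto
      then show False
        using irr by (simp add: irreducible_module_def)
    qed
    fix Z assume Z: "fa.vs.subspace Z" "\<And>a x. x \<in> Z \<Longrightarrow> a * x \<in> Z" "J \<subseteq> Z"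
    \<comment> \<open>\<open>Z\<close> is saturated because it contains the kernel \<open>J\<close>\<close>
    have sat: "x \<in> Z" if "\<phi> x = \<phi> z" "z \<in> Z" for x z
    proof -
      have "x - z \<in> Z"
        using that Z(3) presents_eq_iff[OF P] by (auto simp: J)
      from fa.vs.subspace_add[OF Z(1) this that(2)] show ?thesis
        by simp
    qed
    have pre: "\<phi> -` \<phi> ` Z = Z"
      using sat by blast
    have "\<phi> ` Z \<subseteq> carrier V"
      using p by blast
    moreover have "left_ideal Z"
      using Z fa.vs.subspace_0 fa.vs.subspace_add by (simp add: left_ideal_def)
    ultimately have "submodule (\<phi> ` Z) U V"
      unfolding presents_submodule_iff[OF P] pre by blast
    then consider "\<phi> ` Z = {\<zero>\<^bsub>V\<^esub>}" | "\<phi> ` Z = carrier V"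
      using irr unfolding irreducible_module_def by blast
    then show "Z = J \<or> Z = UNIV"
    proof cases
      case 1
      then have "Z \<subseteq> J"
        by (auto simp: J)
      with Z(3) show ?thesis
        by blast
    next
      case 2
      then have "\<phi> -` \<phi> ` Z = UNIV"
        using p by auto
      then show ?thesis
        using pre by simp
    qed
  qed (use q p0 I_J gen_J in auto)
qed

theorem proposition4p10:
  fixes q1 q2 q3 :: complex and p :: "int \<Rightarrow> complex" and N :: "free_alg set set set"
  assumes "q1 \<noteq> 0" "q2 \<noteq> 0" "q3 \<noteq> 0"
    and "q1 * q2 * q3 = 1"
    and "\<And>m::nat. m > 0 \<Longrightarrow> q1 ^ m \<noteq> 1 \<and> q2 ^ m \<noteq> 1 \<and> q3 ^ m \<noteq> 1"
    and "p 0 \<noteq> 0"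
    and "irreducible_quotient q1 q2 q3 p N"
  shows "finite_type q1 q2 q3 p N \<longleftrightarrow> rational_weight p"
proof -
  define J where "J = hw_annihilator q1 q2 q3 p N"
  interpret H: hw_quotient scal "toroidal_ideal q1 q2 q3" q1 q2 q3 p "\<lambda>i. gen (E i)" "\<lambda>i. gen (F i)"
    "\<lambda>i. gen (Psi i)" "gen PsiInv" J
    unfolding J_def by (rule hw_quotient_irreducible[OF assms(4-7)])
  have sub: "submodule N (toroidal q1 q2 q3) (universal_hw_module q1 q2 q3 p)"
    using assms(7) by (simp add: irreducible_quotient_def)
  have ft: "finite_type q1 q2 q3 p N
      \<longleftrightarrow> (\<forall>d. \<exists>B. finite B \<and> B \<subseteq> FA_component d \<and> FA_component d \<subseteq> fa.vs.span (B \<union> J))"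
    unfolding finite_type_def quot_component_eq_image finite_dim_iff[OF presents_hw_map[OF sub]]
      J_def hw_annihilator_def ..
  have eword: "H.eword js = Poly_Mapping.single (Word (map E js)) 1" for js
    by (simp add: H.eword_def single_word comp_def)
  have eword_component: "H.eword js \<in> FA_component (- int (length js))" for js
  proof -
    have "(\<Sum>g\<leftarrow>map E js. gen_deg g) = - int (length js)"
      by (induction js) auto
    then show ?thesis
      by (simp add: eword FA_component_def)
  qed
  \<comment> \<open>a space that contains the component of degree \<open>d\<close>; in positive degrees everything acts on the highest
    weight vector as 0\<close>
  define G where "G d = (if d \<le> 0 then H.level (nat (- d)) else J)" for d
  have G: "fa.vs.subspace (G d)" "J \<subseteq> G d" for d
    using H.subspace_level H.J_level H.subspace_J by (auto simp: G_def)
  have word_G: "prod_list (map gen gs) \<in> G (\<Sum>g\<leftarrow>gs. gen_deg g)" for gs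
  proof (induction gs)
    case Nil
    show ?case
      using H.eword_level[of "[]"] by (simp add: G_def H.eword_Nil)
  next
    case (Cons g gs)
    define s where "s = (\<Sum>g\<leftarrow>gs. gen_deg g)"
    define x where "x = prod_list (map gen gs)"
    have x: "x \<in> G s"
      using Cons by (simp add: s_def x_def)
    have "gen g * x \<in> G (gen_deg g + s)"
    proof (cases "s > 0")
      case True
      then have "gen g * x \<in> J"
        using x H.left_J by (simp add: G_def)
      then show ?thesis
        using G(2) by blast
    next
      case False
      then have x: "x \<in> H.level (nat (- s))"
        using x by (simp add: G_def)
      show ?thesis
      proof (cases g)
        case (E i)
        have "nat (1 - s) = Suc (nat (- s))"
          using False by simp
        then show ?thesis
          using H.e_level[OF x, of i] E False by (simp add: G_def)
      next
        case (F i)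
        show ?thesis
        proof (cases "s = 0")
          case True
          then show ?thesis
            using H.f_level_0[of x i] x F by (simp add: G_def)
        next
          case s: False
          then have "nat (- s) = Suc (nat (- (1 + s)))"
            using False by simp
          then show ?thesis
            using H.f_level_Suc[of x "nat (- (1 + s))" i] x F False s by (simp add: G_def)
        qed
      next
        case (Psi i)
        then show ?thesis
          using H.cartan_level[OF _ x, of "gen (Psi i)"] False by (simp add: G_def H.cartan_def)
      next
        case PsiInv
        then show ?thesis
          using H.cartan_level[OF _ x, of "gen PsiInv"] False by (simp add: G_def H.cartan_def)
      qed
    qed
    then show ?case
      by (simp add: x_def s_def)
  qed
  have component_G: "FA_component d \<subseteq> G d" for d
  proof
    fix x assume x: "x \<in> FA_component d"
    have "(\<Sum>u\<in>Poly_Mapping.keys x. scal (Poly_Mapping.lookup x u) * prod_list (map gen (letters u))) \<in> G d"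
    proof (intro fa.vs.subspace_sum[OF G(1)] fa.vs.subspace_scale[OF G(1)])
      fix u assume "u \<in> Poly_Mapping.keys x"
      then have "(\<Sum>g\<leftarrow>letters u. gen_deg g) = d"
        using x by (simp add: FA_component_def)
      then show "prod_list (map gen (letters u)) \<in> G d"
        using word_G[of "letters u"] by simp
    qed
    then show "x \<in> G d"
      by (simp flip: free_alg_expand)
  qed
  show ?thesis
    unfolding ft rational_weight_iff_recurrent[of p, OF assms(6)]
  proof
    assume "\<forall>d. \<exists>B. finite B \<and> B \<subseteq> FA_component d \<and> FA_component d \<subseteq> fa.vs.span (B \<union> J)"
    then obtain B where B: "finite B" "FA_component (- 1) \<subseteq> fa.vs.span (B \<union> J)"
      by blast
    have "gen (E i) \<in> FA_component (- 1)" for i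
      using eword_component[of "[i]"] by (simp add: H.eword_def)
    then show "\<exists>A. A \<noteq> 0 \<and> recurrent A (weight_gap p)"
      using B by (intro H.recurrent_of_finite_span[of B]) auto
  next
    assume "\<exists>A. A \<noteq> 0 \<and> recurrent A (weight_gap p)"
    then obtain A where A: "recurrent A (weight_gap p)" "coeff A 0 \<noteq> 0"
      using recurrent_strip by blast
    show "\<forall>d. \<exists>B. finite B \<and> B \<subseteq> FA_component d \<and> FA_component d \<subseteq> fa.vs.span (B \<union> J)"
    proof
      fix d
      show "\<exists>B. finite B \<and> B \<subseteq> FA_component d \<and> FA_component d \<subseteq> fa.vs.span (B \<union> J)"
      proof (cases "d \<le> 0")
        case True
        define k where "k = nat (- d)"
        obtain B where B: "finite B" "B \<subseteq> H.eword ` {js. length js = k}" "H.level k \<subseteq> fa.vs.span (B \<union> J)"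
          using H.finite_span_of_recurrent[OF A] by blast
        have "H.eword js \<in> FA_component d" if "length js = k" for js
          using eword_component[of js] that True by (simp add: k_def)
        then have "B \<subseteq> FA_component d"
          using B(2) by blast
        moreover have "FA_component d \<subseteq> H.level k"
          using component_G[of d] True by (simp add: G_def k_def)
        ultimately show ?thesis
          using B(1,3) by blast
      next
        case False
        then have "FA_component d \<subseteq> fa.vs.span ({} \<union> J)"
          using component_G[of d] by (auto simp: G_def intro: fa.vs.span_base)
        then show ?thesis
          by blast
      qed
    qed
  qed
qed

end
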